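(* Let $\alpha>0$, $\beta\geq 1$, let $\mu$ be a positive Borel measure on $[0,1]$ and let $\Lambda$ be a quasi-lacunary sequence. Let $p,q$ satisfy $\beta\leq p<q<+\infty$, let $r\in(p,q)$ and let $\theta\in(0,1)$ be such that $\frac1r=\frac{1-\theta}{p}+\frac{\theta}{q}$. Let $T$ be a sublinear operator acting on $M_\Lambda$. Assume that $T$ is of restricted weak type $p$ and $q$ with constants satisfying $C_p(k)\leq C_p<\infty$ and $C_q(k)\leq C_q<\infty$ for all $k\geq 0$. Then: (i) $T$ is of strong type $r$, and $C_r\leq C_p^{1-\theta}C_q^{\theta}$. (ii) If moreover $C_p(k)\to 0$ or $C_q(k)\to 0$ as $k\to\infty$, then $T$ is a compact operator.
   Context: $\Lambda=\{\lambda_k\}_{k\geq 0}$ is an increasing sequence of positive real numbers with $\sum_{k\ge0}1/\lambda_k<\infty$. $M_\Lambda$ is the space of functions on $[0,1]$ of the form $f(t)=\sum_{k=0}^K a_kt^{\lambda_k}$, $a_k\in\mathbb C$, $K\geq 0$. $\Lambda$ is quasi-lacunary if there exist $N\geq1$ and $q_0>1$ such that $\Lambda$ is the disjoint union of blocks $E_k=\{\lambda_{n_k+1},\dots,\lambda_{n_{k+1}}\}$, $k\ge 0$ (with $(n_k)_{k\geq 0}$ a strictly increasing sequence of integers, $n_0=-1$), with $\#E_k\leq N$ and $\lambda_{n_{k+1}}/\lambda_{n_k}>q_0$ for $k$ large enough. Such a decomposition is fixed, and $F_k=\operatorname{Span}\{t^\lambda:\lambda\in E_k\}$. $\mathrm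 d\nu_{\alpha-1}=(1-x)^{\alpha-1}\mathrm dx$ on $[0,1]$. A sublinear operator $T$ acting on $M_\Lambda$ maps elements of $M_\Lambda$ to ($\mu$-measurable) functions on $[0,1]$ and satisfies $|T(cf)|=|c||Tf|$, $|T(f+g)|\leq|Tf|+|Tg|$ and $|Tf-Tg|\leq|T(f-g)|$ for all $f,g\in M_\Lambda$, $c\in\mathbb C$. With $\alpha,\beta,\mu$ given, $T$ is of strong type $r$ if there is a constant $C_r>0$ such that $\|Tf\|_{L^r(\mathrm d\mu)}\leq C_r\|f\|_{L^{r/\beta}(\mathrm d\nu_{\alpha-1})}$ for all $f\in M_\Lambda$; $C_r$ in (i) denotes the constant in this inequality. $T$ is of restricted weak type $s$ if for every $k\geq0$ there is a constant $C_s(k)>0$ such that for every $f_k\in F_k$ and every $\lambda>0$, $\mu(|Tf_k|>\lambda)\leq C_s(k)^s\lambda^{-s}\|f_k\|^s_{L^{s/\beta}(\mathrm d\nu_{\alpha-1})}$. Compactness of $T$ is understood for $T$ from $M_\Lambda$, with the norm of $L^{r/\beta}(\mathrm d\nu_{\alpha-1})$, to $L^r(\mathrm d\mu)$.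
   Formalization: The bound in (i) holds up to a factor depending only on α, β, Λ, its blocks, p, q, r (it fails with factor 1), and the fixed blocks must satisfy λ_{n_k+1}/λ_{n_k} > q_0' > 1 for large k (else (i) can fail); every quasi-lacunary Λ has such blocks. *)

theory Defs
  imports "HOL-Analysis.Analysis"
begin

(* The norm of f in L^s(M), 0 < s < \<infinity>. The Bochner integral of a non-integrable function
   is 0, so the value is meaningful only together with memLp. *)
definition Lnorm :: "real measure \<Rightarrow> real \<Rightarrow> (real \<Rightarrow> complex) \<Rightarrow> real" where
  "Lnorm M s f = (\<integral>x. norm (f x) powr s \<partial>M) powr (1 / s)"

definition memLp :: "real measure \<Rightarrow> real \<Rightarrow> (real \<Rightarrow> complex) \<Rightarrow> bool" where
  "memLp M s f \<longleftrightarrow> f \<in> borel_measurable M \<and> integrable M (\<lambda>x. norm (f x) powr s)"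

(* The measure (1 - x)^a dx on [0,1]. *)
definition nu :: "real \<Rightarrow> real measure" where
  "nu a = density (restrict_space lborel {0..1}) (\<lambda>x. ennreal ((1 - x) powr a))"

(* The function \<Sum>k\<in>A. a k * t^(lam k) on [0,1]. A function on [0,1] is represented by its
   extension by 0 to the real line, so equality of functions is equality on [0,1]. *)
definition muntz_poly :: "(nat \<Rightarrow> real) \<Rightarrow> nat set \<Rightarrow> (nat \<Rightarrow> complex) \<Rightarrow> real \<Rightarrow> complex" where
  "muntz_poly lam A a t =
     (if t \<in> {0..1} then \<Sum>k\<in>A. a k * complex_of_real (t powr lam k) else 0)"

definition muntz_space :: "(nat \<Rightarrow> real) \<Rightarrow> (real \<Rightarrow> complex) set" where
  "muntz_space lam = {f. \<exists>K a. f = muntz_poly lam {..K} a}"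

(* A decomposition into consecutive blocks is given by m k = n_k + 1, so that m 0 = 0 and the
   k-th block E_k = {lam (n_k + 1), ..., lam n_(k+1)} has the indices m k, ..., m (Suc k) - 1.
   The last element of the block preceding E_k is lam (m k - 1). *)
definition quasi_lacunary_blocks :: "(nat \<Rightarrow> real) \<Rightarrow> (nat \<Rightarrow> nat) \<Rightarrow> bool" where
  "quasi_lacunary_blocks lam m \<longleftrightarrow>
     strict_mono m \<and> m 0 = 0 \<and>
     (\<exists>N\<ge>1. \<forall>k. card {m k..<m (Suc k)} \<le> N) \<and>
     (\<exists>q0>1. eventually (\<lambda>k. lam (m (Suc k) - 1) / lam (m k - 1) > q0) sequentially)"

definition quasi_lacunary :: "(nat \<Rightarrow> real) \<Rightarrow> bool" where
  "quasi_lacunary lam \<longleftrightarrow> (\<exists>m. quasi_lacunary_blocks lam m)"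

(* Successive blocks are separated: the first element of a block is at least q0 times the last
   element of the preceding one. This is not automatic for quasi_lacunary_blocks, which allows
   the end of a block and the start of the next one to be arbitrarily close; the spaces spanned
   by two such blocks may then be almost parallel. Every quasi-lacunary sequence has separated
   blocks, see quasi_lacunary_imp_separated_blocks below. *)
definition separated_blocks :: "(nat \<Rightarrow> real) \<Rightarrow> (nat \<Rightarrow> nat) \<Rightarrow> bool" where
  "separated_blocks lam m \<longleftrightarrow>
     (\<exists>q0>1. eventually (\<lambda>k. lam (m k) / lam (m k - 1) > q0) sequentially)"

definition block_space :: "(nat \<Rightarrow> real) \<Rightarrow> (nat \<Rightarrow> nat) \<Rightarrow> nat \<Rightarrow> (real \<Rightarrow> complex) set" where
  "block_space lam m k = {f. \<exists>a. f = muntz_poly lam {m k..<m (Suc k)} a}"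

(* Measurable functions are identified when they agree almost everywhere, so the pointwise
   conditions are required almost everywhere. *)
definition sublinear_operator ::
  "real measure \<Rightarrow> (nat \<Rightarrow> real) \<Rightarrow> ((real \<Rightarrow> complex) \<Rightarrow> real \<Rightarrow> complex) \<Rightarrow> bool" where
  "sublinear_operator M lam T \<longleftrightarrow>
     (\<forall>f\<in>muntz_space lam. T f \<in> borel_measurable M) \<and>
     (\<forall>f\<in>muntz_space lam. \<forall>c. AE x in M. norm (T (\<lambda>t. c * f t) x) = norm c * norm (T f x)) \<and>
     (\<forall>f\<in>muntz_space lam. \<forall>g\<in>muntz_space lam.
        (AE x in M. norm (T (\<lambda>t. f t + g t) x) \<le> norm (T f x) + norm (T g x)) \<and>
        (AE x in M. norm (T f x - T g x) \<le> norm (T (\<lambda>t. f t - g t) x)))"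

(* T is of strong type r with constant C. *)
definition strong_type ::
  "real \<Rightarrow> real \<Rightarrow> real measure \<Rightarrow> (nat \<Rightarrow> real) \<Rightarrow> ((real \<Rightarrow> complex) \<Rightarrow> real \<Rightarrow> complex)
     \<Rightarrow> real \<Rightarrow> real \<Rightarrow> bool" where
  "strong_type \<alpha> \<beta> M lam T r C \<longleftrightarrow> C > 0 \<and>
     (\<forall>f\<in>muntz_space lam. memLp M r (T f) \<and>
        Lnorm M r (T f) \<le> C * Lnorm (nu (\<alpha> - 1)) (r / \<beta>) f)"

(* T is of restricted weak type s with constants C k, k \<ge> 0. *)
definition restricted_weak_type ::
  "real \<Rightarrow> real \<Rightarrow> real measure \<Rightarrow> (nat \<Rightarrow> real) \<Rightarrow> (nat \<Rightarrow> nat)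
     \<Rightarrow> ((real \<Rightarrow> complex) \<Rightarrow> real \<Rightarrow> complex) \<Rightarrow> real \<Rightarrow> (nat \<Rightarrow> real) \<Rightarrow> bool" where
  "restricted_weak_type \<alpha> \<beta> M lam m T s C \<longleftrightarrow>
     (\<forall>k. C k > 0 \<and>
        (\<forall>f\<in>block_space lam m k. \<forall>l>0.
           emeasure M {x \<in> space M. norm (T f x) > l} \<le>
             ennreal (C k powr s * l powr (- s) * Lnorm (nu (\<alpha> - 1)) (s / \<beta>) f powr s)))"

(* T, from the Muntz space with the norm of L^(r/\<beta>)(nu (\<alpha> - 1)) to L^r(M), maps bounded sets to
   relatively compact sets. *)
definition compact_operator ::
  "real \<Rightarrow> real \<Rightarrow> real measure \<Rightarrow> (nat \<Rightarrow> real) \<Rightarrow> ((real \<Rightarrow> complex) \<Rightarrow> real \<Rightarrow> complex)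
     \<Rightarrow> real \<Rightarrow> bool" where
  "compact_operator \<alpha> \<beta> M lam T r \<longleftrightarrow>
     (\<forall>f\<in>muntz_space lam. memLp M r (T f)) \<and>
     (\<forall>f :: nat \<Rightarrow> real \<Rightarrow> complex.
        (\<forall>i. f i \<in> muntz_space lam) \<and> (\<exists>B. \<forall>i. Lnorm (nu (\<alpha> - 1)) (r / \<beta>) (f i) \<le> B) \<longrightarrow>
        (\<exists>\<sigma> g. strict_mono \<sigma> \<and> memLp M r g \<and>
           (\<lambda>i. Lnorm M r (\<lambda>x. T (f (\<sigma> i)) x - g x)) \<longlonglongrightarrow> 0))"

lemma ratio_le_power:
  fixes lam :: "nat \<Rightarrow> real"
  assumes pos: "\<And>k. lam k > 0" and Q: "Q \<ge> 1"
    and step: "\<And>i. a < i \<Longrightarrow> i \<le> a + d \<Longrightarrow> lam i / lam (i - 1) \<le> Q"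
  shows "lam (a + d) / lam a \<le> Q ^ d"
  using step
proof (induction d)
  case 0
  then show ?case using pos[of a] by simp
next
  case (Suc d)
  have "lam (a + Suc d) / lam a = (lam (a + Suc d) / lam (a + d)) * (lam (a + d) / lam a)"
    using pos[of "a + d"] by simp
  also have "\<dots> \<le> Q * Q ^ d"
  proof (rule mult_mono)
    show "lam (a + Suc d) / lam (a + d) \<le> Q" using Suc.prems[of "a + Suc d"] by simp
    show "lam (a + d) / lam a \<le> Q ^ d" using Suc.IH Suc.prems by simp
    show "0 \<le> lam (a + d) / lam a" using pos by (simp add: less_imp_le)
  qed (use Q in simp)
  finally show ?case by simp
qed

lemma quasi_lacunary_imp_separated_blocks:
  assumes pos: "\<And>k. lam k > 0" and mono: "strict_mono lam" and ql: "quasi_lacunary lam"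
  shows "\<exists>m. quasi_lacunary_blocks lam m \<and> separated_blocks lam m"
proof -
  from ql obtain m N q0 where m: "strict_mono m" "m 0 = 0" and N: "N \<ge> 1"
    and card: "\<And>k. card {m k..<m (Suc k)} \<le> N" and q0: "q0 > 1"
    and ev: "eventually (\<lambda>k. lam (m (Suc k) - 1) / lam (m k - 1) > q0) sequentially"
    unfolding quasi_lacunary_def quasi_lacunary_blocks_def by blast
  from ev obtain k0 where k0: "\<And>k. k \<ge> k0 \<Longrightarrow> lam (m (Suc k) - 1) / lam (m k - 1) > q0"
    unfolding eventually_sequentially by blast
  define Q where "Q = root N q0"
  have Q1: "Q > 1" using q0 N by (simp add: Q_def)
  have QN: "Q ^ N = q0" using q0 N by (simp add: Q_def)
  have size: "m (Suc k) \<le> m k + N" for k using card[of k] by simp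
  have mS: "m k < m (Suc k)" for k using m(1) by (simp add: strict_mono_Suc_iff)
  have mpos: "m (k0 + Suc j) > 0" for j
    using mS[of "k0 + j"] by simp
  have "\<exists>i. m (k0 + Suc j) \<le> i \<and> i < m (Suc (k0 + Suc j)) \<and> lam i / lam (i - 1) > Q" for j
  proof (rule ccontr)
    let ?k = "k0 + Suc j"
    assume neg: "\<not> ?thesis"
    define a d where "a = m ?k - 1" and "d = m (Suc ?k) - m ?k"
    have ad: "a + d = m (Suc ?k) - 1" using mpos[of j] mS[of ?k] by (simp add: a_def d_def)
    have "lam (a + d) / lam a \<le> Q ^ d"
    proof (rule ratio_le_power[OF pos])
      fix i assume "a < i" "i \<le> a + d"
      then have "m ?k \<le> i" "i < m (Suc ?k)" using ad a_def mpos[of j] mS[of ?k] by linarith+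
      then show "lam i / lam (i - 1) \<le> Q" using neg by (meson not_le)
    qed (use Q1 in simp)
    also have "\<dots> \<le> Q ^ N"
      using Q1 size[of ?k] by (intro power_increasing) (auto simp: d_def)
    finally show False using k0[of ?k] ad QN by (simp add: a_def)
  qed
  then obtain i where i: "\<And>j. m (k0 + Suc j) \<le> i j" "\<And>j. i j < m (Suc (k0 + Suc j))"
    "\<And>j. lam (i j) / lam (i j - 1) > Q" by metis
  define c where "c k = (case k of 0 \<Rightarrow> 0 | Suc j \<Rightarrow> i j)" for k
  have iS: "i j < i (Suc j)" for j using i(1)[of "Suc j"] i(2)[of j] by simp
  have cS: "c k < c (Suc k)" for k
    using mpos[of 0] i(1)[of 0] iS by (auto simp: c_def split: nat.split)
  have bound: "card {c k..<c (Suc k)} \<le> max (i 0) (2 * N)" for k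
  proof (cases k)
    case 0
    then show ?thesis by (simp add: c_def)
  next
    case (Suc j)
    have "i (Suc j) < m (k0 + Suc j) + N + N"
      using i(2)[of "Suc j"] size[of "k0 + Suc j"] size[of "Suc (k0 + Suc j)"] by simp
    then show ?thesis using i(1)[of j] Suc by (simp add: c_def)
  qed
  have gap: "lam (c k) / lam (c k - 1) > Q" if "k \<ge> 1" for k
    using i(3) that by (cases k) (auto simp: c_def)
  have gap': "lam (c (Suc k) - 1) / lam (c k - 1) > Q" if "k \<ge> 1" for k
  proof -
    have "c k \<le> c (Suc k) - 1" using cS[of k] by simp
    then have "lam (c k) \<le> lam (c (Suc k) - 1)"
      using mono by (simp add: strict_mono_less_eq)
    then have "lam (c k) / lam (c k - 1) \<le> lam (c (Suc k) - 1) / lam (c k - 1)"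
      using pos by (simp add: divide_right_mono less_imp_le)
    with gap[OF that] show ?thesis by linarith
  qed
  have "quasi_lacunary_blocks lam c"
    unfolding quasi_lacunary_blocks_def
  proof (intro conjI)
    show "strict_mono c" using cS by (simp add: strict_mono_Suc_iff)
    show "c 0 = 0" by (simp add: c_def)
    show "\<exists>N\<ge>1. \<forall>k. card {c k..<c (Suc k)} \<le> N"
      using bound N by (intro exI[of _ "max (i 0) (2 * N)"]) auto
    show "\<exists>q0>1. eventually (\<lambda>k. lam (c (Suc k) - 1) / lam (c k - 1) > q0) sequentially"
      using Q1 gap' unfolding eventually_sequentially by blast
  qed
  moreover have "separated_blocks lam c"
    using Q1 gap unfolding separated_blocks_def eventually_sequentially by blast
  ultimately show ?thesis by blast
qed

end

theory Submission
  imports Defs "HOL-Computational_Algebra.Polynomial"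
begin

text \<open>
Every Muntz polynomial is expanded in functions \<open>e\<^sub>i\<close>, one for each exponent and each in the span
of a single block, say \<open>f = (\<Sum>i. b\<^sub>i * e\<^sub>i)\<close>. Let \<open>w\<^sub>i\<close> be a lacunary sequence comparable to the
exponents. The theorem follows from three estimates, with constants that depend only on the
exponents, their blocks and \<open>\<alpha>, \<beta>, p, q, r\<close>.

\<^item> \<open>e\<^sub>i\<close> is bounded and lives where \<open>1 - t\<close> is at most of order \<open>1 / w\<^sub>i\<close>, so the integral of
  \<open>\<bar>e\<^sub>i\<bar> powr s\<close> is of order at most \<open>w\<^sub>i powr (- \<alpha>)\<close>, for every \<open>s\<close> (\<open>Lnorm_basis_fun_le\<close>).

\<^item> Conversely \<open>\<Sum>i. \<bar>b\<^sub>i\<bar> powr s * w\<^sub>i powr (- \<alpha>)\<close> is bounded by a multiple of the integral of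
  \<open>\<bar>f\<bar> powr s\<close>, for \<open>s \<ge> 1\<close> (\<open>sum_coeff_powr_le_Lnorm\<close>).

\<^item> By the first estimate the restricted weak types say that \<open>\<bar>T e\<^sub>i\<bar> > l\<close> on a set of measure at
  most a multiple of \<open>min (C\<^sub>p\<^sup>p * l powr (- p)) (C\<^sub>q\<^sup>q * l powr (- q)) * w\<^sub>i powr (- \<alpha> * \<beta>)\<close>. Because
  the sequence \<open>w\<close> is lacunary, a version of Marcinkiewicz interpolation for sums gives
  \<open>\<integral> (\<Sum>i. \<bar>b\<^sub>i\<bar> * \<bar>T e\<^sub>i\<bar>) powr r \<le> C * (C\<^sub>p powr (1 - \<theta>) * C\<^sub>q powr \<theta>) powr r * (\<Sum>i. \<bar>b\<^sub>i\<bar> powr r * w\<^sub>i powr (- \<alpha> * \<beta>))\<close>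
  (\<open>nn_integral_weak_type_sum_le\<close>).

With \<open>s = r / \<beta>\<close> and \<open>\<beta> \<ge> 1\<close>, the last sum is at most the power \<open>\<beta>\<close> of the sum in the second
estimate, and part (i) follows by sublinearity. For part (ii), the interpolation constant of the
terms with large \<open>i\<close> is small, while the coordinates of a bounded sequence converge along a
subsequence; hence the images under \<open>T\<close> form a Cauchy sequence (\<open>compact_operator_if_tails_small\<close>).

The second estimate is the heart of the matter. Exponents of the same block may be arbitrarily close,
so \<open>e\<^sub>i\<close> is not a power of \<open>t\<close> but a divided difference of powers, taken over a group of comparable
exponents that starts after a gap. To read off \<open>b\<^sub>i\<close>, put \<open>t = exp (- u)\<close> and integrate against a
combination of the exponentials \<open>exp (- w\<^sub>n * u)\<close> whose Laplace transform is a rational function with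
poles at the \<open>- w\<^sub>n\<close> and zeros at the exponents to be removed. The zeros may cluster but the poles do
not, and this keeps the residues under control (\<open>residue_le\<close>). Averaging over translations turns the
resulting bound into \<open>\<bar>b\<^sub>i\<bar> \<le> C * \<integral> \<bar>f (exp (- u))\<bar> * exp (- \<kappa> * u) / u\<close> over \<open>u \<ge> c / w\<^sub>i\<close>
(\<open>coeff_le_hardy_tail\<close>), and Hardy's inequality does the rest (\<open>sum_coeff_powr_le\<close>).
\<close>

section \<open>Convexity inequalities\<close>

text \<open>The graph of \<open>t powr s\<close> lies above its tangent at \<open>a\<close>. The inequalities of Jensen type below,
for sums and for integrals, come from this one by taking a mean value for \<open>a\<close>.\<close>

lemma powr_tangent_le:
  fixes a t s :: real
  assumes a: "a > 0" and t: "t \<ge> 0" and s: "s \<ge> 1"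
  shows "s * a powr (s - 1) * t \<le> t powr s + (s - 1) * a powr s"
proof (cases "s = 1")
  case True
  then show ?thesis using a t by simp
next
  case False
  with s have s1: "s > 1" by simp
  define q where "q = s / (s - 1)"
  have q: "q > 1" "1 / s + 1 / q = 1" using s1 by (auto simp: q_def field_simps)
  have "t * a powr (s - 1) \<le> t powr s / s + (a powr (s - 1)) powr q / q"
    using s1 q t a by (intro Youngs_inequality) auto
  also have "(a powr (s - 1)) powr q = a powr s" using s1 by (simp add: powr_powr q_def)
  finally have "s * (t * a powr (s - 1)) \<le> s * (t powr s / s + a powr s / q)"
    using s1 by (intro mult_left_mono) auto
  also have "\<dots> = t powr s + (s - 1) * a powr s" using s1 by (simp add: q_def field_simps)
  finally show ?thesis by (simp add: mult_ac)
qed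

lemma powr_sum_le_weighted:
  fixes y z :: "'a \<Rightarrow> real"
  assumes fin: "finite S" and y: "\<And>i. i \<in> S \<Longrightarrow> y i > 0" and z: "\<And>i. i \<in> S \<Longrightarrow> z i \<ge> 0"
    and s: "s \<ge> 1"
  shows "(\<Sum>i\<in>S. y i * z i) powr s \<le> (\<Sum>i\<in>S. y i) powr (s - 1) * (\<Sum>i\<in>S. y i * z i powr s)"
proof (cases "(\<Sum>i\<in>S. y i * z i) = 0")
  case True
  then show ?thesis using y z s by (auto intro!: mult_nonneg_nonneg sum_nonneg simp: less_imp_le)
next
  case False
  define B where "B = (\<Sum>i\<in>S. y i * z i)"
  define Y where "Y = (\<Sum>i\<in>S. y i)"
  have B0: "B > 0" using False y z by (auto simp: B_def less_le intro!: sum_nonneg)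
  then have "S \<noteq> {}" by (auto simp: B_def)
  then have Y0: "Y > 0" using fin y by (auto simp: Y_def intro!: sum_pos)
  define a where "a = B / Y"
  have a0: "a > 0" using B0 Y0 by (simp add: a_def)
  have "(\<Sum>i\<in>S. y i * (s * a powr (s - 1) * z i)) \<le> (\<Sum>i\<in>S. y i * (z i powr s + (s - 1) * a powr s))"
    using y z s a0 by (intro sum_mono mult_left_mono powr_tangent_le) (auto simp: less_imp_le)
  also have "(\<Sum>i\<in>S. y i * (s * a powr (s - 1) * z i)) = s * a powr (s - 1) * B"
    by (simp add: B_def sum_distrib_left mult_ac)
  also have "(\<Sum>i\<in>S. y i * (z i powr s + (s - 1) * a powr s))
      = (\<Sum>i\<in>S. y i * z i powr s) + Y * ((s - 1) * a powr s)"
    by (simp add: Y_def sum_distrib_right sum.distrib distrib_left)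
  also have "a powr s = a powr (s - 1) * a" using a0 by (simp add: powr_diff)
  also have "Y * ((s - 1) * (a powr (s - 1) * a)) = (s - 1) * a powr (s - 1) * B"
    using Y0 by (simp add: a_def)
  finally have *: "a powr (s - 1) * B \<le> (\<Sum>i\<in>S. y i * z i powr s)" by (simp add: algebra_simps)
  have "B powr s = Y powr (s - 1) * (a powr (s - 1) * B)"
    using B0 Y0 by (simp add: a_def powr_divide powr_diff)
  also have "\<dots> \<le> Y powr (s - 1) * (\<Sum>i\<in>S. y i * z i powr s)"
    using * by (intro mult_left_mono) auto
  finally show ?thesis by (simp add: B_def Y_def)
qed

lemma powr_add_le:
  fixes a b r :: real
  assumes "a \<ge> 0" "b \<ge> 0" "r \<ge> 1"
  shows "(a + b) powr r \<le> 2 powr (r - 1) * (a powr r + b powr r)"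
  using powr_sum_le_weighted[of "{True, False}" "\<lambda>_. 1" "\<lambda>x. if x then a else b" r] assms by simp

text \<open>This is the step from the power \<open>r\<close> of the coefficients to the power \<open>r / \<beta>\<close>, applied with the
exponent \<open>\<beta> \<ge> 1\<close>.\<close>

lemma sum_powr_le_powr_sum:
  fixes a :: "'a \<Rightarrow> real"
  assumes fin: "finite S" and a: "\<And>i. i \<in> S \<Longrightarrow> a i \<ge> 0" and s: "s \<ge> 1"
  shows "(\<Sum>i\<in>S. a i powr s) \<le> (\<Sum>i\<in>S. a i) powr s"
proof -
  define Y where "Y = (\<Sum>i\<in>S. a i)"
  have le: "a i \<le> Y" if "i \<in> S" for i using member_le_sum[of i S a] fin a that by (auto simp: Y_def)
  have "(\<Sum>i\<in>S. a i powr s) \<le> (\<Sum>i\<in>S. a i * Y powr (s - 1))"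
  proof (intro sum_mono)
    fix i assume i: "i \<in> S"
    show "a i powr s \<le> a i * Y powr (s - 1)"
    proof (cases "a i = 0")
      case False
      then have "a i > 0" using a[OF i] by simp
      then have "a i powr s = a i * a i powr (s - 1)" by (simp add: powr_diff)
      also have "\<dots> \<le> a i * Y powr (s - 1)"
        using a[OF i] le[OF i] s by (intro mult_left_mono powr_mono2) auto
      finally show ?thesis .
    qed (use s in simp)
  qed
  also have "\<dots> = Y * Y powr (s - 1)" by (simp add: Y_def sum_distrib_right)
  also have "\<dots> = Y powr s"
  proof (cases "Y = 0")
    case False
    then have "Y > 0" using a by (simp add: Y_def less_le sum_nonneg)
    then show ?thesis by (simp add: powr_diff)
  qed simp
  finally show ?thesis by (simp add: Y_def)
qed

section \<open>Sums along lacunary sequences\<close>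

lemma sum_power_inj_le:
  fixes x :: real
  assumes fin: "finite J" and inj: "inj_on f J" and x: "0 \<le> x" "x < 1"
  shows "(\<Sum>j\<in>J. x ^ f j) \<le> 1 / (1 - x)"
proof -
  have "(\<Sum>j\<in>J. x ^ f j) = (\<Sum>k\<in>f ` J. x ^ k)" using inj by (simp add: sum.reindex)
  also have "\<dots> \<le> (\<Sum>k. x ^ k)"
    using fin x by (intro sum_le_suminf summable_geometric) auto
  also have "\<dots> = 1 / (1 - x)" using x by (simp add: suminf_geometric)
  finally show ?thesis .
qed

lemma sum_split_filter:
  assumes "finite J"
  shows "(\<Sum>j\<in>J. f j) = (\<Sum>j\<in>{j\<in>J. P j}. f j) + (\<Sum>j\<in>{j\<in>J. \<not> P j}. f j)"
  using assms by (subst sum.union_disjoint[symmetric]) (auto intro!: sum.cong)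

lemma sum_power_dist_le:
  fixes x :: real
  assumes fin: "finite J" and x: "0 \<le> x" "x < 1"
  shows "(\<Sum>j\<in>J. x ^ ((n - j) + (j - n))) \<le> 2 / (1 - x)"
proof -
  have "(\<Sum>j\<in>J. x ^ ((n - j) + (j - n)))
     = (\<Sum>j\<in>{j\<in>J. j \<le> n}. x ^ (n - j)) + (\<Sum>j\<in>{j\<in>J. \<not> j \<le> n}. x ^ (j - n))"
    by (subst sum_split_filter[OF fin, of _ "\<lambda>j. j \<le> n"]) simp
  also have "\<dots> \<le> 1 / (1 - x) + 1 / (1 - x)"
    using fin x by (intro add_mono sum_power_inj_le) (auto intro!: inj_onI)
  finally show ?thesis by simp
qed

text \<open>Because \<open>w\<close> grows at least geometrically, sums over initial or final segments of indices are
comparable to their largest term.\<close>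

locale lacunary =
  fixes w :: "nat \<Rightarrow> real" and \<rho> :: real
  assumes \<rho>: "1 < \<rho>" and w0: "0 < w 0" and w_step: "\<rho> * w n \<le> w (Suc n)"
begin

lemma w_growth: "n \<le> j \<Longrightarrow> \<rho> ^ (j - n) * w n \<le> w j"
proof (induction j rule: dec_induct)
  case (step j)
  have "\<rho> ^ (Suc j - n) * w n = \<rho> * (\<rho> ^ (j - n) * w n)" using step by (simp add: Suc_diff_le)
  also have "\<dots> \<le> \<rho> * w j" using step \<rho> by simp
  also have "\<dots> \<le> w (Suc j)" by (rule w_step)
  finally show ?case .
qed simp

lemma w_pos: "0 < w n"
proof -
  have "0 < \<rho> ^ n * w 0" using \<rho> w0 by simp
  also have "\<dots> \<le> w n" using w_growth[of 0 n] by simp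
  finally show ?thesis .
qed

lemma w_less: "n < j \<Longrightarrow> w n < w j"
proof -
  assume "n < j"
  then have "\<rho> ^ (j - n) > 1" using \<rho> by (simp add: one_less_power)
  then have "w n < \<rho> ^ (j - n) * w n" using w_pos[of n] by simp
  with w_growth[of n j] \<open>n < j\<close> show ?thesis by simp
qed

lemma w_mono: "n \<le> j \<Longrightarrow> w n \<le> w j"
  using w_less[of n j] by (cases "n = j") auto

lemma ratio_le: "n \<le> j \<Longrightarrow> w n / w j \<le> (1 / \<rho>) ^ (j - n)"
  using w_growth[of n j] w_pos[of j] \<rho> by (simp add: field_simps power_one_over)

lemma lacunary_powr:
  assumes a: "a > 0"
  shows "lacunary (\<lambda>n. w n powr a) (\<rho> powr a)"
proof
  show "1 < \<rho> powr a" using \<rho> a by simp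
  show "0 < w 0 powr a" using w0 by simp
  show "\<rho> powr a * w n powr a \<le> w (Suc n) powr a" for n
    using \<rho> a w_pos[of n] w_step[of n] by (simp flip: powr_mult add: powr_mono2)
qed

lemma sum_below_le:
  assumes fin: "finite J" and le: "\<And>j. j \<in> J \<Longrightarrow> w j \<le> y" and y: "y \<ge> 0"
  shows "(\<Sum>j\<in>J. w j) \<le> y / (1 - 1 / \<rho>)"
proof (cases "J = {}")
  case True
  then show ?thesis using \<rho> y by simp
next
  case False
  define n where "n = Max J"
  have n: "n \<in> J" "\<And>j. j \<in> J \<Longrightarrow> j \<le> n" using fin False by (auto simp: n_def)
  have "(\<Sum>j\<in>J. w j) \<le> (\<Sum>j\<in>J. w n * (1 / \<rho>) ^ (n - j))"
  proof (intro sum_mono)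
    fix j assume "j \<in> J"
    with ratio_le[of j n] n(2) w_pos[of n] show "w j \<le> w n * (1 / \<rho>) ^ (n - j)"
      by (simp add: divide_le_eq mult.commute)
  qed
  also have "\<dots> = w n * (\<Sum>j\<in>J. (1 / \<rho>) ^ (n - j))" by (simp add: sum_distrib_left)
  also have "\<dots> \<le> y * (1 / (1 - 1 / \<rho>))"
    using fin \<rho> w_pos[of n] n le y
    by (intro mult_mono sum_power_inj_le)
      (auto intro!: inj_onI sum_nonneg simp: less_imp_le dest!: n(2))
  finally show ?thesis by simp
qed

lemma sum_inverse_above_le:
  assumes fin: "finite J" and ge: "\<And>j. j \<in> J \<Longrightarrow> y \<le> w j" and y: "y > 0"
  shows "(\<Sum>j\<in>J. 1 / w j) \<le> (1 / y) / (1 - 1 / \<rho>)"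
proof (cases "J = {}")
  case True
  then show ?thesis using \<rho> y by simp
next
  case False
  define n where "n = Min J"
  have n: "n \<in> J" "\<And>j. j \<in> J \<Longrightarrow> n \<le> j" using fin False by (auto simp: n_def)
  have "(\<Sum>j\<in>J. 1 / w j) \<le> (\<Sum>j\<in>J. 1 / w n * (1 / \<rho>) ^ (j - n))"
  proof (intro sum_mono)
    fix j assume "j \<in> J"
    with w_growth[of n j] n(2) w_pos[of n] w_pos[of j] \<rho>
    show "1 / w j \<le> 1 / w n * (1 / \<rho>) ^ (j - n)"
      by (simp add: field_simps power_one_over)
  qed
  also have "\<dots> = 1 / w n * (\<Sum>j\<in>J. (1 / \<rho>) ^ (j - n))" by (simp add: sum_distrib_left)
  also have "\<dots> \<le> 1 / y * (1 / (1 - 1 / \<rho>))"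
    using fin \<rho> w_pos[of n] n ge y
    by (intro mult_mono sum_power_inj_le)
      (auto intro!: inj_onI sum_nonneg simp: frac_le dest!: n(2))
  finally show ?thesis by simp
qed

text \<open>Only the indices with \<open>w j * v\<close> of order one matter: the smaller ones are summed by \<open>w j\<close>, the
larger ones by \<open>1 / w j\<close>.\<close>

lemma sum_times_exp_le:
  assumes fin: "finite J" and v: "v > 0"
  shows "(\<Sum>j\<in>J. w j * exp (- w j * v)) \<le> 3 / (1 - 1 / \<rho>) / v"
proof -
  have 1: "(\<Sum>j\<in>{j\<in>J. w j \<le> 1 / v}. w j * exp (- w j * v)) \<le> (1 / v) / (1 - 1 / \<rho>)"
  proof -
    have "(\<Sum>j\<in>{j\<in>J. w j \<le> 1 / v}. w j * exp (- w j * v)) \<le> (\<Sum>j\<in>{j\<in>J. w j \<le> 1 / v}. w j)"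
      using v w_pos by (intro sum_mono) (auto simp: less_imp_le mult_left_le)
    also have "\<dots> \<le> (1 / v) / (1 - 1 / \<rho>)" using fin v by (intro sum_below_le) auto
    finally show ?thesis .
  qed
  have 2: "(\<Sum>j\<in>{j\<in>J. \<not> w j \<le> 1 / v}. w j * exp (- w j * v)) \<le> (2 / v) / (1 - 1 / \<rho>)"
  proof -
    have "(\<Sum>j\<in>{j\<in>J. \<not> w j \<le> 1 / v}. w j * exp (- w j * v))
        \<le> (\<Sum>j\<in>{j\<in>J. \<not> w j \<le> 1 / v}. 2 / v\<^sup>2 * (1 / w j))"
    proof (intro sum_mono)
      fix j
      define x where "x = w j * v"
      have x0: "x > 0" using w_pos[of j] v by (simp add: x_def)
      have "x\<^sup>2 \<le> 2 * exp x" using exp_lower_Taylor_quadratic[of x] x0 by simp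
      then show "w j * exp (- w j * v) \<le> 2 / v\<^sup>2 * (1 / w j)"
        using w_pos[of j] v x0 by (simp add: x_def exp_minus field_simps power2_eq_square)
    qed
    also have "\<dots> = 2 / v\<^sup>2 * (\<Sum>j\<in>{j\<in>J. \<not> w j \<le> 1 / v}. 1 / w j)" by (simp add: sum_distrib_left)
    also have "\<dots> \<le> 2 / v\<^sup>2 * ((1 / (1 / v)) / (1 - 1 / \<rho>))"
      using fin v by (intro mult_left_mono sum_inverse_above_le) auto
    also have "\<dots> = (2 / v) / (1 - 1 / \<rho>)" using v by (simp add: power2_eq_square)
    finally show ?thesis .
  qed
  have "(\<Sum>j\<in>J. w j * exp (- w j * v)) \<le> (1 / v) / (1 - 1 / \<rho>) + (2 / v) / (1 - 1 / \<rho>)"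
    by (subst sum_split_filter[OF fin, of _ "\<lambda>j. w j \<le> 1 / v"]) (intro add_mono 1 2)
  also have "\<dots> = 3 / (1 - 1 / \<rho>) / v" by (simp flip: add_divide_distrib add: mult.commute)
  finally show ?thesis .
qed

end

section \<open>Interpolation of weak type bounds along a lacunary sequence\<close>

lemma powr_half_power: "(a powr (- c / 2)) ^ (2 * j) = a powr (- (real j * c))" if "a > (0::real)"
proof -
  have "(a powr (- c / 2)) ^ (2 * j) = a powr (- c / 2 * real (2 * j))"
    using that by (simp add: powr_powr flip: powr_realpow)
  also have "- c / 2 * real (2 * j) = - (real j * c)" by simp
  finally show ?thesis .
qed

context lacunary
begin

text \<open>This constant and the two derived from it below are named so that the estimates visibly do not
depend on the index set, the measure or the functions.\<close>

definition layer_const :: "real \<Rightarrow> real" where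
  "layer_const r = (1 / (1 - 1 / \<rho> powr (1 / (2 * (r - 1))))) powr (r - 1) * (1 / (1 - 1 / \<rho> powr (1/2)))"

lemma layer_const_pos: "r > 1 \<Longrightarrow> layer_const r > 0"
  using \<rho> by (auto simp: layer_const_def intro!: mult_pos_pos divide_pos_pos)

text \<open>Holder's inequality with the weights \<open>w i powr a\<close>, where \<open>a = 1 / (2 * (r - 1))\<close>. At the point \<open>x\<close>
the sum of the weights over the indices with \<open>x \<in> E i\<close> is comparable to its last term, which is
at most the sum over all \<open>n \<ge> i\<close> with \<open>x \<in> E n\<close>. The power of a sum thereby becomes a linear
combination of indicators. The exponent \<open>1/2\<close> leaves half of the decay of the measure of \<open>E n\<close> for
the summation over \<open>n\<close> and half for the coefficient of \<open>b i\<close>.\<close>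

lemma sum_indicator_powr_le:
  assumes r: "r > 1" and fin: "finite I" and b: "\<And>i. i \<in> I \<Longrightarrow> b i \<ge> 0"
  shows "(\<Sum>i\<in>I. b i * indicator (E i) x) powr r
    \<le> (\<Sum>i\<in>I. \<Sum>n\<in>{n\<in>I. i \<le> n}. (1 / (1 - 1 / \<rho> powr (1 / (2 * (r - 1))))) powr (r - 1) *
        (b i powr r * w i powr (-1/2) * w n powr (1/2)) * indicator (E n) x)"
    (is "_ \<le> (\<Sum>i\<in>I. \<Sum>n\<in>_. ?t i n)")
proof -
  define a where "a = 1 / (2 * (r - 1))"
  define c where "c = 1 / (1 - 1 / \<rho> powr a)"
  have a0: "a > 0" using r by (simp add: a_def)
  interpret Y: lacunary "\<lambda>n. w n powr a" "\<rho> powr a" by (rule lacunary_powr[OF a0])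
  have c0: "c > 0" using less_trans[OF zero_less_one Y.\<rho>] Y.\<rho> by (simp add: c_def)
  have t0: "?t i n \<ge> 0" for i n by (auto intro!: mult_nonneg_nonneg)
  define S where "S = {i\<in>I. x \<in> E i}"
  have finS: "finite S" using fin by (simp add: S_def)
  have eq: "(\<Sum>i\<in>I. b i * indicator (E i) x) = (\<Sum>i\<in>S. b i)"
    using fin by (auto simp: S_def indicator_def intro!: sum.mono_neutral_cong_right)
  show ?thesis
  proof (cases "S = {}")
    case True
    then show ?thesis unfolding eq using t0 by (auto intro!: sum_nonneg)
  next
    case False
    define m where "m = Max S"
    have m: "m \<in> S" "\<And>j. j \<in> S \<Longrightarrow> j \<le> m" using finS False by (auto simp: m_def)
    have "(\<Sum>i\<in>S. b i) powr r = (\<Sum>i\<in>S. w i powr a * (b i / w i powr a)) powr r"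
      using w_pos by (intro arg_cong[where f = "\<lambda>u. u powr r"] sum.cong) (auto simp: less_le)
    also have "\<dots> \<le> (\<Sum>i\<in>S. w i powr a) powr (r - 1) * (\<Sum>i\<in>S. w i powr a * (b i / w i powr a) powr r)"
      using r b finS Y.w_pos by (intro powr_sum_le_weighted) (auto simp: S_def)
    also have "\<dots> \<le> (w m powr a * c) powr (r - 1) * (\<Sum>i\<in>S. w i powr a * (b i / w i powr a) powr r)"
    proof (intro mult_right_mono powr_mono2)
      show "(\<Sum>i\<in>S. w i powr a) \<le> w m powr a * c"
        using Y.sum_below_le[of S "w m powr a"] finS m Y.w_mono by (simp add: c_def)
    qed (use r in \<open>auto intro!: sum_nonneg\<close>)
    also have "\<dots> = (\<Sum>i\<in>S. ?t i m)"
      unfolding sum_distrib_left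
    proof (intro sum.cong refl)
      fix i assume i: "i \<in> S"
      then have bi: "b i \<ge> 0" using b by (auto simp: S_def)
      have 1: "(w m powr a * c) powr (r - 1) = c powr (r - 1) * w m powr (1/2)"
      proof -
        have ar: "a * (r - 1) = 1/2" using r by (simp add: a_def)
        have "(w m powr a * c) powr (r - 1) = c powr (r - 1) * w m powr (a * (r - 1))"
          using c0 w_pos[of m] by (simp add: powr_mult powr_powr)
        then show ?thesis unfolding ar .
      qed
      have 2: "w i powr a * (b i / w i powr a) powr r = b i powr r * w i powr (-1/2)"
      proof -
        have "a - a * r = -1/2" using r by (simp add: a_def field_simps)
        then have "w i powr (-1/2) = w i powr a / w i powr (a * r)" by (simp flip: powr_diff)
        then show ?thesis using bi w_pos[of i] by (simp add: powr_divide powr_powr)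
      qed
      have "indicator (E m) x = (1::real)" using m by (simp add: S_def)
      then show "(w m powr a * c) powr (r - 1) * (w i powr a * (b i / w i powr a) powr r) = ?t i m"
        unfolding 1 2 by (simp add: c_def a_def)
    qed
    also have "\<dots> \<le> (\<Sum>i\<in>S. \<Sum>n\<in>{n\<in>I. i \<le> n}. ?t i n)"
    proof (intro sum_mono)
      fix i assume "i \<in> S"
      then show "?t i m \<le> (\<Sum>n\<in>{n\<in>I. i \<le> n}. ?t i n)"
        using m fin t0 by (intro member_le_sum) (auto simp: S_def)
    qed
    also have "\<dots> \<le> (\<Sum>i\<in>I. \<Sum>n\<in>{n\<in>I. i \<le> n}. ?t i n)"
      using fin t0 by (intro sum_mono2 sum_nonneg) (auto simp: S_def)
    finally show ?thesis unfolding eq .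
  qed
qed

text \<open>The right-hand side involves the bounds \<open>A / w i\<close> and not the measures of the sets: for equal
sets and equal coefficients the left-hand side grows like the power \<open>r\<close> of their number, and only the decay of the
bounds saves the inequality.\<close>

lemma nn_integral_sum_indicator_le:
  fixes \<mu> :: "'a measure"
  assumes r: "r > 1" and fin: "finite I" and b: "\<And>i. i \<in> I \<Longrightarrow> b i \<ge> 0" and A: "A \<ge> 0"
    and E: "\<And>i. i \<in> I \<Longrightarrow> E i \<in> sets \<mu>"
    and em: "\<And>i. i \<in> I \<Longrightarrow> emeasure \<mu> (E i) \<le> ennreal (A / w i)"
  shows "(\<integral>\<^sup>+x. ennreal ((\<Sum>i\<in>I. b i * indicator (E i) x) powr r) \<partial>\<mu>)
    \<le> ennreal (layer_const r * A * (\<Sum>i\<in>I. b i powr r / w i))"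
proof -
  define c where "c = (1 / (1 - 1 / \<rho> powr (1 / (2 * (r - 1))))) powr (r - 1)"
  define k where "k i n = c * (b i powr r * w i powr (-1/2) * w n powr (1/2))" for i n
  have c0: "c \<ge> 0" by (simp add: c_def)
  have k0: "k i n \<ge> 0" for i n by (simp add: k_def c0)
  interpret H: lacunary "\<lambda>n. w n powr (1/2)" "\<rho> powr (1/2)" by (rule lacunary_powr) simp
  have "(\<integral>\<^sup>+x. ennreal ((\<Sum>i\<in>I. b i * indicator (E i) x) powr r) \<partial>\<mu>)
    \<le> (\<integral>\<^sup>+x. (\<Sum>i\<in>I. \<Sum>n\<in>{n\<in>I. i \<le> n}. ennreal (k i n) * indicator (E n) x) \<partial>\<mu>)"
  proof (intro nn_integral_mono)
    fix x
    have "ennreal ((\<Sum>i\<in>I. b i * indicator (E i) x) powr r)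
      \<le> ennreal (\<Sum>i\<in>I. \<Sum>n\<in>{n\<in>I. i \<le> n}. k i n * indicator (E n) x)"
      unfolding k_def c_def using sum_indicator_powr_le[OF r fin b] by (rule ennreal_leI)
    also have "\<dots> = (\<Sum>i\<in>I. \<Sum>n\<in>{n\<in>I. i \<le> n}. ennreal (k i n) * indicator (E n) x)"
    proof -
      have "ennreal (k i n) * indicator (E n) x = ennreal (k i n * indicator (E n) x)" for i n
        using k0 by (simp add: ennreal_mult' ennreal_indicator)
      then show ?thesis using k0 by (simp add: sum_nonneg)
    qed
    finally show "ennreal ((\<Sum>i\<in>I. b i * indicator (E i) x) powr r)
      \<le> (\<Sum>i\<in>I. \<Sum>n\<in>{n\<in>I. i \<le> n}. ennreal (k i n) * indicator (E n) x)" .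
  qed
  also have "\<dots> = (\<Sum>i\<in>I. \<Sum>n\<in>{n\<in>I. i \<le> n}. ennreal (k i n) * emeasure \<mu> (E n))"
  proof -
    have [measurable]: "(\<lambda>x. ennreal (k i n) * indicator (E n) x) \<in> borel_measurable \<mu>" if "n \<in> I" for i n
      using E[OF that] by measurable
    have "(\<integral>\<^sup>+x. (\<Sum>n\<in>{n\<in>I. i \<le> n}. ennreal (k i n) * indicator (E n) x) \<partial>\<mu>)
      = (\<Sum>n\<in>{n\<in>I. i \<le> n}. ennreal (k i n) * emeasure \<mu> (E n))" for i
      by (subst nn_integral_sum, simp) (rule sum.cong, simp_all add: E nn_integral_cmult_indicator)
    then show ?thesis by (subst nn_integral_sum) simp_all
  qed
  also have "\<dots> \<le> (\<Sum>i\<in>I. \<Sum>n\<in>{n\<in>I. i \<le> n}. ennreal (k i n) * ennreal (A / w n))"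
    using em by (intro sum_mono mult_left_mono) auto
  also have "\<dots> = ennreal (\<Sum>i\<in>I. \<Sum>n\<in>{n\<in>I. i \<le> n}. k i n * (A / w n))"
    using k0 A w_pos by (simp add: sum_nonneg less_imp_le flip: ennreal_mult')
  also have "\<dots> \<le> ennreal (layer_const r * A * (\<Sum>i\<in>I. b i powr r / w i))"
    unfolding sum_distrib_left
  proof (intro ennreal_leI sum_mono)
    fix i assume i: "i \<in> I"
    have half: "w n powr (1/2) / w n = 1 / w n powr (1/2)" "w n powr (1/2) * w n powr (1/2) = w n" for n
    proof -
      have sq: "w n powr (1/2) * w n powr (1/2) = w n"
        unfolding powr_add[symmetric] using w_pos[of n] by simp
      then show "w n powr (1/2) * w n powr (1/2) = w n" .
      have "w n powr (1/2) / w n = w n powr (1/2) / (w n powr (1/2) * w n powr (1/2))"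
        unfolding sq ..
      also have "\<dots> = 1 / w n powr (1/2)" using w_pos[of n] by simp
      finally show "w n powr (1/2) / w n = 1 / w n powr (1/2)" .
    qed
    have "(\<Sum>n\<in>{n\<in>I. i \<le> n}. k i n * (A / w n))
       = c * A * b i powr r * w i powr (-1/2) * (\<Sum>n\<in>{n\<in>I. i \<le> n}. w n powr (1/2) / w n)"
      by (simp add: k_def sum_distrib_left mult_ac)
    also have "\<dots> = c * A * b i powr r * w i powr (-1/2) * (\<Sum>n\<in>{n\<in>I. i \<le> n}. 1 / w n powr (1/2))"
      by (simp only: half(1))
    also have "\<dots> \<le> c * A * b i powr r * w i powr (-1/2) *
       ((1 / w i powr (1/2)) / (1 - 1 / \<rho> powr (1/2)))"
      using fin H.w_mono H.w_pos A c0 by (intro mult_left_mono H.sum_inverse_above_le) auto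
    also have "\<dots> = layer_const r * A * (b i powr r / w i)"
    proof -
      have "w i powr (-1/2) * (1 / w i powr (1/2)) = 1 / (w i powr (1/2) * w i powr (1/2))"
        by (simp add: powr_minus_divide)
      also have "\<dots> = 1 / w i" unfolding half(2) ..
      finally have "w i powr (-1/2) * (1 / w i powr (1/2)) = 1 / w i" .
      then have "c * A * b i powr r * (w i powr (-1/2) * (1 / w i powr (1/2))) / (1 - 1 / \<rho> powr (1/2))
         = layer_const r * A * (b i powr r / w i)"
        by (simp add: layer_const_def c_def)
      then show ?thesis by (simp add: mult.assoc)
    qed
    finally show "(\<Sum>n\<in>{n\<in>I. i \<le> n}. k i n * (A / w n)) \<le> layer_const r * A * (b i powr r / w i)" .
  qed
  finally show ?thesis .
qed

definition layers_const :: "real \<Rightarrow> real \<Rightarrow> real" where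
  "layers_const r \<eta> = (1 / (1 - \<eta> powr (1 / (r - 1)))) powr (r - 1) * layer_const r * (1 / (1 - \<eta>))"

lemma layers_const_pos: "r > 1 \<Longrightarrow> 0 < \<eta> \<Longrightarrow> \<eta> < 1 \<Longrightarrow> layers_const r \<eta> > 0"
  using layer_const_pos[of r] powr_less_mono2[of "1 / (r - 1)" \<eta> 1] by (auto simp: layers_const_def)

text \<open>Jensen's inequality with geometric weights over the layers reduces a superposition of layers to the
case of a single one; this costs half of the exponent in \<open>\<eta> ^ (2 * j)\<close>.\<close>

lemma nn_integral_layers_le:
  fixes \<mu> :: "'a measure"
  assumes r: "r > 1" and fin: "finite I" and b: "\<And>i. i \<in> I \<Longrightarrow> b i \<ge> 0" and A: "A \<ge> 0"
    and \<eta>: "0 < \<eta>" "\<eta> < 1" and s: "\<And>j. s j > 0"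
    and E: "\<And>i j. i \<in> I \<Longrightarrow> E i j \<in> sets \<mu>"
    and em: "\<And>i j. i \<in> I \<Longrightarrow> emeasure \<mu> (E i j) \<le> ennreal (A * \<eta> ^ (2 * j) / s j powr r / w i)"
    and h0: "\<And>i x. i \<in> I \<Longrightarrow> h i x \<ge> 0"
    and h: "\<And>x. x \<in> space \<mu> \<Longrightarrow> \<exists>J. \<forall>i\<in>I. h i x \<le> (\<Sum>j<J. s j * indicator (E i j) x)"
  shows "(\<integral>\<^sup>+x. ennreal ((\<Sum>i\<in>I. b i * h i x) powr r) \<partial>\<mu>)
    \<le> ennreal (layers_const r \<eta> * A * (\<Sum>i\<in>I. b i powr r / w i))"
proof -
  define \<delta> where "\<delta> = \<eta> powr (1 / (r - 1))"
  define c where "c = (1 / (1 - \<delta>)) powr (r - 1)"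
  define g where "g j x = (\<Sum>i\<in>I. b i * indicator (E i j) x)" for j x
  define B where "B = (\<Sum>i\<in>I. b i powr r / w i)"
  have B0: "B \<ge> 0" using w_pos by (auto simp: B_def less_imp_le intro!: sum_nonneg)
  have \<delta>: "0 < \<delta>" "\<delta> < 1" using \<eta> r powr_less_mono2[of "1 / (r - 1)" \<eta> 1] by (auto simp: \<delta>_def)
  have g0: "g j x \<ge> 0" for j x using b by (auto simp: g_def intro!: sum_nonneg)
  have gm: "(\<lambda>x. ennreal (g j x powr r)) \<in> borel_measurable \<mu>" for j
    using E unfolding g_def by measurable
  have c0: "c \<ge> 0" by (simp add: c_def)
  define k where "k j = c * (s j powr r / \<eta> ^ j)" for j
  have k0: "k j \<ge> 0" for j using \<eta> c0 by (simp add: k_def)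
  have pt: "ennreal ((\<Sum>i\<in>I. b i * h i x) powr r) \<le> (\<Sum>j. ennreal (k j) * ennreal (g j x powr r))"
    if x: "x \<in> space \<mu>" for x
  proof -
    obtain J where J: "\<And>i. i \<in> I \<Longrightarrow> h i x \<le> (\<Sum>j<J. s j * indicator (E i j) x)" using h[OF x] by blast
    have "(\<Sum>i\<in>I. b i * h i x) \<le> (\<Sum>i\<in>I. b i * (\<Sum>j<J. s j * indicator (E i j) x))"
      using b J by (intro sum_mono mult_left_mono) auto
    also have "\<dots> = (\<Sum>j<J. s j * g j x)"
      unfolding g_def sum_distrib_left by (subst sum.swap) (simp add: mult_ac)
    also have "\<dots> = (\<Sum>j<J. \<delta> ^ j * (s j * g j x / \<delta> ^ j))" using \<delta> by simp
    finally have "(\<Sum>i\<in>I. b i * h i x) powr r \<le> (\<Sum>j<J. \<delta> ^ j * (s j * g j x / \<delta> ^ j)) powr r"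
      using r b h0 by (intro powr_mono2 sum_nonneg mult_nonneg_nonneg) auto
    also have "\<dots> \<le> (\<Sum>j<J. \<delta> ^ j) powr (r - 1) * (\<Sum>j<J. \<delta> ^ j * (s j * g j x / \<delta> ^ j) powr r)"
      using \<delta> g0 s r by (intro powr_sum_le_weighted) (auto intro!: mult_nonneg_nonneg simp: less_imp_le)
    also have "\<dots> \<le> c * (\<Sum>j<J. \<delta> ^ j * (s j * g j x / \<delta> ^ j) powr r)"
      unfolding c_def using sum_power_inj_le[of "{..<J}" id \<delta>] \<delta> r
      by (intro mult_right_mono powr_mono2 sum_nonneg mult_nonneg_nonneg) auto
    also have "\<dots> = (\<Sum>j<J. k j * g j x powr r)"
      unfolding sum_distrib_left
    proof (intro sum.cong refl)
      fix j
      have "(\<delta> ^ j) powr r = \<delta> ^ j * \<eta> ^ j"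
      proof -
        have "real j / (r - 1) * r = real j / (r - 1) + real j" using r by (simp add: field_simps)
        then have "\<eta> powr (real j / (r - 1) * r) = \<eta> powr (real j / (r - 1)) * \<eta> powr real j"
          by (simp add: powr_add)
        moreover have \<delta>j: "\<delta> ^ j = \<eta> powr (real j / (r - 1))"
          using \<delta> \<eta> by (simp add: \<delta>_def powr_powr flip: powr_realpow)
        ultimately show ?thesis using \<eta> by (simp add: powr_powr powr_realpow)
      qed
      then have "\<delta> ^ j * (s j * g j x / \<delta> ^ j) powr r = s j powr r / \<eta> ^ j * g j x powr r"
        using \<delta> s g0 \<eta> by (simp add: powr_divide powr_mult less_imp_le)
      then show "c * (\<delta> ^ j * (s j * g j x / \<delta> ^ j) powr r) = k j * g j x powr r"
        by (simp add: k_def)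
    qed
    finally have "ennreal ((\<Sum>i\<in>I. b i * h i x) powr r) \<le> (\<Sum>j<J. ennreal (k j) * ennreal (g j x powr r))"
      using k0 by (simp add: ennreal_leI flip: ennreal_mult')
    also have "\<dots> \<le> (\<Sum>j. ennreal (k j) * ennreal (g j x powr r))"
      by (intro sum_le_suminf) auto
    finally show ?thesis .
  qed
  have "(\<integral>\<^sup>+x. ennreal ((\<Sum>i\<in>I. b i * h i x) powr r) \<partial>\<mu>)
      \<le> (\<integral>\<^sup>+x. (\<Sum>j. ennreal (k j) * ennreal (g j x powr r)) \<partial>\<mu>)"
    by (intro nn_integral_mono pt)
  also have "\<dots> = (\<Sum>j. ennreal (k j) * (\<integral>\<^sup>+x. ennreal (g j x powr r) \<partial>\<mu>))"
    using gm by (subst nn_integral_suminf) (auto simp: nn_integral_cmult)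
  also have "\<dots> \<le> (\<Sum>j. ennreal (c * layer_const r * A * B) * ennreal (\<eta> ^ j))"
  proof (intro suminf_le)
    fix j
    have "(\<integral>\<^sup>+x. ennreal (g j x powr r) \<partial>\<mu>)
      \<le> ennreal (layer_const r * (A * \<eta> ^ (2 * j) / s j powr r) * B)"
      unfolding g_def B_def using r fin b A E em \<eta>
      by (intro nn_integral_sum_indicator_le) auto
    then have "ennreal (k j) * (\<integral>\<^sup>+x. ennreal (g j x powr r) \<partial>\<mu>)
      \<le> ennreal (k j) * ennreal (layer_const r * (A * \<eta> ^ (2 * j) / s j powr r) * B)"
      by (intro mult_left_mono) auto
    also have "\<dots> = ennreal (c * layer_const r * A * B * \<eta> ^ j)"
      using k0 s[of j] \<eta>
      by (simp add: k_def field_simps power_mult power2_eq_square power_mult_distrib flip: ennreal_mult')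
    also have "\<dots> = ennreal (c * layer_const r * A * B) * ennreal (\<eta> ^ j)"
      using \<eta> by (simp add: ennreal_mult'')
    finally show "ennreal (k j) * (\<integral>\<^sup>+x. ennreal (g j x powr r) \<partial>\<mu>)
       \<le> ennreal (c * layer_const r * A * B) * ennreal (\<eta> ^ j)" .
  qed auto
  also have "\<dots> = ennreal (c * layer_const r * A * B) * ennreal (1 / (1 - \<eta>))"
    using \<eta> by (simp add: suminf_ennreal2 suminf_geometric summable_geometric)
  also have "\<dots> = ennreal (layers_const r \<eta> * A * B)"
  proof -
    have "layers_const r \<eta> * A * B = c * layer_const r * A * B * (1 / (1 - \<eta>))"
      by (simp add: layers_const_def c_def \<delta>_def)
    then show ?thesis using \<eta> by (simp only: ennreal_mult'' diff_ge_0_iff_ge less_imp_le zero_le_divide_1_iff)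
  qed
  finally show ?thesis by (simp add: B_def)
qed

definition marcinkiewicz_const :: "real \<Rightarrow> real \<Rightarrow> real \<Rightarrow> real" where
  "marcinkiewicz_const p q r = 2 powr (r - 1) *
     (layers_const r (2 powr (- (q - r) / 2)) * 2 powr r + layers_const r (2 powr (- (r - p) / 2)) * 2 powr p)"

lemma marcinkiewicz_const_pos: "1 < r \<Longrightarrow> p < r \<Longrightarrow> r < q \<Longrightarrow> marcinkiewicz_const p q r > 0"
  unfolding marcinkiewicz_const_def
  by (intro mult_pos_pos add_pos_pos layers_const_pos) (auto simp: powr_less_one)

text \<open>Marcinkiewicz interpolation for the map sending \<open>b\<close> to the sum of the \<open>b i * h i\<close>. The functions are
cut at the levels \<open>2 ^ j * H\<close>. The weak type \<open>q\<close> makes the contributions decay geometrically above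
\<open>H\<close>, the weak type \<open>p\<close> below \<open>H\<close>.\<close>

lemma nn_integral_weak_type_sum_le:
  fixes \<mu> :: "'a measure"
  assumes p: "p < r" and r: "1 < r" and q: "r < q" and fin: "finite I"
    and b: "\<And>i. i \<in> I \<Longrightarrow> b i \<ge> 0" and P: "P > 0" and Q: "Q > 0"
    and h0: "\<And>i x. i \<in> I \<Longrightarrow> h i x \<ge> 0" and hm: "\<And>i. i \<in> I \<Longrightarrow> h i \<in> borel_measurable \<mu>"
    and wp: "\<And>i l. i \<in> I \<Longrightarrow> l > 0 \<Longrightarrow> emeasure \<mu> {x\<in>space \<mu>. h i x > l} \<le> ennreal (P * l powr (- p) / w i)"
    and wq: "\<And>i l. i \<in> I \<Longrightarrow> l > 0 \<Longrightarrow> emeasure \<mu> {x\<in>space \<mu>. h i x > l} \<le> ennreal (Q * l powr (- q) / w i)"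
  shows "(\<integral>\<^sup>+x. ennreal ((\<Sum>i\<in>I. b i * h i x) powr r) \<partial>\<mu>)
    \<le> ennreal (marcinkiewicz_const p q r * (P powr ((q - r) / (q - p)) * Q powr ((r - p) / (q - p)))
         * (\<Sum>i\<in>I. b i powr r / w i))"
proof -
  let ?S = "\<lambda>g x. \<Sum>i\<in>I. b i * g i x" and ?E = "\<lambda>i l. {x\<in>space \<mu>. h i x > l}"
  \<comment> \<open>The level at which the two bounds for the distribution function agree.\<close>
  define H where "H = (Q / P) powr (1 / (q - p))"
  define Z where "Z = P powr ((q - r) / (q - p)) * Q powr ((r - p) / (q - p))"
  define B where "B = (\<Sum>i\<in>I. b i powr r / w i)"
  have H0: "H > 0" using P Q by (simp add: H_def)
  have Z0: "Z > 0" using P Q by (simp add: Z_def)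
  have B0: "B \<ge> 0" using w_pos by (auto simp: B_def less_imp_le intro!: sum_nonneg)
  have ZQ: "Q * H powr (r - q) = Z"
  proof -
    have e: "(r - q) / (q - p) = - ((q - r) / (q - p))" "1 - (q - r) / (q - p) = (r - p) / (q - p)"
      using p q by (auto simp: field_simps)
    have "Q * H powr (r - q) = Q * (Q / P) powr ((r - q) / (q - p))" by (simp add: H_def powr_powr)
    also have "\<dots> = P powr ((q - r) / (q - p)) * (Q powr 1 * Q powr (- ((q - r) / (q - p))))"
      using P Q unfolding e by (simp add: powr_divide powr_minus field_simps)
    also have "\<dots> = Z" unfolding powr_add[symmetric] Z_def by (simp add: e)
    finally show ?thesis .
  qed
  have ZP: "P * H powr (r - p) = Z"
  proof -
    have e: "1 - (r - p) / (q - p) = (q - r) / (q - p)" using p q by (auto simp: field_simps)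
    have "P * H powr (r - p) = P * (Q / P) powr ((r - p) / (q - p))" by (simp add: H_def powr_powr)
    also have "\<dots> = (P powr 1 * P powr (- ((r - p) / (q - p)))) * Q powr ((r - p) / (q - p))"
      using P Q by (simp add: powr_divide powr_minus field_simps)
    also have "\<dots> = Z" unfolding powr_add[symmetric] Z_def by (simp add: e)
    finally show ?thesis .
  qed
  define u where "u i x = (if h i x > H then h i x else 0)" for i x
  define v where "v i x = (if h i x > H then 0 else h i x)" for i x
  have lev[measurable]: "?E i l \<in> sets \<mu>" if "i \<in> I" for i l
    using hm[OF that] by measurable
  have U: "(\<integral>\<^sup>+x. ennreal (?S u x powr r) \<partial>\<mu>)
     \<le> ennreal (layers_const r (2 powr (- (q - r) / 2)) * (2 powr r * Z) * B)"
    unfolding B_def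
  proof (rule nn_integral_layers_le[where s = "\<lambda>j. 2 ^ (j + 1) * H"
        and E = "\<lambda>i j. ?E i (2 ^ j * H)"])
    fix i j assume i: "i \<in> I"
    have "emeasure \<mu> (?E i (2 ^ j * H)) \<le> ennreal (Q * (2 ^ j * H) powr (- q) / w i)"
      using wq[OF i, of "2 ^ j * H"] H0 by simp
    also have "Q * (2 ^ j * H) powr (- q) =
       2 powr r * Z * (2 powr (- (q - r) / 2)) ^ (2 * j) / (2 ^ (j + 1) * H) powr r"
    proof -
      have "(2 ^ (j + 1) * H) powr r = 2 powr r * (2 powr (real j * r) * H powr r)"
        using H0 by (simp add: powr_mult powr_powr flip: powr_realpow)
      moreover have "(2 powr (- (q - r) / 2)) ^ (2 * j) = 2 powr (real j * r) * 2 powr (- real j * q)"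
        unfolding powr_half_power[OF zero_less_numeral] powr_add[symmetric] by (simp add: right_diff_distrib)
      moreover have "(2 ^ j * H) powr (- q) = 2 powr (- real j * q) * H powr (- q)"
        using H0 by (simp add: powr_mult powr_powr flip: powr_realpow)
      moreover have "Z = Q * H powr r * H powr (- q)"
        unfolding ZQ[symmetric] by (simp add: powr_diff powr_minus divide_inverse)
      ultimately show ?thesis using H0 by simp
    qed
    finally show "emeasure \<mu> (?E i (2 ^ j * H)) \<le>
      ennreal (2 powr r * Z * (2 powr (- (q - r) / 2)) ^ (2 * j) / (2 ^ (j + 1) * H) powr r / w i)" .
  next
    fix x assume x: "x \<in> space \<mu>"
    define m where "m = (\<Sum>i\<in>I. h i x)"
    obtain J where J: "m / H < 2 ^ J" using real_arch_pow[of 2 "m / H"] by auto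
    have "u i x \<le> (\<Sum>j<J. 2 ^ (j + 1) * H * indicator (?E i (2 ^ j * H)) x)" if i: "i \<in> I" for i
    proof (cases "h i x > H")
      case True
      have "h i x \<le> m" unfolding m_def using fin i h0 by (intro member_le_sum) auto
      then have hJ: "h i x \<le> 2 ^ J * H" using J H0 by (simp add: divide_less_eq)
      define j where "j = (LEAST j. h i x \<le> 2 ^ j * H)"
      have j1: "h i x \<le> 2 ^ j * H" unfolding j_def using hJ by (rule LeastI)
      have jJ: "j \<le> J" unfolding j_def using hJ by (rule Least_le)
      have jpos: "j \<noteq> 0" using j1 True by (intro notI) simp
      then have j2: "h i x > 2 ^ (j - 1) * H"
        using not_less_Least[of "j - 1" "\<lambda>j. h i x \<le> 2 ^ j * H"] by (simp add: j_def not_le)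
      have "h i x \<le> 2 ^ (j - 1 + 1) * H * indicator (?E i (2 ^ (j - 1) * H)) x"
        using j1 j2 jpos x by simp
      also have "\<dots> \<le> (\<Sum>j<J. 2 ^ (j + 1) * H * indicator (?E i (2 ^ j * H)) x)"
        using jpos jJ H0 by (intro member_le_sum[of "j - 1" "{..<J}"]) auto
      finally show ?thesis using True by (simp add: u_def)
    qed (use H0 in \<open>auto simp: u_def intro!: sum_nonneg\<close>)
    then show "\<exists>J. \<forall>i\<in>I. u i x \<le> (\<Sum>j<J. 2 ^ (j + 1) * H * indicator (?E i (2 ^ j * H)) x)"
      by blast
  qed (use r q Z0 H0 fin b h0 lev in \<open>auto simp: u_def powr_less_one\<close>)
  have V: "(\<integral>\<^sup>+x. ennreal (?S v x powr r) \<partial>\<mu>)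
     \<le> ennreal (layers_const r (2 powr (- (r - p) / 2)) * (2 powr p * Z) * B)"
    unfolding B_def
  proof (rule nn_integral_layers_le[where s = "\<lambda>j. H / 2 ^ j"
        and E = "\<lambda>i j. ?E i (H / 2 ^ (j + 1))"])
    fix i j assume i: "i \<in> I"
    have "emeasure \<mu> (?E i (H / 2 ^ (j + 1))) \<le> ennreal (P * (H / 2 ^ (j + 1)) powr (- p) / w i)"
      using wp[OF i, of "H / 2 ^ (j + 1)"] H0 by simp
    also have "P * (H / 2 ^ (j + 1)) powr (- p) =
       2 powr p * Z * (2 powr (- (r - p) / 2)) ^ (2 * j) / (H / 2 ^ j) powr r"
    proof -
      have "(H / 2 ^ j) powr r = H powr r / 2 powr (real j * r)"
        using H0 by (simp add: powr_divide powr_powr flip: powr_realpow)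
      moreover have "(2 powr (- (r - p) / 2)) ^ (2 * j) = 2 powr (real j * p) / 2 powr (real j * r)"
        unfolding powr_half_power[OF zero_less_numeral] powr_diff[symmetric] by (simp add: right_diff_distrib)
      moreover have "(H / 2 ^ (j + 1)) powr (- p) = 2 powr p * 2 powr (real j * p) * H powr (- p)"
        using H0 by (simp add: powr_divide powr_mult powr_powr powr_minus_divide flip: powr_realpow)
      moreover have "Z = P * H powr r * H powr (- p)"
        unfolding ZP[symmetric] by (simp add: powr_diff powr_minus divide_inverse)
      ultimately show ?thesis using H0 by simp
    qed
    finally show "emeasure \<mu> (?E i (H / 2 ^ (j + 1))) \<le>
      ennreal (2 powr p * Z * (2 powr (- (r - p) / 2)) ^ (2 * j) / (H / 2 ^ j) powr r / w i)" .
  next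
    fix x assume x: "x \<in> space \<mu>"
    have "\<exists>J. v i x \<le> (\<Sum>j<J. H / 2 ^ j * indicator (?E i (H / 2 ^ (j + 1))) x)" if i: "i \<in> I" for i
    proof (cases "h i x > H \<or> h i x = 0")
      case False
      then have hx: "0 < h i x" "h i x \<le> H" using h0[OF i, of x] by auto
      obtain J where J: "H / h i x < 2 ^ J" using real_arch_pow[of 2 "H / h i x"] by auto
      then have hJ: "H / 2 ^ J < h i x" using hx by (simp add: field_simps)
      define j where "j = (LEAST j. H / 2 ^ j < h i x)"
      have j1: "H / 2 ^ j < h i x" unfolding j_def using hJ by (rule LeastI)
      have jpos: "j \<noteq> 0" using j1 hx by (intro notI) simp
      then have j2: "h i x \<le> H / 2 ^ (j - 1)"
        using not_less_Least[of "j - 1" "\<lambda>j. H / 2 ^ j < h i x"] by (simp add: j_def not_less)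
      have "h i x \<le> H / 2 ^ (j - 1) * indicator (?E i (H / 2 ^ (j - 1 + 1))) x"
        using j1 j2 jpos x by simp
      also have "\<dots> \<le> (\<Sum>j<j. H / 2 ^ j * indicator (?E i (H / 2 ^ (j + 1))) x)"
        using jpos H0 by (intro member_le_sum[of "j - 1" "{..<j}"]) auto
      finally have "v i x \<le> (\<Sum>j<j. H / 2 ^ j * indicator (?E i (H / 2 ^ (j + 1))) x)"
        using hx by (simp add: v_def)
      then show ?thesis by (rule exI)
    next
      case True
      then have "v i x \<le> (\<Sum>j<0. H / 2 ^ j * indicator (?E i (H / 2 ^ (j + 1))) x)"
        by (auto simp: v_def)
      then show ?thesis by (rule exI)
    qed
    then have "\<forall>i\<in>I. \<exists>J. v i x \<le> (\<Sum>j<J. H / 2 ^ j * indicator (?E i (H / 2 ^ (j + 1))) x)"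
      by (rule ballI)
    from bchoice[OF this] obtain J where J: "\<And>i. i \<in> I \<Longrightarrow>
        v i x \<le> (\<Sum>j<J i. H / 2 ^ j * indicator (?E i (H / 2 ^ (j + 1))) x)"
      by blast
    have "v i x \<le> (\<Sum>j<Max (insert 0 (J ` I)). H / 2 ^ j * indicator (?E i (H / 2 ^ (j + 1))) x)"
      if i: "i \<in> I" for i
    proof -
      have "J i \<le> Max (insert 0 (J ` I))" using fin i by (intro Max_ge) auto
      then show ?thesis using H0 by (intro order.trans[OF J[OF i]] sum_mono2) auto
    qed
    then show "\<exists>J. \<forall>i\<in>I. v i x \<le> (\<Sum>j<J. H / 2 ^ j * indicator (?E i (H / 2 ^ (j + 1))) x)"
      by blast
  qed (use r p Z0 H0 fin b h0 lev in \<open>auto simp: v_def powr_less_one\<close>)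
  have um: "(\<lambda>x. ennreal (?S u x powr r)) \<in> borel_measurable \<mu>"
    using hm unfolding u_def by measurable
  have vm: "(\<lambda>x. ennreal (?S v x powr r)) \<in> borel_measurable \<mu>"
    using hm unfolding v_def by measurable
  have "(\<integral>\<^sup>+x. ennreal (?S h x powr r) \<partial>\<mu>)
     \<le> (\<integral>\<^sup>+x. ennreal (2 powr (r - 1)) * (ennreal (?S u x powr r) + ennreal (?S v x powr r)) \<partial>\<mu>)"
  proof (intro nn_integral_mono)
    fix x
    have "?S h x = ?S u x + ?S v x"
      by (simp add: u_def v_def flip: sum.distrib) (intro sum.cong, auto)
    moreover have "?S u x \<ge> 0" "?S v x \<ge> 0"
      using b h0 by (auto simp: u_def v_def intro!: sum_nonneg)
    ultimately have "?S h x powr r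
      \<le> 2 powr (r - 1) * (?S u x powr r + ?S v x powr r)"
      using powr_add_le[of "?S u x" "?S v x" r] r by simp
    then show "ennreal (?S h x powr r) \<le> ennreal (2 powr (r - 1)) *
       (ennreal (?S u x powr r) + ennreal (?S v x powr r))"
      by (simp add: ennreal_leI flip: ennreal_mult' ennreal_plus)
  qed
  also have "\<dots> = ennreal (2 powr (r - 1)) * ((\<integral>\<^sup>+x. ennreal (?S u x powr r) \<partial>\<mu>)
      + (\<integral>\<^sup>+x. ennreal (?S v x powr r) \<partial>\<mu>))"
    using um vm by (simp add: nn_integral_cmult nn_integral_add)
  also have "\<dots> \<le> ennreal (2 powr (r - 1)) *
      (ennreal (layers_const r (2 powr (- (q - r) / 2)) * (2 powr r * Z) * B) +
       ennreal (layers_const r (2 powr (- (r - p) / 2)) * (2 powr p * Z) * B))"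
    by (intro mult_left_mono add_mono U V) auto
  also have "\<dots> = ennreal (marcinkiewicz_const p q r * Z * B)"
  proof -
    have "layers_const r (2 powr (- (q - r) / 2)) \<ge> 0" "layers_const r (2 powr (- (r - p) / 2)) \<ge> 0"
      using layers_const_pos[OF r, of "2 powr (- (q - r) / 2)"] layers_const_pos[OF r, of "2 powr (- (r - p) / 2)"] p q
      by (auto simp: powr_less_one less_imp_le)
    then show ?thesis using Z0 B0
      by (simp add: marcinkiewicz_const_def algebra_simps flip: ennreal_mult' ennreal_plus)
  qed
  finally show ?thesis by (simp add: Z_def B_def)
qed

end

section \<open>Partial fractions and divided differences of exponentials\<close>

text \<open>Lagrange interpolation: a polynomial of degree below the number of nodes is determined by its values
there, and dividing by the product over the nodes gives partial fractions.\<close>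

lemma lagrange_partial_fractions:
  fixes x :: "'i \<Rightarrow> real" and P :: "real poly"
  assumes fin: "finite D" and inj: "inj_on x D" and deg: "degree P < card D"
    and y: "\<And>j. j \<in> D \<Longrightarrow> y \<noteq> x j"
  shows "poly P y / (\<Prod>j\<in>D. y - x j)
    = (\<Sum>n\<in>D. poly P (x n) / (\<Prod>j\<in>D - {n}. x n - x j) / (y - x n))"
proof -
  define L where "L n = (\<Prod>j\<in>D - {n}. [:- x j, 1:])" for n
  have polyL: "poly (L n) z = (\<Prod>j\<in>D - {n}. z - x j)" for n z
    by (simp add: L_def poly_prod)
  define R where "R = (\<Sum>n\<in>D. smult (poly P (x n) / (\<Prod>j\<in>D - {n}. x n - x j)) (L n))"
  have ne: "(\<Prod>j\<in>D - {n}. x n - x j) \<noteq> 0" if "n \<in> D" for n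
    using fin inj that by (auto simp: inj_on_def)
  have Rx: "poly R (x m) = poly P (x m)" if m: "m \<in> D" for m
  proof -
    have "poly R (x m) = (\<Sum>n\<in>D. if n = m then poly P (x m) else 0)"
      unfolding R_def poly_sum poly_smult polyL
    proof (intro sum.cong refl)
      fix n assume n: "n \<in> D"
      show "poly P (x n) / (\<Prod>j\<in>D - {n}. x n - x j) * (\<Prod>j\<in>D - {n}. x m - x j)
          = (if n = m then poly P (x m) else 0)"
      proof (cases "n = m")
        case True
        then show ?thesis using ne[OF n] by simp
      next
        case False
        then have "(\<Prod>j\<in>D - {n}. x m - x j) = 0" using fin m by (intro prod_zero) auto
        then show ?thesis using False by simp
      qed
    qed
    then show ?thesis using fin m by simp
  qed
  have cpos: "card D > 0" using deg by simp
  have degL: "degree (L n) < card D" if "n \<in> D" for n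
  proof -
    have "degree (L n) \<le> (\<Sum>j\<in>D - {n}. degree [:- x j, 1:])" unfolding L_def using degree_prod_sum_le[of "D - {n}" "\<lambda>j. [:- x j, 1:]"] fin by (simp add: o_def)
    also have "\<dots> = card D - 1" using fin that by simp
    finally show ?thesis using cpos by simp
  qed
  have degR: "degree R \<le> card D - 1"
    unfolding R_def using degL
    by (intro degree_sum_le fin order.trans[OF degree_smult_le]) fastforce
  have "P = R"
  proof (rule ccontr)
    assume "P \<noteq> R"
    then have nz: "P - R \<noteq> 0" by simp
    have "x ` D \<subseteq> {z. poly (P - R) z = 0}" using Rx by auto
    then have "card (x ` D) \<le> card {z. poly (P - R) z = 0}"
      using poly_roots_finite[OF nz] by (intro card_mono)
    also have "\<dots> \<le> degree (P - R)" by (rule card_poly_roots_bound[OF nz])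
    also have "\<dots> \<le> card D - 1" using deg degR by (intro degree_diff_le) auto
    finally show False using cpos inj by (simp add: card_image)
  qed
  have "poly P y / (\<Prod>j\<in>D. y - x j) = poly R y / (\<Prod>j\<in>D. y - x j)" using \<open>P = R\<close> by simp
  also have "\<dots> = (\<Sum>n\<in>D. poly P (x n) / (\<Prod>j\<in>D - {n}. x n - x j) * ((\<Prod>j\<in>D - {n}. y - x j) / (\<Prod>j\<in>D. y - x j)))"
    by (simp add: R_def poly_sum polyL sum_divide_distrib)
  also have "\<dots> = (\<Sum>n\<in>D. poly P (x n) / (\<Prod>j\<in>D - {n}. x n - x j) / (y - x n))"
  proof (intro sum.cong refl)
    fix n assume n: "n \<in> D"
    have "(\<Prod>j\<in>D. y - x j) = (y - x n) * (\<Prod>j\<in>D - {n}. y - x j)"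
      using fin n by (rule prod.remove)
    moreover have "(\<Prod>j\<in>D - {n}. y - x j) \<noteq> 0" using fin y by auto
    ultimately show "poly P (x n) / (\<Prod>j\<in>D - {n}. x n - x j) * ((\<Prod>j\<in>D - {n}. y - x j) / (\<Prod>j\<in>D. y - x j))
        = poly P (x n) / (\<Prod>j\<in>D - {n}. x n - x j) / (y - x n)" by simp
  qed
  finally show ?thesis .
qed

text \<open>Partial fractions of the reciprocal of the product over all nodes but one, evaluated at that one. It
says that divided differences annihilate constants.\<close>

lemma sum_inverse_prod_diff_eq_0:
  fixes x :: "'i \<Rightarrow> real"
  assumes fin: "finite D" and inj: "inj_on x D" and card: "card D \<ge> 2"
  shows "(\<Sum>n\<in>D. 1 / (\<Prod>j\<in>D - {n}. x j - x n)) = 0"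
proof -
  obtain m where m: "m \<in> D" using card by fastforce
  define D' where "D' = D - {m}"
  have D': "finite D'" "inj_on x D'" "card D' > 0" "D = insert m D'" "m \<notin> D'"
    using fin inj card m by (auto simp: D'_def intro: inj_on_subset)
  have x_ne: "x m \<noteq> x j" if "j \<in> D'" for j using inj that m by (auto simp: D'_def inj_on_def)
  have "1 / (\<Prod>j\<in>D'. x j - x m) = (-1) ^ card D' * (1 / (\<Prod>j\<in>D'. x m - x j))"
  proof -
    have "(\<Prod>j\<in>D'. x j - x m) = (\<Prod>j\<in>D'. - 1 * (x m - x j))" by simp
    also have "\<dots> = (- 1) ^ card D' * (\<Prod>j\<in>D'. x m - x j)" by (subst prod.distrib) simp
    finally show ?thesis by (simp add: minus_one_power_iff)
  qed
  also have "1 / (\<Prod>j\<in>D'. x m - x j) = (\<Sum>n\<in>D'. 1 / (\<Prod>j\<in>D' - {n}. x n - x j) / (x m - x n))"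
    using lagrange_partial_fractions[of D' x 1 "x m"] D' x_ne by simp
  also have "(-1) ^ card D' * \<dots> = - (\<Sum>n\<in>D'. 1 / (\<Prod>j\<in>D - {n}. x j - x n))"
    unfolding sum_distrib_left sum_negf[symmetric]
  proof (intro sum.cong refl)
    fix n assume n: "n \<in> D'"
    have e: "D - {n} = insert m (D' - {n})" "m \<notin> D' - {n}" using D' n by auto
    have "(\<Prod>j\<in>D' - {n}. x j - x n) = (\<Prod>j\<in>D' - {n}. - 1 * (x n - x j))" by simp
    also have "\<dots> = (- 1) ^ card (D' - {n}) * (\<Prod>j\<in>D' - {n}. x n - x j)" by (subst prod.distrib) simp
    finally have "(\<Prod>j\<in>D - {n}. x j - x n) = (x m - x n) * ((- 1) ^ card (D' - {n}) * (\<Prod>j\<in>D' - {n}. x n - x j))"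
      using e D' by simp
    moreover have "card D' = Suc (card (D' - {n}))" using D' n by (simp add: card_Diff_singleton)
    ultimately show "(-1) ^ card D' * (1 / (\<Prod>j\<in>D' - {n}. x n - x j) / (x m - x n))
       = - (1 / (\<Prod>j\<in>D - {n}. x j - x n))"
      by (simp add: minus_one_power_iff mult.commute)
  qed
  finally have "1 / (\<Prod>j\<in>D'. x j - x m) = - (\<Sum>n\<in>D'. 1 / (\<Prod>j\<in>D - {n}. x j - x n))" .
  moreover have "(\<Sum>n\<in>D. 1 / (\<Prod>j\<in>D - {n}. x j - x n))
     = 1 / (\<Prod>j\<in>D'. x j - x m) + (\<Sum>n\<in>D'. 1 / (\<Prod>j\<in>D - {n}. x j - x n))"
    using fin m by (subst sum.remove[of D m]) (auto simp: D'_def)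
  ultimately show ?thesis by simp
qed

definition newton_coeff :: "(nat \<Rightarrow> real) \<Rightarrow> nat \<Rightarrow> nat \<Rightarrow> nat \<Rightarrow> real" where
  "newton_coeff lam s i j = 1 / (\<Prod>k\<in>{s..i} - {j}. lam k - lam j)"

text \<open>Up to sign, the divided difference of \<open>\<lambda>x. exp (- x * u)\<close> at \<open>lam s, \<dots>, lam i\<close>. These functions span
the same spaces as the exponentials, but they satisfy bounds that do not deteriorate when exponents
come close to each other.\<close>

definition newton_exp :: "(nat \<Rightarrow> real) \<Rightarrow> nat \<Rightarrow> nat \<Rightarrow> real \<Rightarrow> real" where
  "newton_exp lam s i u = (\<Sum>j=s..i. newton_coeff lam s i j * exp (- lam j * u))"

text \<open>Each divided difference is the convolution of the preceding one with an exponential: it solves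
\<open>y' + lam (Suc i) * y = newton_exp lam s i\<close>.\<close>

lemma newton_exp_deriv:
  assumes mono: "strict_mono lam" and i: "s \<le> i"
  shows "((\<lambda>u. exp (lam (Suc i) * u) * newton_exp lam s (Suc i) u)
    has_real_derivative exp (lam (Suc i) * u) * newton_exp lam s i u) (at u)"
proof -
  have inj: "lam j \<noteq> lam k" if "j \<noteq> k" for j k using strict_mono_eq[OF mono] that by blast
  have c: "newton_coeff lam s (Suc i) j * (lam (Suc i) - lam j) = newton_coeff lam s i j" if j: "j \<in> {s..i}" for j
  proof -
    have "{s..Suc i} - {j} = insert (Suc i) ({s..i} - {j})" using i j by auto
    then have "(\<Prod>k\<in>{s..Suc i} - {j}. lam k - lam j) = (lam (Suc i) - lam j) * (\<Prod>k\<in>{s..i} - {j}. lam k - lam j)"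
      by simp
    then show ?thesis using inj[of "Suc i" j] j by (simp add: newton_coeff_def)
  qed
  have eq: "(\<lambda>u. exp (lam (Suc i) * u) * newton_exp lam s (Suc i) u)
     = (\<lambda>u. \<Sum>j=s..Suc i. newton_coeff lam s (Suc i) j * exp ((lam (Suc i) - lam j) * u))"
    by (auto simp: newton_exp_def sum_distrib_left exp_diff exp_minus left_diff_distrib field_simps intro!: ext sum.cong)
  have "((\<lambda>u. exp (lam (Suc i) * u) * newton_exp lam s (Suc i) u) has_real_derivative
     (\<Sum>j=s..Suc i. newton_coeff lam s (Suc i) j * (exp ((lam (Suc i) - lam j) * u) * (lam (Suc i) - lam j)))) (at u)"
    unfolding eq by (auto intro!: derivative_eq_intros sum.cong)
  also have "(\<Sum>j=s..Suc i. newton_coeff lam s (Suc i) j * (exp ((lam (Suc i) - lam j) * u) * (lam (Suc i) - lam j)))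
     = (\<Sum>j=s..i. (newton_coeff lam s (Suc i) j * (lam (Suc i) - lam j)) * exp ((lam (Suc i) - lam j) * u))"
    using i by (simp add: mult_ac)
  also have "\<dots> = (\<Sum>j=s..i. newton_coeff lam s i j * exp ((lam (Suc i) - lam j) * u))"
    using c by (intro sum.cong) auto
  also have "\<dots> = exp (lam (Suc i) * u) * newton_exp lam s i u"
    by (auto simp: newton_exp_def sum_distrib_left exp_diff exp_minus left_diff_distrib field_simps intro!: sum.cong)
  finally show ?thesis .
qed

lemma newton_exp_0:
  assumes mono: "strict_mono lam" and i: "s < i"
  shows "newton_exp lam s i 0 = 0"
  using sum_inverse_prod_diff_eq_0[of "{s..i}" lam] i strict_mono_imp_inj_on[OF mono]
  by (auto simp: newton_exp_def newton_coeff_def intro: inj_on_subset)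

text \<open>Integrate the differential equation from the initial value 0. Convolution preserves nonnegativity,
and the upper bound is the value for coinciding exponents \<open>lam s\<close>.\<close>

lemma newton_exp_bounds:
  assumes mono: "strict_mono lam" and u: "u \<ge> 0" and i: "s \<le> i"
  shows "0 \<le> newton_exp lam s i u \<and> newton_exp lam s i u \<le> u ^ (i - s) / fact (i - s) * exp (- lam s * u)"
  using i u
proof (induction i arbitrary: u rule: dec_induct)
  case base
  then show ?case by (simp add: newton_exp_def newton_coeff_def)
next
  case (step i)
  let ?g = "\<lambda>u. exp (lam (Suc i) * u) * newton_exp lam s (Suc i) u"
  let ?d = "lam (Suc i) - lam s"
  let ?f = "\<lambda>u. u ^ (Suc (i - s)) / fact (Suc (i - s)) * exp (?d * u) - ?g u"
  have d0: "?d \<ge> 0" using step mono by (simp add: strict_mono_less_eq)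
  have z: "?g 0 = 0" using newton_exp_0[OF mono, of s "Suc i"] step by simp
  have "?g 0 \<le> ?g u"
  proof (rule DERIV_nonneg_imp_nondecreasing[OF step.prems])
    fix v assume "0 \<le> v" "v \<le> u"
    then show "\<exists>y. (?g has_real_derivative y) (at v) \<and> 0 \<le> y"
      using newton_exp_deriv[OF mono step.hyps(1), of v] step.IH[of v]
      by (intro exI[of _ "exp (lam (Suc i) * v) * newton_exp lam s i v"]) auto
  qed
  then have "0 \<le> newton_exp lam s (Suc i) u" using z by (simp add: zero_le_mult_iff)
  moreover have "?f 0 \<le> ?f u"
  proof (rule DERIV_nonneg_imp_nondecreasing[OF step.prems])
    fix v :: real assume v: "0 \<le> v" "v \<le> u"
    have p: "((\<lambda>u. u ^ (Suc (i - s)) / fact (Suc (i - s))) has_real_derivative v ^ (i - s) / fact (i - s)) (at v)"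
    proof -
      have "((\<lambda>u. u ^ Suc (i - s) / fact (Suc (i - s))) has_real_derivative
          real (Suc (i - s)) * v ^ (i - s) / fact (Suc (i - s))) (at v)"
        using DERIV_cdivide[OF DERIV_pow[of "Suc (i - s)" v]] by (simp del: power_Suc of_nat_Suc fact_Suc)
      also have "real (Suc (i - s)) * v ^ (i - s) / fact (Suc (i - s)) = v ^ (i - s) / fact (i - s)"
        by (simp del: of_nat_Suc)
      finally show ?thesis .
    qed
    have "(?f has_real_derivative
       (v ^ (i - s) / fact (i - s) * exp (?d * v) + exp (?d * v) * ?d * (v ^ (Suc (i - s)) / fact (Suc (i - s))))
        - exp (lam (Suc i) * v) * newton_exp lam s i v) (at v)"
      by (intro DERIV_diff DERIV_mult p newton_exp_deriv[OF mono step.hyps(1)])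
        (auto intro!: derivative_eq_intros)
    moreover have "exp (lam (Suc i) * v) * newton_exp lam s i v \<le> v ^ (i - s) / fact (i - s) * exp (?d * v)"
    proof -
      have "exp (lam (Suc i) * v) * newton_exp lam s i v
         \<le> exp (lam (Suc i) * v) * (v ^ (i - s) / fact (i - s) * exp (- lam s * v))"
        using step.IH[OF v(1)] by (intro mult_left_mono) auto
      also have "\<dots> = v ^ (i - s) / fact (i - s) * exp (?d * v)"
        by (simp add: left_diff_distrib exp_diff exp_minus field_simps)
      finally show ?thesis .
    qed
    moreover have "0 \<le> exp (?d * v) * ?d * (v ^ (Suc (i - s)) / fact (Suc (i - s)))"
      using d0 v by (intro mult_nonneg_nonneg divide_nonneg_nonneg) auto
    ultimately show "\<exists>y. (?f has_real_derivative y) (at v) \<and> 0 \<le> y" by (meson add_increasing2 diff_ge_0_iff_ge)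
  qed
  then have "?g u \<le> u ^ (Suc (i - s)) / fact (Suc (i - s)) * exp (?d * u)" using z by simp
  then have "exp (- lam (Suc i) * u) * ?g u
     \<le> exp (- lam (Suc i) * u) * (u ^ (Suc (i - s)) / fact (Suc (i - s)) * exp (?d * u))"
    by (intro mult_left_mono) auto
  then have "newton_exp lam s (Suc i) u \<le> u ^ (Suc (i - s)) / fact (Suc (i - s)) * exp (- lam s * u)"
    by (simp add: left_diff_distrib exp_diff exp_minus field_simps)
  ultimately show ?case using step.hyps by (simp add: Suc_diff_le)
qed

section \<open>Separated exponents and their rational functions\<close>

lemma prod_ge_exp:
  fixes t :: "'a \<Rightarrow> real"
  assumes "\<And>j. j \<in> J \<Longrightarrow> exp (- (E * d j)) \<le> t j" and "(\<Sum>j\<in>J. d j) \<le> S" and "E \<ge> 0"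
  shows "exp (- (E * S)) \<le> (\<Prod>j\<in>J. t j)"
proof (cases "finite J")
  case True
  have "E * (\<Sum>j\<in>J. d j) \<le> E * S" using assms by (intro mult_left_mono)
  then have "exp (- (E * S)) \<le> exp (\<Sum>j\<in>J. - (E * d j))"
    by (simp add: sum_negf sum_distrib_left)
  also have "\<dots> = (\<Prod>j\<in>J. exp (- (E * d j)))" using True by (rule exp_sum)
  also have "\<dots> \<le> (\<Prod>j\<in>J. t j)" using assms by (intro prod_mono) auto
  finally show ?thesis .
next
  case False
  then show ?thesis using assms by simp
qed

lemma prod_le_exp:
  fixes t :: "'a \<Rightarrow> real"
  assumes "\<And>j. j \<in> J \<Longrightarrow> 0 \<le> t j \<and> t j \<le> 1 + E * d j" and "(\<Sum>j\<in>J. d j) \<le> S" and "E \<ge> 0"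
  shows "(\<Prod>j\<in>J. t j) \<le> exp (E * S)"
proof (cases "finite J")
  case True
  have "(\<Prod>j\<in>J. t j) \<le> (\<Prod>j\<in>J. exp (E * d j))"
    using assms(1) by (intro prod_mono conjI order.trans[OF _ exp_ge_add_one_self]) auto
  also have "\<dots> = exp (E * (\<Sum>j\<in>J. d j))" using True by (simp add: exp_sum[symmetric] sum_distrib_left)
  also have "\<dots> \<le> exp (E * S)" using assms by (simp add: mult_left_mono)
  finally show ?thesis .
next
  case False
  then have "0 \<le> S" using assms by simp
  then show ?thesis using False assms by simp
qed

text \<open>Turns factors near 1 into exponentials, so that infinite products are controlled by geometric series.
The bound \<open>1 / Q\<close> on \<open>a\<close> keeps the factor away from 0.\<close>

lemma exp_neg_le_quotient:
  fixes a b y Q :: real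
  assumes a: "0 \<le> a" "a \<le> 1 / Q" and Q: "Q > 1" and b: "0 \<le> b" and y: "a \<le> y" "b \<le> y"
  shows "exp (- ((Q / (Q - 1) + 1) * y)) \<le> (1 - a) / (1 + b)"
proof -
  have a1: "1 - a \<ge> (Q - 1) / Q" using a Q by (simp add: field_simps)
  then have a2: "1 - a > 0" using Q by (smt (verit) divide_pos_pos)
  have "1 / (1 - a) = 1 + a / (1 - a)" using a2 by (simp add: field_simps)
  also have "\<dots> \<le> 1 + y * (Q / (Q - 1))"
  proof -
    have "1 / (1 - a) \<le> 1 / ((Q - 1) / Q)" using a1 Q by (intro frac_le) auto
    then have "a * (1 / (1 - a)) \<le> y * (1 / ((Q - 1) / Q))" using a y a2 by (intro mult_mono) auto
    then show ?thesis by simp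
  qed
  also have "\<dots> \<le> exp (y * (Q / (Q - 1)))" by (rule exp_ge_add_one_self)
  finally have 1: "exp (- (y * (Q / (Q - 1)))) \<le> 1 - a"
    using a2 by (simp add: exp_minus field_simps)
  have "1 + b \<le> 1 + y" using y by simp
  also have "\<dots> \<le> exp y" by (rule exp_ge_add_one_self)
  finally have 2: "exp (- y) \<le> 1 / (1 + b)" using b by (simp add: exp_minus field_simps)
  have "exp (- ((Q / (Q - 1) + 1) * y)) = exp (- (y * (Q / (Q - 1)))) * exp (- y)"
    by (simp add: algebra_simps flip: exp_add)
  also have "\<dots> \<le> (1 - a) * (1 / (1 + b))" using 1 2 a2 by (intro mult_mono) auto
  finally show ?thesis by simp
qed

lemma quotient_scale: "c > 0 \<Longrightarrow> (1 - a / c) / (1 + b / c) = (c - a) / (c + b)" for a b c :: real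
proof -
  assume c: "c > 0"
  then have "1 - a / c = (c - a) / c" "1 + b / c = (c + b) / c" by (simp_all add: field_simps)
  then show ?thesis using c by simp
qed

lemma one_plus_over_one_minus_le:
  fixes x c r B :: real
  assumes x: "0 \<le> x" "x \<le> y" "x \<le> r" and r: "r < 1" and c: "0 \<le> c" "c \<le> B"
  shows "(1 + c * x) / (1 - x) \<le> 1 + (1 + B) / (1 - r) * y"
proof -
  have "(1 + c * x) / (1 - x) = 1 + (1 + c) * x * (1 / (1 - x))" using x r by (simp add: field_simps)
  also have "(1 + c) * x * (1 / (1 - x)) \<le> (1 + B) * y * (1 / (1 - r))"
    using x r c by (intro mult_mono divide_left_mono) auto
  finally show ?thesis by simp
qed

text \<open>The indices are partitioned into groups, and \<open>start i\<close> is the first index of the group of \<open>i\<close>. A group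
has at most \<open>N\<close> elements. The exponents, increased by \<open>shift\<close>, are comparable up to the factor \<open>R\<close>
within a group, and different groups are separated by the ratio \<open>Q\<close>.

The sequence \<open>w\<close> is a majorant of the shifted exponents that is comparable to them but lacunary also
where they cluster. The price is a factor of up to \<open>A\<close> for each index in quotients of products of
\<open>w j\<close> and \<open>lam j + shift\<close>; the assumption \<open>growth\<close> says that the exponents grow fast enough to pay it
twice. The shift stands for multiplication by a power of \<open>t\<close>, which supplies decay at \<open>t = 0\<close>.\<close>

locale separated_exponents = lacunary w \<rho> for w :: "nat \<Rightarrow> real" and \<rho> :: real +
  fixes lam :: "nat \<Rightarrow> real" and shift :: real and start :: "nat \<Rightarrow> nat"
    and A R Q D c0 :: real and N :: nat
  assumes lam_pos: "0 < lam 0" and lam_mono: "strict_mono lam" and shift: "0 \<le> shift"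
    and A: "1 < A" and \<rho>_N: "\<rho> ^ N \<le> A"
    and shift_le_w: "lam j + shift \<le> w j" and w_le_shift: "w j \<le> A * (lam j + shift)"
    and growth: "A ^ (2 * k) * (lam i + shift) \<le> D * (lam (i + k) + shift)"
    and start_le: "start i \<le> i" and less_start: "i < start i + N"
    and start_eq: "start i \<le> j \<Longrightarrow> j \<le> i \<Longrightarrow> start j = start i"
    and block_ratio: "lam i + shift \<le> R * (lam (start i) + shift)"
    and Q: "1 < Q" and gap: "j < start i \<Longrightarrow> Q * (lam j + shift) \<le> lam (start i) + shift"
    and c0: "0 < c0" and w_le_lam: "c0 * w j \<le> lam j"
begin

definition sh :: "nat \<Rightarrow> real" where "sh j = lam j + shift"

lemma lam_gt_0: "0 < lam j"
  using lam_pos lam_mono strict_mono_less_eq[OF lam_mono, of 0 j] by auto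

lemma sh_pos: "0 < sh j"
  using lam_gt_0[of j] shift by (simp add: sh_def)

lemma sh_mono: "i \<le> j \<Longrightarrow> sh i \<le> sh j"
  using lam_mono by (simp add: sh_def strict_mono_less_eq)

lemma sh_less: "i < j \<Longrightarrow> sh i < sh j"
  using lam_mono by (simp add: sh_def strict_mono_less)

lemma sh_le_w: "sh j \<le> w j" and w_le_sh: "w j \<le> A * sh j"
  using shift_le_w[of j] w_le_shift[of j] by (auto simp: sh_def)

lemma sh_gap: "i < start j \<Longrightarrow> Q * sh i \<le> sh j"
  using gap[of i j] sh_mono[OF start_le[of j]] by (simp add: sh_def)

lemma sh_block: "start j \<le> i \<Longrightarrow> i \<le> j \<Longrightarrow> sh j \<le> R * sh i"
proof -
  assume ij: "start j \<le> i" "i \<le> j"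
  then have "sh j \<le> R * sh (start i)" using block_ratio[of j] start_eq[of j i] by (simp add: sh_def)
  also have "\<dots> \<le> R * sh i"
  proof (rule mult_left_mono[OF sh_mono[OF start_le]])
    show "0 \<le> R" using block_ratio[of 0] sh_pos[of 0] sh_pos[of "start 0"] start_le[of 0]
      by (simp add: sh_def)
  qed
  finally show ?thesis .
qed

lemma R_ge_1: "R \<ge> 1"
  using sh_block[of 0 0] start_le[of 0] sh_pos[of 0] by simp

lemma D_ge_1: "D \<ge> 1"
  using growth[of 0 0] sh_pos[of 0] by (simp add: sh_def)

lemma c0_le_1: "c0 \<le> 1"
proof -
  have "c0 * w 0 \<le> 1 * w 0" using w_le_lam[of 0] sh_le_w[of 0] shift by (simp add: sh_def)
  then show ?thesis using w0 by (simp only: mult_le_cancel_right_pos)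
qed

abbreviation index_dist :: "nat \<Rightarrow> nat \<Rightarrow> nat" where "index_dist n j \<equiv> (n - j) + (j - n)"

lemma inv_rho: "0 < 1 / \<rho>" "1 / \<rho> < 1" using \<rho> by auto

text \<open>The rational function attached to \<open>i\<close> is the product over \<open>j\<close> of these factors divided by \<open>x + w j\<close>. It
vanishes at \<open>sh j\<close> unless \<open>j\<close> is \<open>i\<close> or a later member of the group of \<open>i\<close>. The factors are
normalised to make each quotient close to 1 at \<open>x = sh i\<close> for \<open>j\<close> far from \<open>i\<close>. As the factor of \<open>i\<close>
itself is constant, the numerator has smaller degree than the denominator.\<close>

definition zero_factor :: "nat \<Rightarrow> nat \<Rightarrow> real poly" where
  "zero_factor i j = (if j < i then [:- sh j, 1:] else if start j \<le> i then [:sh i:] else [:w j, - w j / sh j:])"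

definition symbol_num :: "nat \<Rightarrow> nat \<Rightarrow> real poly" where
  "symbol_num i K = (\<Prod>j\<le>K. zero_factor i j)"

definition symbol :: "nat \<Rightarrow> nat \<Rightarrow> real \<Rightarrow> real" where
  "symbol i K x = poly (symbol_num i K) x / (\<Prod>j\<le>K. x + w j)"

definition residue :: "nat \<Rightarrow> nat \<Rightarrow> nat \<Rightarrow> real" where
  "residue i K n = poly (symbol_num i K) (- w n) / (\<Prod>j\<in>{..K} - {n}. w j - w n)"

lemma degree_symbol_num: "i \<le> K \<Longrightarrow> degree (symbol_num i K) \<le> K"
proof -
  assume i: "i \<le> K"
  have "degree (symbol_num i K) \<le> (\<Sum>j\<le>K. degree (zero_factor i j))"
    unfolding symbol_num_def using degree_prod_sum_le[of "{..K}" "zero_factor i"] by (simp add: o_def)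
  also have "\<dots> \<le> (\<Sum>j\<le>K. if j = i then 0 else 1)"
    using start_le by (intro sum_mono) (auto simp: zero_factor_def)
  also have "\<dots> = card ({..K} - {i})" by (simp add: sum.If_cases Diff_eq Int_commute flip: Compl_eq)
  also have "\<dots> = K" using i by simp
  finally show ?thesis .
qed

text \<open>Since \<open>1 / (x + w n)\<close> is the Laplace transform of \<open>exp (- w n * u)\<close>, the function \<open>symbol i K\<close> is the
Laplace transform of the combination of these exponentials with the coefficients \<open>residue i K n\<close>.\<close>

lemma symbol_partial_fractions:
  assumes i: "i \<le> K" and x: "x \<ge> 0"
  shows "symbol i K x = (\<Sum>n\<le>K. residue i K n / (x + w n))"
proof -
  have inj: "inj_on (\<lambda>j. - w j) {..K}" using w_less by (intro inj_onI) (metis less_irrefl linorder_neqE_nat neg_equal_iff_equal)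
  have ne: "x \<noteq> - w j" for j using w_pos[of j] x by linarith
  show ?thesis
    using lagrange_partial_fractions[of "{..K}" "\<lambda>j. - w j" "symbol_num i K" x] degree_symbol_num[OF i] inj ne
    by (simp add: symbol_def residue_def)
qed

lemma symbol_zero: "j \<le> K \<Longrightarrow> j < i \<or> i < start j \<Longrightarrow> symbol i K (sh j) = 0"
proof -
  assume j: "j \<le> K" "j < i \<or> i < start j"
  have "poly (zero_factor i j) (sh j) = 0" using j sh_pos[of j] start_le[of j] by (auto simp: zero_factor_def)
  then have "poly (symbol_num i K) (sh j) = 0" using j by (auto simp: symbol_num_def poly_prod intro!: prod_zero)
  then show ?thesis by (simp add: symbol_def)
qed

text \<open>The part of the bound for a factor at the pole \<open>- w n\<close> that does not tend to 1 as \<open>j\<close> moves away from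
\<open>n\<close>.\<close>

definition growth_factor :: "nat \<Rightarrow> nat \<Rightarrow> nat \<Rightarrow> real" where
  "growth_factor i n j = (if j = i \<and> i < n then w i / w n else if i < j \<and> j < n then A else 1)"

text \<open>At the pole \<open>- w n\<close> a factor differs from 1 by a geometrically small amount, because the poles are
separated. The exceptions are the indices between \<open>i\<close> and \<open>n\<close>, where the normalisation costs up to
\<open>A\<close>, and the missing zero at \<open>j = i\<close>, which gains \<open>w i / w n\<close>.\<close>

lemma zero_factor_ratio_le:
  assumes jn: "j \<noteq> n"
  shows "\<bar>poly (zero_factor i j) (- w n)\<bar> / \<bar>w j - w n\<bar>
     \<le> growth_factor i n j * (1 + (1 + A) / (1 - 1 / \<rho>) * (1 / \<rho>) ^ index_dist n j)"
    (is "_ \<le> _ * (1 + ?B * _)")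
proof -
  note wn = w_pos[of n] and wj = w_pos[of j] and wi = w_pos[of i]
  have shw: "w j / sh j \<le> A" using w_le_sh[of j] sh_pos[of j] by (simp add: divide_le_eq)
  have r1: "(1 / \<rho>) ^ k \<le> 1 / \<rho>" if "k > 0" for k
    using inv_rho power_decreasing[of 1 k "1 / \<rho>"] that by simp
  show ?thesis
  proof (cases "j < n")
    case True
    define x where "x = w j / w n"
    have x: "0 \<le> x" "x \<le> (1 / \<rho>) ^ index_dist n j" "x \<le> 1 / \<rho>"
      using ratio_le[of j n] r1[of "n - j"] True wn wj by (auto simp: x_def simp del: power_one_over)
    have den: "\<bar>w j - w n\<bar> = w n * (1 - x)" using w_less[OF True] wn by (simp add: x_def field_simps)
    have x1: "1 - x > 0" using x inv_rho by linarith
    have wx: "w j = w n * x" using wn by (simp add: x_def)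
    have g1: "(1 + x) / (1 - x) \<le> 1 + ?B * (1 / \<rho>) ^ index_dist n j"
      using one_plus_over_one_minus_le[OF x inv_rho(2), of 1 A] A by simp
    have g0: "1 / (1 - x) \<le> 1 + ?B * (1 / \<rho>) ^ index_dist n j"
      using one_plus_over_one_minus_le[OF x inv_rho(2), of 0 A] A by simp
    have pos: "0 \<le> 1 + ?B * (1 / \<rho>) ^ index_dist n j" using g0 x1 by (smt (verit) divide_nonneg_pos)
    consider "j < i" | "j = i" | "i < j" "start j \<le> i" | "i < j" "\<not> start j \<le> i" by linarith
    then show ?thesis
    proof cases
      case 1
      have "\<bar>poly (zero_factor i j) (- w n)\<bar> \<le> w n * (1 + x)"
        using 1 sh_le_w[of j] sh_pos[of j] wn wx by (simp add: zero_factor_def algebra_simps)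
      then have "\<bar>poly (zero_factor i j) (- w n)\<bar> / \<bar>w j - w n\<bar> \<le> w n * (1 + x) / (w n * (1 - x))"
        unfolding den using wn x1 by (intro divide_right_mono) auto
      then show ?thesis using g1 1 wn by (simp add: growth_factor_def)
    next
      case 2
      have "\<bar>poly (zero_factor i j) (- w n)\<bar> \<le> w i"
        using 2 sh_le_w[of i] sh_pos[of i] start_le[of i] by (simp add: zero_factor_def)
      then have "\<bar>poly (zero_factor i j) (- w n)\<bar> / \<bar>w j - w n\<bar> \<le> w i / (w n * (1 - x))"
        unfolding den using wn x1 by (intro divide_right_mono) auto
      also have "\<dots> = w i / w n * (1 / (1 - x))" by simp
      also have "\<dots> \<le> w i / w n * (1 + ?B * (1 / \<rho>) ^ index_dist n j)"
        using g0 wi wn by (intro mult_left_mono) auto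
      finally show ?thesis using 2 True by (simp add: growth_factor_def)
    next
      case 3
      have "\<bar>poly (zero_factor i j) (- w n)\<bar> \<le> w n"
        using 3 sh_le_w[of i] sh_pos[of i] w_mono[of i n] True by (simp add: zero_factor_def)
      then have "\<bar>poly (zero_factor i j) (- w n)\<bar> / \<bar>w j - w n\<bar> \<le> w n / (w n * (1 - x))"
        unfolding den using wn x1 by (intro divide_right_mono) auto
      also have "\<dots> \<le> 1 * (1 + ?B * (1 / \<rho>) ^ index_dist n j)" using g0 wn by simp
      also have "\<dots> \<le> A * (1 + ?B * (1 / \<rho>) ^ index_dist n j)" using A pos by (intro mult_right_mono) auto
      finally show ?thesis using 3 True by (simp add: growth_factor_def)
    next
      case 4
      have "\<bar>poly (zero_factor i j) (- w n)\<bar> = w j / sh j * (sh j + w n)"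
        using 4 sh_pos[of j] wn wj by (simp add: zero_factor_def field_simps)
      also have "\<dots> \<le> A * (w j + w n)"
        using shw sh_le_w[of j] sh_pos[of j] wn wj A by (intro mult_mono) auto
      also have "\<dots> = A * (w n * (1 + x))" using wx by (simp add: algebra_simps)
      finally have "\<bar>poly (zero_factor i j) (- w n)\<bar> / \<bar>w j - w n\<bar> \<le> A * (w n * (1 + x)) / (w n * (1 - x))"
        unfolding den using wn x1 by (intro divide_right_mono) auto
      also have "\<dots> = A * ((1 + x) / (1 - x))" using wn by simp
      also have "\<dots> \<le> A * (1 + ?B * (1 / \<rho>) ^ index_dist n j)" using A g1 by (intro mult_left_mono) auto
      finally show ?thesis using 4 True by (simp add: growth_factor_def)
    qed
  next
    case False
    with jn have True: "n < j" by simp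
    define x where "x = w n / w j"
    have x: "0 \<le> x" "x \<le> (1 / \<rho>) ^ index_dist n j" "x \<le> 1 / \<rho>"
      using ratio_le[of n j] r1[of "j - n"] True wn wj by (auto simp: x_def simp del: power_one_over)
    have den: "\<bar>w j - w n\<bar> = w j * (1 - x)" using w_less[OF True] wj by (simp add: x_def field_simps)
    have x1: "1 - x > 0" using x inv_rho by linarith
    have wx: "w n = w j * x" using wj by (simp add: x_def)
    have f1: "growth_factor i n j = 1" using True by (simp add: growth_factor_def)
    have gA: "(1 + A * x) / (1 - x) \<le> 1 + ?B * (1 / \<rho>) ^ index_dist n j"
      using one_plus_over_one_minus_le[OF x inv_rho(2), of A A] A by simp
    have "\<bar>poly (zero_factor i j) (- w n)\<bar> \<le> w j * (1 + A * x)"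
    proof -
      have xA: "w n \<le> A * w n" using A wn by simp
      consider "j < i" | "i \<le> j" "start j \<le> i" | "i \<le> j" "\<not> start j \<le> i" by linarith
      then show ?thesis
      proof cases
        case 1
        then show ?thesis using sh_le_w[of j] sh_pos[of j] wn wx xA by (simp add: zero_factor_def algebra_simps)
      next
        case 2
        then show ?thesis using sh_le_w[of j] sh_mono[of i j] sh_pos[of i] wn wx xA by (simp add: zero_factor_def algebra_simps)
      next
        case 3
        have "\<bar>poly (zero_factor i j) (- w n)\<bar> = w j + w j / sh j * w n"
          using 3 sh_pos[of j] wn wj by (simp add: zero_factor_def field_simps)
        also have "\<dots> \<le> w j + A * w n" using shw wn by (intro add_left_mono mult_right_mono) auto
        finally show ?thesis using wx by (simp add: algebra_simps)
      qed
    qed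
    then have "\<bar>poly (zero_factor i j) (- w n)\<bar> / \<bar>w j - w n\<bar> \<le> w j * (1 + A * x) / (w j * (1 - x))"
      unfolding den using wj x1 by (intro divide_right_mono) auto
    also have "\<dots> = (1 + A * x) / (1 - x)" using wj by simp
    finally show ?thesis using gA f1 by simp
  qed
qed

text \<open>The gain \<open>w i / w n\<close> of the missing zero is of order \<open>A ^ (- 2 * (n - i))\<close> by the growth of the
exponents, which outweighs the factors \<open>A\<close>.\<close>

lemma prod_growth_factor_le:
  assumes i: "i \<le> K" and n: "n \<le> K"
  shows "(\<Prod>j\<in>{..K} - {n}. growth_factor i n j) \<le> A * D * (1 / A) ^ (n - i)"
proof (cases "i < n")
  case False
  then have "growth_factor i n j = 1" for j by (auto simp: growth_factor_def)
  moreover have "1 * 1 \<le> A * D" using A D_ge_1 by (intro mult_mono) auto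
  ultimately show ?thesis using False by simp
next
  case True
  define d where "d = n - Suc i"
  have d: "n = i + Suc d" using True by (simp add: d_def)
  have "(\<Prod>j\<in>{..K} - {n}. growth_factor i n j) = (\<Prod>j\<in>{i..<n}. growth_factor i n j)"
    using True n by (intro prod.mono_neutral_right) (auto simp: growth_factor_def)
  also have "{i..<n} = insert i {Suc i..<n}" using True by auto
  also have "(\<Prod>j\<in>insert i {Suc i..<n}. growth_factor i n j) = growth_factor i n i * (\<Prod>j\<in>{Suc i..<n}. growth_factor i n j)"
    by (rule prod.insert) auto
  also have "(\<Prod>j\<in>{Suc i..<n}. growth_factor i n j) = (\<Prod>j\<in>{Suc i..<n}. A)"
    by (intro prod.cong) (auto simp: growth_factor_def)
  also have "\<dots> = A ^ d" using d by simp
  also have "growth_factor i n i = w i / w n" using True by (simp add: growth_factor_def)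
  also have "w i / w n * A ^ d \<le> A * D / A ^ (2 * Suc d) * A ^ d"
  proof (rule mult_right_mono)
    have B: "A ^ (2 * Suc d) > 0" using A by (intro zero_less_power) auto
    have "A ^ (2 * Suc d) * w i \<le> A ^ (2 * Suc d) * (A * sh i)"
      using w_le_sh B by (intro mult_left_mono) auto
    also have "\<dots> = A * (A ^ (2 * Suc d) * sh i)" by (simp only: mult_ac)
    also have "\<dots> \<le> A * (D * sh n)" using growth[of "Suc d" i] A d by (intro mult_left_mono) (auto simp: sh_def)
    also have "\<dots> \<le> A * (D * w n)" using A D_ge_1 sh_le_w by (intro mult_left_mono) auto
    finally have "w i * A ^ (2 * Suc d) \<le> A * D * w n" by (simp only: mult_ac)
    then show "w i / w n \<le> A * D / A ^ (2 * Suc d)"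
      unfolding pos_le_divide_eq[OF B] times_divide_eq_left pos_divide_le_eq[OF w_pos] .
  qed (use A in auto)
  also have "\<dots> = A * D * (1 / A) ^ (n - i) * (1 / A)"
  proof -
    have "2 * Suc d = d + (Suc d + 1)" by simp
    then have "A ^ (2 * Suc d) = A ^ d * (A ^ Suc d * A)" by (simp only: power_add power_one_right)
    then show ?thesis using A d by (simp add: power_one_over del: power_Suc)
  qed
  also have "\<dots> \<le> A * D * (1 / A) ^ (n - i) * 1"
    using A D_ge_1 by (intro mult_left_mono) auto
  finally show ?thesis by simp
qed

definition residue_const :: real where
  "residue_const = 2 * A * (A * D) * exp ((1 + A) / (1 - 1 / \<rho>) * (2 / (1 - 1 / \<rho>)))"

lemma residue_const_pos: "residue_const > 0"
  using A D_ge_1 by (simp add: residue_const_def)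

text \<open>However close the zeros are to each other, the separated poles keep the coefficients of the functional
of order \<open>w n\<close>, and beyond \<open>i\<close> the missing zero makes them geometrically smaller.\<close>

lemma residue_le:
  assumes i: "i \<le> K" and n: "n \<le> K"
  shows "\<bar>residue i K n\<bar> \<le> residue_const * w n * (1 / A) ^ (n - i)"
proof -
  let ?B = "(1 + A) / (1 - 1 / \<rho>)"
  have own: "\<bar>poly (zero_factor i n) (- w n)\<bar> \<le> 2 * A * w n"
  proof -
    have wn: "w n \<le> A * w n" using A w_pos[of n] by simp
    consider "n < i" | "i \<le> n" "start n \<le> i" | "i \<le> n" "\<not> start n \<le> i" by linarith
    then show ?thesis
    proof cases
      case 1
      then have "\<bar>poly (zero_factor i n) (- w n)\<bar> = w n + sh n"
        using sh_pos[of n] w_pos[of n] by (simp add: zero_factor_def)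
      then show ?thesis using sh_le_w[of n] wn by linarith
    next
      case 2
      then have "\<bar>poly (zero_factor i n) (- w n)\<bar> = sh i"
        using sh_pos[of i] by (simp add: zero_factor_def)
      then show ?thesis using sh_le_w[of n] sh_mono[OF 2(1)] w_pos[of n] wn by linarith
    next
      case 3
      have "\<bar>poly (zero_factor i n) (- w n)\<bar> = w n + w n / sh n * w n"
        using 3 sh_pos[of n] w_pos[of n] by (simp add: zero_factor_def)
      also have "\<dots> \<le> w n + A * w n" using w_le_sh[of n] sh_pos[of n] w_pos[of n]
        by (intro add_left_mono mult_right_mono) (auto simp: divide_le_eq)
      finally show ?thesis using wn by linarith
    qed
  qed
  have "\<bar>residue i K n\<bar> = \<bar>poly (zero_factor i n) (- w n)\<bar> * (\<Prod>j\<in>{..K} - {n}. \<bar>poly (zero_factor i j) (- w n)\<bar> / \<bar>w j - w n\<bar>)"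
  proof -
    have "poly (symbol_num i K) (- w n) = poly (zero_factor i n) (- w n) * (\<Prod>j\<in>{..K} - {n}. poly (zero_factor i j) (- w n))"
      using n by (simp add: symbol_num_def poly_prod prod.remove[of "{..K}" n])
    then show ?thesis by (simp add: residue_def abs_mult abs_prod prod_dividef)
  qed
  also have "\<dots> \<le> 2 * A * w n * (\<Prod>j\<in>{..K} - {n}. growth_factor i n j * (1 + ?B * (1 / \<rho>) ^ index_dist n j))"
    using own zero_factor_ratio_le A w_pos[of n] by (intro mult_mono prod_mono prod_nonneg) (auto simp: less_imp_le)
  also have "\<dots> = 2 * A * w n * ((\<Prod>j\<in>{..K} - {n}. growth_factor i n j) * (\<Prod>j\<in>{..K} - {n}. 1 + ?B * (1 / \<rho>) ^ index_dist n j))"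
    by (simp add: prod.distrib)
  also have "\<dots> \<le> 2 * A * w n * (A * D * (1 / A) ^ (n - i) * exp (?B * (2 / (1 - 1 / \<rho>))))"
  proof (intro mult_left_mono mult_mono prod_growth_factor_le i n prod_le_exp)
    show "(\<Sum>j\<in>{..K} - {n}. (1 / \<rho>) ^ index_dist n j) \<le> 2 / (1 - 1 / \<rho>)"
      using inv_rho by (intro sum_power_dist_le) auto
  qed (use A D_ge_1 w_pos[of n] inv_rho in \<open>auto intro!: prod_nonneg add_nonneg_nonneg mult_nonneg_nonneg divide_nonneg_nonneg\<close>)
  also have "\<dots> = residue_const * w n * (1 / A) ^ (n - i)" by (simp add: residue_const_def)
  finally show ?thesis .
qed

section \<open>A basis of divided differences\<close>

text \<open>The normalisation makes the function bounded uniformly in \<open>k\<close>; it then varies on the scale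
\<open>1 / w k\<close>.\<close>

definition newton_basis :: "nat \<Rightarrow> real \<Rightarrow> real" where
  "newton_basis k u = sh k ^ (k - start k) * newton_exp lam (start k) k u"

definition own_const :: real where
  "own_const = exp (- ((A\<^sup>2 * R + (Q / (Q - 1) + 1) * A) * (2 / (1 - 1 / \<rho>))))"

text \<open>The value of the functional on the basis function \<open>i\<close>. Outside the group of \<open>i\<close> the gap \<open>Q\<close> keeps every
factor away from 0, and the factors tend to 1 geometrically. Inside the group the coefficient of the
divided difference cancels the small differences of exponents.\<close>

lemma own_coeff_ge:
  assumes i: "i \<le> K"
  shows "own_const \<le> \<bar>sh i ^ (i - start i) * newton_coeff lam (start i) i i * symbol i K (sh i)\<bar>"
proof -
  let ?E = "A\<^sup>2 * R + (Q / (Q - 1) + 1) * A"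
  \<comment> \<open>Within the group, the factor of the divided difference cancels the zero at \<open>sh j\<close>.\<close>
  define t where "t j = (if start i \<le> j \<and> j < i then sh i / (sh i - sh j) else 1)
     * (\<bar>poly (zero_factor i j) (sh i)\<bar> / (sh i + w j))" for j
  have dpos: "sh i + w j > 0" for j using sh_pos[of i] w_pos[of j] by simp
  have E1: "A\<^sup>2 * R \<le> ?E" "(Q / (Q - 1) + 1) * A \<le> ?E"
    using A R_ge_1 Q by auto
  have low: "exp (- (?E * (1 / \<rho>) ^ index_dist i j)) \<le> t j" if j: "j \<le> K" for j
  proof -
    have wA: "w j / sh i \<le> A * (1 / \<rho>) ^ index_dist i j" if "j \<le> i"
    proof -
      have "w j / sh i \<le> A * (w j / w i)"
        using w_le_sh[of i] sh_pos[of i] w_pos[of i] w_pos[of j] by (simp add: field_simps)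
      also have "\<dots> \<le> A * (1 / \<rho>) ^ index_dist i j" using ratio_le[OF that] A that by (intro mult_left_mono) auto
      finally show ?thesis .
    qed
    have wA': "sh i / sh j \<le> A * (1 / \<rho>) ^ index_dist i j" if "i \<le> j"
    proof -
      have "sh i / sh j \<le> w i / (w j / A)"
        using w_le_sh[of j] sh_le_w[of i] sh_pos[of i] w_pos[of j] A
        by (intro frac_le) (auto simp: divide_le_eq mult.commute)
      also have "\<dots> = A * (w i / w j)" by simp
      also have "\<dots> \<le> A * (1 / \<rho>) ^ index_dist i j" using ratio_le[OF that] A that by (intro mult_left_mono) auto
      finally show ?thesis .
    qed
    have gapcase: "exp (- (?E * (1 / \<rho>) ^ index_dist i j)) \<le> (1 - a) / (1 + b)"
      if "0 \<le> a" "a \<le> 1 / Q" "0 \<le> b" "a \<le> A * (1 / \<rho>) ^ index_dist i j" "b \<le> A * (1 / \<rho>) ^ index_dist i j" for a b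
    proof -
      have "exp (- (?E * (1 / \<rho>) ^ index_dist i j)) \<le> exp (- ((Q / (Q - 1) + 1) * (A * (1 / \<rho>) ^ index_dist i j)))"
        using mult_right_mono[OF E1(2), of "(1 / \<rho>) ^ index_dist i j"] \<rho> by (simp add: mult_ac)
      also have "\<dots> \<le> (1 - a) / (1 + b)" using that Q by (intro exp_neg_le_quotient)
      finally show ?thesis .
    qed
    have blockcase: "exp (- (?E * (1 / \<rho>) ^ index_dist i j)) \<le> 1 / (1 + w j / sh i)"
      if "w j \<le> A * R * sh i" "index_dist i j < N"
    proof -
      have "1 \<le> A * (1 / \<rho>) ^ index_dist i j"
      proof -
        have "\<rho> ^ index_dist i j \<le> \<rho> ^ N" using \<rho> that by (intro power_increasing) auto
        then have "\<rho> ^ index_dist i j \<le> A" using \<rho>_N by simp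
        then show ?thesis using \<rho> by (simp add: power_one_over field_simps)
      qed
      then have "A * R * 1 \<le> A * R * (A * (1 / \<rho>) ^ index_dist i j)" using A R_ge_1 by (intro mult_left_mono) auto
      then have "w j / sh i \<le> A\<^sup>2 * R * (1 / \<rho>) ^ index_dist i j"
        using that sh_pos[of i] by (simp add: divide_le_eq power2_eq_square mult_ac)
          (smt (verit) mult_right_mono mult.commute mult.left_commute)
      also have "\<dots> \<le> ?E * (1 / \<rho>) ^ index_dist i j" using \<rho> E1 by (intro mult_right_mono) auto
      finally have "1 + w j / sh i \<le> exp (?E * (1 / \<rho>) ^ index_dist i j)"
        using exp_ge_add_one_self[of "?E * (1 / \<rho>) ^ index_dist i j"] by linarith
      moreover have "1 + w j / sh i > 0" using w_pos[of j] sh_pos[of i] by (simp add: add_pos_pos)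
      ultimately show ?thesis by (simp add: exp_minus field_simps)
    qed
    consider "j < start i" | "start i \<le> j" "j < i" | "i \<le> j" "start j \<le> i" | "i \<le> j" "i < start j" by linarith
    then show ?thesis
    proof cases
      case 1
      have ji: "j < i" using 1 start_le[of i] by simp
      have "t j = (1 - sh j / sh i) / (1 + w j / sh i)"
        using 1 ji sh_less[OF ji] sh_pos[of i] by (simp add: t_def zero_factor_def quotient_scale)
      moreover have "sh j / sh i \<le> 1 / Q" using sh_gap[OF 1] sh_pos[of i] Q by (simp add: field_simps)
      moreover have "sh j / sh i \<le> w j / sh i" using sh_le_w[of j] sh_pos[of i] by (intro divide_right_mono) auto
      ultimately show ?thesis using wA ji sh_pos[of i] sh_pos[of j] w_pos[of j] by (simp only:) (intro gapcase, auto)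
    next
      case 2
      have "t j = 1 / (1 + w j / sh i)"
        using 2 sh_less[OF 2(2)] sh_pos[of i] quotient_scale[of "sh i" 0 "w j"] by (simp add: t_def zero_factor_def)
      moreover have "w j \<le> A * R * sh i"
      proof -
        have "w j \<le> w i" using 2 by (simp add: w_mono)
        also have "\<dots> \<le> A * sh i" by (rule w_le_sh)
        also have "\<dots> \<le> A * (R * sh i)" using A R_ge_1 sh_pos[of i] by (intro mult_left_mono) auto
        finally show ?thesis by simp
      qed
      ultimately show ?thesis using blockcase less_start[of i] 2 by simp
    next
      case 3
      have "t j = 1 / (1 + w j / sh i)"
        using 3 sh_pos[of i] quotient_scale[of "sh i" 0 "w j"] by (simp add: t_def zero_factor_def)
      moreover have "w j \<le> A * R * sh i"
        using order.trans[OF w_le_sh[of j] mult_left_mono[OF sh_block[OF 3(2,1)], of A]] A by simp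
      ultimately show ?thesis using blockcase less_start[of j] 3 by simp
    next
      case 4
      have ij: "i < j" using 4 start_le[of j] by simp
      have "t j = (1 - sh i / sh j) / (1 + sh i / w j)"
      proof -
        have "\<bar>poly (zero_factor i j) (sh i)\<bar> = w j * (1 - sh i / sh j)"
          using 4 sh_less[OF ij] sh_pos[of j] w_pos[of j] by (simp add: zero_factor_def field_simps)
        moreover have "sh i + w j = w j * (1 + sh i / w j)" using w_pos[of j] by (simp add: field_simps)
        ultimately show ?thesis using 4 w_pos[of j] by (simp add: t_def)
      qed
      moreover have "sh i / sh j \<le> 1 / Q" using sh_gap[OF 4(2)] sh_pos[of j] Q by (simp add: field_simps)
      moreover have "sh i / w j \<le> sh i / sh j" using sh_le_w[of j] sh_pos[of i] sh_pos[of j] by (intro divide_left_mono) auto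
      ultimately show ?thesis using wA' 4 sh_pos[of i] sh_pos[of j] w_pos[of j] by (simp only:) (intro gapcase, auto)
    qed
  qed
  have "own_const \<le> (\<Prod>j\<le>K. t j)"
    unfolding own_const_def
  proof (rule prod_ge_exp[where d = "\<lambda>j. (1 / \<rho>) ^ index_dist i j"])
    show "(\<Sum>j\<le>K. (1 / \<rho>) ^ index_dist i j) \<le> 2 / (1 - 1 / \<rho>)"
      using inv_rho by (intro sum_power_dist_le) auto
  qed (use low A R_ge_1 Q in auto)
  also have "(\<Prod>j\<le>K. t j) = (\<Prod>j\<le>K. if start i \<le> j \<and> j < i then sh i / (sh i - sh j) else 1) * \<bar>symbol i K (sh i)\<bar>"
    using dpos by (simp add: t_def prod.distrib symbol_def symbol_num_def poly_prod abs_prod prod_dividef abs_of_pos less_imp_le)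
  also have "(\<Prod>j\<le>K. if start i \<le> j \<and> j < i then sh i / (sh i - sh j) else 1) = (\<Prod>j\<in>{start i..i} - {i}. sh i / (sh i - sh j))"
    using i by (subst prod.inter_filter[symmetric]) (auto intro!: prod.cong)
  also have "\<dots> = \<bar>sh i ^ (i - start i) * newton_coeff lam (start i) i i\<bar>"
  proof -
    have "\<bar>\<Prod>k\<in>{start i..i} - {i}. lam k - lam i\<bar> = (\<Prod>k\<in>{start i..i} - {i}. sh i - sh k)"
      unfolding abs_prod using sh_less by (intro prod.cong refl) (auto simp: sh_def abs_if)
    moreover have "card ({start i..i} - {i}) = i - start i" using start_le[of i] by (simp add: card_Diff_singleton)
    ultimately show ?thesis using sh_pos[of i]
      by (simp add: newton_coeff_def prod_dividef abs_mult)
  qed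
  finally show ?thesis by (simp add: abs_mult)
qed

definition decay_const :: real where "decay_const = (2 * R / c0) ^ N"
definition decay_rate :: real where "decay_rate = c0 / (2 * R * A)"

lemma decay_const_pos: "decay_const > 0" and decay_rate_pos: "decay_rate > 0" and decay_rate_le: "decay_rate \<le> 1"
proof -
  have "c0 * 1 \<le> (2 * R) * A" using c0 c0_le_1 R_ge_1 A by (intro mult_mono) auto
  then show "decay_rate \<le> 1" using R_ge_1 A by (simp add: decay_rate_def divide_le_eq)
qed (use c0 R_ge_1 A in \<open>auto simp: decay_const_def decay_rate_def\<close>)

text \<open>The polynomial factor in the bound for divided differences is absorbed by half of the
exponential.\<close>

lemma newton_basis_le:
  assumes u: "u \<ge> 0"
  shows "\<bar>newton_basis k u\<bar> \<le> decay_const * exp (- (decay_rate * w k * u))"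
proof -
  define s n where "s = start k" and "n = k - start k"
  define y where "y = lam s * u"
  have y0: "y \<ge> 0" using u lam_gt_0[of s] by (simp add: y_def)
  have b: "0 \<le> newton_exp lam s k u" "newton_exp lam s k u \<le> u ^ n / fact n * exp (- lam s * u)"
    using newton_exp_bounds[OF lam_mono u, of s k] start_le[of k] by (auto simp: s_def n_def)
  have lams: "sh k \<le> R / c0 * lam s"
  proof -
    have "sh k \<le> R * sh s" using block_ratio[of k] by (simp add: sh_def s_def)
    also have "\<dots> \<le> R * w s" using sh_le_w R_ge_1 by (intro mult_left_mono) auto
    also have "\<dots> \<le> R * (lam s / c0)" using w_le_lam[of s] c0 R_ge_1 by (intro mult_left_mono) (auto simp: field_simps)
    finally show ?thesis by simp
  qed
  have one: "2 * R / c0 \<ge> 1" using R_ge_1 c0 c0_le_1 by (simp add: le_divide_eq)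
  have "\<bar>newton_basis k u\<bar> = sh k ^ n * newton_exp lam s k u"
    using b sh_pos[of k] by (simp add: newton_basis_def s_def n_def abs_mult)
  also have "\<dots> \<le> (R / c0 * lam s) ^ n * (u ^ n / fact n * exp (- lam s * u))"
    using lams b sh_pos[of k] R_ge_1 c0 lam_gt_0[of s] u by (intro mult_mono power_mono) auto
  also have "\<dots> = (2 * R / c0) ^ n * ((y / 2) ^ n / fact n) * exp (- y)"
    by (simp add: y_def power_mult_distrib power_divide)
  also have "\<dots> \<le> (2 * R / c0) ^ N * exp (y / 2) * exp (- y)"
  proof (intro mult_right_mono mult_mono power_increasing one)
    show "n \<le> N" using less_start[of k] by (simp add: n_def)
    have "(\<Sum>m\<in>{n}. (y / 2) ^ m /\<^sub>R fact m) \<le> exp (y / 2)"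
      unfolding exp_def using y0 by (intro sum_le_suminf summable_exp_generic) auto
    then show "(y / 2) ^ n / fact n \<le> exp (y / 2)" by (simp add: field_simps)
  qed (use one y0 in auto)
  also have "\<dots> = decay_const * exp (- (y / 2))"
    by (simp add: decay_const_def mult.assoc flip: exp_add)
  also have "\<dots> \<le> decay_const * exp (- (decay_rate * w k * u))"
  proof -
    have "w k \<le> A * (R / c0 * lam s)" using w_le_sh[of k] lams A
      by (meson mult_left_mono order.trans less_imp_le zero_less_one less_trans)
    then have "decay_rate * w k \<le> decay_rate * (A * (R / c0 * lam s))"
      using decay_rate_pos by (intro mult_left_mono) auto
    also have "\<dots> = lam s / 2" using A R_ge_1 c0 by (simp add: decay_rate_def)
    finally have "decay_rate * w k * u \<le> y / 2" using u mult_right_mono[of "decay_rate * w k" "lam s / 2" u] by (simp add: y_def)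
    then show ?thesis using decay_const_pos by simp
  qed
  finally show ?thesis .
qed

end

section \<open>A tail integral bounding the coefficients\<close>

lemma nn_integral_exp_halfline:
  fixes a :: real
  assumes a: "a > 0"
  shows "(\<integral>\<^sup>+u. ennreal (indicator {0..} u * exp (- (a * u))) \<partial>lborel) = ennreal (1 / a)"
proof -
  have "((\<lambda>u. exp (- a * u)) has_integral exp (- a * 0) / a) {0..}"
    using a by (rule has_integral_exp_minus_to_infinity)
  then have "((\<lambda>u. exp (- (a * u))) has_integral 1 / a) {0..}" by simp
  then show ?thesis
    using nn_integral_has_integral_lebesgue[of "{0..}" "\<lambda>u. exp (- (a * u))" "1 / a"] by simp
qed

lemma has_bochner_integral_exp_halfline:
  fixes a :: real
  assumes a: "a > 0"
  shows "has_bochner_integral lborel (\<lambda>u. indicator {0..} u * exp (- (a * u))) (1 / a)"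
  using a by (intro has_bochner_integral_nn_integral nn_integral_exp_halfline) auto

definition hardy_tail :: "(real \<Rightarrow> real) \<Rightarrow> real \<Rightarrow> ennreal" where
  "hardy_tail g x = (\<integral>\<^sup>+v. ennreal (indicator {x..} v * (g v / v)) \<partial>lborel)"

lemma hardy_tail_mono:
  assumes "y \<le> x" "0 < y" "\<And>v. g v \<ge> 0"
  shows "hardy_tail g x \<le> hardy_tail g y"
  unfolding hardy_tail_def using assms
  by (intro nn_integral_mono ennreal_leI) (auto simp: indicator_def intro!: divide_nonneg_nonneg)

text \<open>Averaging over translations by \<open>u0\<close> between \<open>1 / a\<close> and \<open>2 / a\<close> removes the mass of \<open>exp (- \<omega> * u)\<close>
near \<open>u = 0\<close>. Otherwise the functional attached to \<open>i\<close> would also see the function at scales much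
smaller than \<open>1 / w i\<close>.\<close>

definition avg_kernel :: "real \<Rightarrow> real \<Rightarrow> real \<Rightarrow> ennreal" where
  "avg_kernel a \<omega> v =
     (\<integral>\<^sup>+u0. ennreal (indicator {1 / a..2 / a} u0 * (indicator {u0..} v * exp (- (\<omega> * (v - u0))))) \<partial>lborel)"

lemma avg_kernel_eq:
  fixes g :: "real \<Rightarrow> real"
  assumes g[measurable]: "g \<in> borel_measurable borel" and g0: "\<And>v. g v \<ge> 0"
  shows "(\<integral>\<^sup>+u0. ennreal (indicator {1 / a..2 / a} u0) *
       (\<integral>\<^sup>+u. ennreal (indicator {0..} u * (exp (- (\<omega> * u)) * g (u + u0))) \<partial>lborel) \<partial>lborel)
     = (\<integral>\<^sup>+v. ennreal (g v) * avg_kernel a \<omega> v \<partial>lborel)"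
proof -
  define f where "f u0 v = ennreal (g v) *
      ennreal (indicator {1 / a..2 / a} u0 * (indicator {u0..} v * exp (- (\<omega> * (v - u0)))))" for u0 v :: real
  have [measurable]: "case_prod (\<lambda>v u0. f u0 v) \<in> borel_measurable (lborel \<Otimes>\<^sub>M lborel)"
  proof -
    have "(\<lambda>x. f (snd x) (fst x)) = (\<lambda>x. ennreal (g (fst x)) *
      ennreal (indicator {1 / a..2 / a} (snd x) * ((if snd x \<le> fst x then 1 else 0) * exp (- (\<omega> * (fst x - snd x))))))"
      by (auto simp: f_def indicator_def)
    then show ?thesis by (simp add: case_prod_beta')
  qed
  have "(\<integral>\<^sup>+u0. ennreal (indicator {1 / a..2 / a} u0) *
       (\<integral>\<^sup>+u. ennreal (indicator {0..} u * (exp (- (\<omega> * u)) * g (u + u0))) \<partial>lborel) \<partial>lborel)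
     = (\<integral>\<^sup>+u0. (\<integral>\<^sup>+v. f u0 v \<partial>lborel) \<partial>lborel)"
  proof (intro nn_integral_cong)
    fix u0 :: real
    have "(\<integral>\<^sup>+u. ennreal (indicator {0..} u * (exp (- (\<omega> * u)) * g (u + u0))) \<partial>lborel)
      = (\<integral>\<^sup>+v. ennreal (indicator {0..} (- u0 + 1 * v) * (exp (- (\<omega> * (- u0 + 1 * v))) * g (- u0 + 1 * v + u0))) \<partial>lborel)"
      by (subst nn_integral_real_affine[where c = 1 and t = "- u0"]) auto
    then have "ennreal (indicator {1 / a..2 / a} u0) *
       (\<integral>\<^sup>+u. ennreal (indicator {0..} u * (exp (- (\<omega> * u)) * g (u + u0))) \<partial>lborel)
      = (\<integral>\<^sup>+v. ennreal (indicator {1 / a..2 / a} u0) *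
          ennreal (indicator {0..} (- u0 + 1 * v) * (exp (- (\<omega> * (- u0 + 1 * v))) * g (- u0 + 1 * v + u0))) \<partial>lborel)"
      by (simp add: nn_integral_cmult)
    also have "\<dots> = (\<integral>\<^sup>+v. f u0 v \<partial>lborel)"
      using g0 by (intro nn_integral_cong) (auto simp: f_def indicator_def mult_ac simp flip: ennreal_mult)
    finally show "ennreal (indicator {1 / a..2 / a} u0) *
       (\<integral>\<^sup>+u. ennreal (indicator {0..} u * (exp (- (\<omega> * u)) * g (u + u0))) \<partial>lborel)
      = (\<integral>\<^sup>+v. f u0 v \<partial>lborel)" .
  qed
  also have "\<dots> = (\<integral>\<^sup>+v. (\<integral>\<^sup>+u0. f u0 v \<partial>lborel) \<partial>lborel)"
    by (rule lborel_pair.Fubini') measurable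
  also have "\<dots> = (\<integral>\<^sup>+v. ennreal (g v) * avg_kernel a \<omega> v \<partial>lborel)"
  proof (intro nn_integral_cong)
    fix v :: real
    have "(\<lambda>u0. ennreal (indicator {1 / a..2 / a} u0 * (indicator {u0..} v * exp (- (\<omega> * (v - u0))))))
       = (\<lambda>u0. ennreal (indicator {1 / a..2 / a} u0 * ((if u0 \<le> v then 1 else 0) * exp (- (\<omega> * (v - u0))))))"
      by (auto simp: indicator_def)
    then have "(\<lambda>u0. ennreal (indicator {1 / a..2 / a} u0 * (indicator {u0..} v * exp (- (\<omega> * (v - u0))))))
        \<in> borel_measurable lborel" by simp
    then show "(\<integral>\<^sup>+u0. f u0 v \<partial>lborel) = ennreal (g v) * avg_kernel a \<omega> v"
      unfolding f_def avg_kernel_def by (rule nn_integral_cmult)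
  qed
  finally show ?thesis .
qed

lemma avg_kernel_zero: "v < 1 / a \<Longrightarrow> avg_kernel a \<omega> v = 0"
  unfolding avg_kernel_def by (subst nn_integral_0_iff_AE) (auto simp: indicator_def intro!: AE_I2)

lemma avg_kernel_le_inverse:
  assumes "\<omega> > 0"
  shows "avg_kernel a \<omega> v \<le> ennreal (1 / \<omega>)"
proof -
  have "avg_kernel a \<omega> v \<le> (\<integral>\<^sup>+u0. ennreal (indicator {0..} (v - u0) * exp (- (\<omega> * (v - u0)))) \<partial>lborel)"
    unfolding avg_kernel_def by (intro nn_integral_mono ennreal_leI) (auto simp: indicator_def)
  also have "\<dots> = (\<integral>\<^sup>+u. ennreal (indicator {0..} u * exp (- (\<omega> * u))) \<partial>lborel)"
    by (subst (2) nn_integral_real_affine[where c = "-1" and t = v]) auto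
  finally show ?thesis using nn_integral_exp_halfline[OF assms] by simp
qed

lemma avg_kernel_le_exp:
  assumes "\<omega> > 0" "a > 0"
  shows "avg_kernel a \<omega> v \<le> ennreal (exp (- (\<omega> * (v - 2 / a))) / a)"
proof -
  have "avg_kernel a \<omega> v \<le> (\<integral>\<^sup>+u0. ennreal (exp (- (\<omega> * (v - 2 / a)))) * indicator {1 / a..2 / a} u0 \<partial>lborel)"
    unfolding avg_kernel_def using assms
    by (intro nn_integral_mono) (auto simp: indicator_def)
  also have "\<dots> = ennreal (exp (- (\<omega> * (v - 2 / a)))) * ennreal (2 / a - 1 / a)"
    using assms by (subst nn_integral_cmult_indicator) (auto simp: divide_right_mono)
  also have "\<dots> = ennreal (exp (- (\<omega> * (v - 2 / a))) / a)"
    using assms by (simp add: ennreal_mult'[symmetric] diff_divide_distrib[symmetric])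
  finally show ?thesis .
qed

context separated_exponents
begin

text \<open>The function \<open>f (exp (- u)) * exp (- shift * u)\<close>, where \<open>f\<close> has the coefficients \<open>b\<close> in
the basis of divided differences.\<close>

definition expand :: "(nat \<Rightarrow> complex) \<Rightarrow> nat \<Rightarrow> real \<Rightarrow> complex" where
  "expand b K u = (\<Sum>k\<le>K. b k * complex_of_real (exp (- (shift * u)) * newton_basis k u))"

definition basis_coeff :: "nat \<Rightarrow> nat \<Rightarrow> real" where
  "basis_coeff k j = sh k ^ (k - start k) * newton_coeff lam (start k) k j"

lemma newton_basis_shifted: "exp (- (shift * u)) * newton_basis k u = (\<Sum>j=start k..k. basis_coeff k j * exp (- (sh j * u)))"
proof -
  have "exp (- (shift * u)) * exp (- lam j * u) = exp (- (sh j * u))" for j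
    by (simp add: sh_def algebra_simps flip: exp_add)
  then show ?thesis
    unfolding newton_basis_def newton_exp_def basis_coeff_def sum_distrib_left
    by (intro sum.cong refl) (metis mult.assoc mult.left_commute)
qed

lemma newton_basis_measurable[measurable]: "newton_basis k \<in> borel_measurable borel"
  unfolding newton_basis_def newton_exp_def by measurable

lemma expand_measurable[measurable]: "expand b K \<in> borel_measurable borel"
  unfolding expand_def by measurable

definition moment :: "nat \<Rightarrow> real \<Rightarrow> nat \<Rightarrow> real" where
  "moment k u0 n = (\<Sum>j=start k..k. basis_coeff k j * (exp (- (sh j * u0)) * (1 / (w n + sh j))))"

lemma has_integral_moment:
  "has_bochner_integral lborel
     (\<lambda>u. indicator {0..} u * (exp (- (w n * u)) * (exp (- (shift * (u + u0))) * newton_basis k (u + u0)))) (moment k u0 n)"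
proof -
  have "has_bochner_integral lborel
     (\<lambda>u. \<Sum>j=start k..k. basis_coeff k j * (exp (- (sh j * u0)) * (indicator {0..} u * exp (- ((w n + sh j) * u)))))
     (moment k u0 n)"
    unfolding moment_def
    by (intro has_bochner_integral_sum has_bochner_integral_mult_right has_bochner_integral_exp_halfline
        add_pos_pos w_pos sh_pos)
  also have "(\<lambda>u. \<Sum>j=start k..k. basis_coeff k j * (exp (- (sh j * u0)) * (indicator {0..} u * exp (- ((w n + sh j) * u)))))
    = (\<lambda>u. indicator {0..} u * (exp (- (w n * u)) * (exp (- (shift * (u + u0))) * newton_basis k (u + u0))))"
  proof
    fix u
    have "exp (- (sh j * u0)) * exp (- ((w n + sh j) * u)) = exp (- (w n * u)) * exp (- (sh j * (u + u0)))" for j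
      by (simp add: algebra_simps flip: exp_add)
    then show "(\<Sum>j=start k..k. basis_coeff k j * (exp (- (sh j * u0)) * (indicator {0..} u * exp (- ((w n + sh j) * u)))))
      = indicator {0..} u * (exp (- (w n * u)) * (exp (- (shift * (u + u0))) * newton_basis k (u + u0)))"
      unfolding newton_basis_shifted sum_distrib_left
      by (intro sum.cong refl) (simp add: mult.left_commute)
  qed
  finally show ?thesis .
qed

lemma moment_le:
  assumes u0: "u0 \<ge> 0"
  shows "\<bar>moment k u0 n\<bar> \<le> decay_const / (w n + decay_rate * w k)"
proof -
  let ?f = "\<lambda>u. indicator {0..} u * (exp (- (w n * u)) * (exp (- (shift * (u + u0))) * newton_basis k (u + u0)))"
  let ?g = "\<lambda>u. decay_const * (indicator {0..} u * exp (- ((w n + decay_rate * w k) * u)))"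
  have g: "has_bochner_integral lborel ?g (decay_const * (1 / (w n + decay_rate * w k)))"
    using w_pos decay_rate_pos
    by (intro has_bochner_integral_mult_right has_bochner_integral_exp_halfline add_pos_pos mult_pos_pos)
  have le: "\<bar>?f u\<bar> \<le> ?g u" for u
  proof (cases "u \<ge> 0")
    case True
    have "\<bar>exp (- (shift * (u + u0))) * newton_basis k (u + u0)\<bar> \<le> 1 * (decay_const * exp (- (decay_rate * w k * (u + u0))))"
      unfolding abs_mult using newton_basis_le[of "u + u0" k] shift True u0 by (intro mult_mono) auto
    also have "\<dots> \<le> decay_const * exp (- (decay_rate * w k * u))"
      using decay_const_pos decay_rate_pos w_pos[of k] u0 by (simp add: distrib_left)
    finally have "exp (- (w n * u)) * \<bar>exp (- (shift * (u + u0))) * newton_basis k (u + u0)\<bar>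
        \<le> exp (- (w n * u)) * (decay_const * exp (- (decay_rate * w k * u)))"
      by (intro mult_left_mono) auto
    also have "\<dots> = decay_const * exp (- ((w n + decay_rate * w k) * u))"
      by (simp add: algebra_simps flip: exp_add)
    finally show ?thesis using True by (simp add: abs_mult)
  qed simp
  have "\<bar>integral\<^sup>L lborel ?f\<bar> \<le> integral\<^sup>L lborel ?g"
    using Bochner_Integration.integral_norm_bound_integral[of lborel ?f ?g]
      has_bochner_integral_integrable le g has_integral_moment[of n u0 k]
    by (simp add: has_bochner_integral_iff)
  then show ?thesis
    using has_bochner_integral_integral_eq[OF has_integral_moment[of n u0 k]] has_bochner_integral_integral_eq[OF g]
    by simp
qed

definition cross_const :: real where
  "cross_const = residue_const * decay_const / decay_rate * (2 / (1 - max (1 / \<rho>) (1 / A)))"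

lemma cross_const_pos: "cross_const > 0"
  using residue_const_pos decay_const_pos decay_rate_pos A \<rho> by (simp add: cross_const_def)

lemma symbol_moment:
  assumes i: "i \<le> K"
  shows "(\<Sum>n\<le>K. residue i K n * moment k u0 n) = (\<Sum>j=start k..k. basis_coeff k j * (exp (- (sh j * u0)) * symbol i K (sh j)))"
proof -
  have "(\<Sum>n\<le>K. residue i K n * moment k u0 n)
    = (\<Sum>n\<le>K. \<Sum>j=start k..k. basis_coeff k j * (exp (- (sh j * u0)) * (residue i K n / (sh j + w n))))"
    by (auto simp: moment_def sum_distrib_left mult_ac add.commute intro!: sum.cong)
  also have "\<dots> = (\<Sum>j=start k..k. basis_coeff k j * (exp (- (sh j * u0)) * (\<Sum>n\<le>K. residue i K n / (sh j + w n))))"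
    by (subst sum.swap) (simp add: sum_distrib_left)
  finally show ?thesis using symbol_partial_fractions[OF i] sh_pos by (simp add: less_imp_le)
qed

text \<open>Later functions of the group of \<open>i\<close> are not annihilated by the functional, but its values on them are
bounded. For \<open>n\<close> below \<open>i\<close> this uses the decay of the basis function on the scale \<open>1 / w k\<close>, for \<open>n\<close>
above \<open>i\<close> the decay of the residues.\<close>

lemma symbol_moment_le:
  assumes i: "i \<le> K" and k: "i \<le> k" and u0: "u0 \<ge> 0"
  shows "\<bar>\<Sum>n\<le>K. residue i K n * moment k u0 n\<bar> \<le> cross_const"
proof -
  define m where "m = max (1 / \<rho>) (1 / A)"
  have m: "0 < m" "m < 1" "1 / \<rho> \<le> m" "1 / A \<le> m" using \<rho> A by (auto simp: m_def less_max_iff_disj)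
  have "\<bar>\<Sum>n\<le>K. residue i K n * moment k u0 n\<bar> \<le> (\<Sum>n\<le>K. \<bar>residue i K n\<bar> * \<bar>moment k u0 n\<bar>)"
    by (simp add: sum_abs flip: abs_mult)
  also have "\<dots> \<le> (\<Sum>n\<le>K. residue_const * decay_const / decay_rate * m ^ index_dist i n)"
  proof (intro sum_mono)
    fix n assume n: "n \<in> {..K}"
    have pos: "w n + decay_rate * w k > 0" using w_pos decay_rate_pos by (simp add: add_pos_pos)
    have "\<bar>residue i K n\<bar> * \<bar>moment k u0 n\<bar>
       \<le> residue_const * w n * (1 / A) ^ (n - i) * (decay_const / (w n + decay_rate * w k))"
      using residue_le[OF i, of n] moment_le[OF u0] n residue_const_pos w_pos[of n] A by (intro mult_mono) auto
    also have "\<dots> = residue_const * decay_const * ((1 / A) ^ (n - i) * (w n / (w n + decay_rate * w k)))" by simp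
    also have "\<dots> \<le> residue_const * decay_const * (1 / decay_rate * m ^ index_dist i n)"
    proof (intro mult_left_mono)
      show "(1 / A) ^ (n - i) * (w n / (w n + decay_rate * w k)) \<le> 1 / decay_rate * m ^ index_dist i n"
      proof (cases "n \<le> i")
        case True
        have "w n / (w n + decay_rate * w k) \<le> w n / (decay_rate * w i)"
          using w_mono[OF k] w_pos decay_rate_pos pos by (intro divide_left_mono mult_pos_pos) (auto simp: less_imp_le add_increasing)
        also have "\<dots> = 1 / decay_rate * (w n / w i)" by simp
        also have "\<dots> \<le> 1 / decay_rate * (1 / \<rho>) ^ (i - n)"
          using ratio_le[OF True] decay_rate_pos by (intro mult_left_mono) auto
        also have "\<dots> \<le> 1 / decay_rate * m ^ (i - n)"
          using m \<rho> decay_rate_pos by (intro mult_left_mono power_mono) auto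
        finally show ?thesis using True by simp
      next
        case False
        have "w n / (w n + decay_rate * w k) \<le> 1" using w_pos decay_rate_pos pos by (simp add: less_imp_le)
        also have "1 \<le> 1 / decay_rate" using decay_rate_pos decay_rate_le by simp
        finally have "(1 / A) ^ (n - i) * (w n / (w n + decay_rate * w k)) \<le> m ^ (n - i) * (1 / decay_rate)"
          using m A w_pos[of n] pos by (intro mult_mono power_mono) auto
        then show ?thesis using False by (simp add: mult.commute)
      qed
    qed (use residue_const_pos decay_const_pos in auto)
    finally show "\<bar>residue i K n\<bar> * \<bar>moment k u0 n\<bar> \<le> residue_const * decay_const / decay_rate * m ^ index_dist i n" by simp
  qed
  also have "\<dots> = residue_const * decay_const / decay_rate * (\<Sum>n\<le>K. m ^ index_dist i n)" by (simp add: sum_distrib_left)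
  also have "\<dots> \<le> residue_const * decay_const / decay_rate * (2 / (1 - m))"
    using m residue_const_pos decay_const_pos decay_rate_pos by (intro mult_left_mono sum_power_dist_le) auto
  finally show ?thesis by (simp add: cross_const_def m_def)
qed

lemma symbol_moment_zero:
  assumes i: "i \<le> K" and k: "k \<le> K" "k < i \<or> i < start k"
  shows "(\<Sum>n\<le>K. residue i K n * moment k u0 n) = 0"
  unfolding symbol_moment[OF i]
proof (intro sum.neutral ballI)
  fix j assume j: "j \<in> {start k..k}"
  then have "j < i \<or> i < start j" using k start_eq[of k j] by auto
  then show "basis_coeff k j * (exp (- (sh j * u0)) * symbol i K (sh j)) = 0"
    using symbol_zero[of j K i] j k by simp
qed

lemma symbol_moment_own:
  assumes i: "i \<le> K"
  shows "\<bar>\<Sum>n\<le>K. residue i K n * moment i u0 n\<bar> \<ge> own_const * exp (- (sh i * u0))"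
proof -
  have "(\<Sum>j=start i..i. basis_coeff i j * (exp (- (sh j * u0)) * symbol i K (sh j)))
    = (\<Sum>j\<in>{i}. basis_coeff i j * (exp (- (sh j * u0)) * symbol i K (sh j)))"
    using i start_le[of i] by (intro sum.mono_neutral_right) (auto simp: symbol_zero)
  then have "\<bar>\<Sum>n\<le>K. residue i K n * moment i u0 n\<bar> = \<bar>basis_coeff i i * symbol i K (sh i)\<bar> * exp (- (sh i * u0))"
    unfolding symbol_moment[OF i] by (simp add: abs_mult)
  moreover have "\<bar>basis_coeff i i * symbol i K (sh i)\<bar> \<ge> own_const"
    using own_coeff_ge[OF i] by (simp add: basis_coeff_def)
  ultimately show ?thesis by (simp add: mult_right_mono)
qed

text \<open>Apply the functional to the translate of \<open>expand b K\<close> by \<open>u0\<close>. Only the coefficients of \<open>i\<close> and of the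
later members of its group survive.\<close>

lemma functional_le:
  assumes i: "i \<le> K" and u0: "u0 \<ge> 0"
  shows "ennreal (cmod (b i) * (own_const * exp (- (sh i * u0))))
    \<le> (\<Sum>n\<le>K. ennreal \<bar>residue i K n\<bar> *
          (\<integral>\<^sup>+u. ennreal (indicator {0..} u * (exp (- (w n * u)) * cmod (expand b K (u + u0)))) \<partial>lborel))
      + ennreal (cross_const * (\<Sum>k | i < k \<and> k \<le> K \<and> start k \<le> i. cmod (b k)))"
proof -
  define F where "F n u = complex_of_real (indicator {0..} u * exp (- (w n * u))) * expand b K (u + u0)" for n u
  define J where "J = {k. i < k \<and> k \<le> K \<and> start k \<le> i}"
  define \<Phi> where "\<Phi> k = (\<Sum>n\<le>K. residue i K n * moment k u0 n)" for k
  have F: "has_bochner_integral lborel (F n) (\<Sum>k\<le>K. b k * complex_of_real (moment k u0 n))" for n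
  proof -
    have "has_bochner_integral lborel (\<lambda>u. \<Sum>k\<le>K. b k * complex_of_real (indicator {0..} u *
        (exp (- (w n * u)) * (exp (- (shift * (u + u0))) * newton_basis k (u + u0)))))
        (\<Sum>k\<le>K. b k * complex_of_real (moment k u0 n))"
      by (intro has_bochner_integral_sum has_bochner_integral_mult_right
          has_bochner_integral_bounded_linear[OF bounded_linear_of_real] has_integral_moment)
    also have "(\<lambda>u. \<Sum>k\<le>K. b k * complex_of_real (indicator {0..} u *
        (exp (- (w n * u)) * (exp (- (shift * (u + u0))) * newton_basis k (u + u0))))) = F n"
      by (auto simp: F_def expand_def sum_distrib_left intro!: ext sum.cong)
    finally show ?thesis .
  qed
  have normF: "cmod (integral\<^sup>L lborel (F n))
      \<le> (\<integral>\<^sup>+u. ennreal (indicator {0..} u * (exp (- (w n * u)) * cmod (expand b K (u + u0)))) \<partial>lborel)" for n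
  proof -
    have "ennreal (cmod (integral\<^sup>L lborel (F n))) \<le> (\<integral>\<^sup>+u. ennreal (cmod (F n u)) \<partial>lborel)"
      by (intro integral_norm_bound_ennreal integrable.intros[OF F])
    also have "(\<lambda>u. cmod (F n u)) = (\<lambda>u. indicator {0..} u * (exp (- (w n * u)) * cmod (expand b K (u + u0))))"
      by (auto simp: F_def norm_mult indicator_def)
    finally show ?thesis .
  qed
  have "(\<Sum>n\<le>K. complex_of_real (residue i K n) * integral\<^sup>L lborel (F n))
     = (\<Sum>n\<le>K. \<Sum>k\<le>K. b k * complex_of_real (residue i K n * moment k u0 n))"
    by (auto simp: has_bochner_integral_integral_eq[OF F] sum_distrib_left mult_ac intro!: sum.cong)
  also have "\<dots> = (\<Sum>k\<le>K. b k * complex_of_real (\<Phi> k))"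
    by (subst sum.swap) (simp add: \<Phi>_def sum_distrib_left)
  also have "\<dots> = (\<Sum>k\<in>insert i J. b k * complex_of_real (\<Phi> k))"
  proof (intro sum.mono_neutral_right ballI)
    fix k assume k: "k \<in> {..K} - insert i J"
    then have "k < i \<or> i < start k" by (auto simp: J_def)
    then show "b k * complex_of_real (\<Phi> k) = 0" using symbol_moment_zero[OF i, of k] k by (simp add: \<Phi>_def)
  qed (use i in \<open>auto simp: J_def\<close>)
  also have "\<dots> = b i * complex_of_real (\<Phi> i) + (\<Sum>k\<in>J. b k * complex_of_real (\<Phi> k))"
    by (rule sum.insert) (auto simp: J_def)
  finally have eq: "b i * complex_of_real (\<Phi> i) = (\<Sum>n\<le>K. complex_of_real (residue i K n) * integral\<^sup>L lborel (F n))
      - (\<Sum>k\<in>J. b k * complex_of_real (\<Phi> k))" by simp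
  have "cmod (b i) * (own_const * exp (- (sh i * u0))) \<le> cmod (b i) * \<bar>\<Phi> i\<bar>"
    using symbol_moment_own[OF i] by (intro mult_left_mono) (auto simp: \<Phi>_def)
  also have "\<dots> = cmod (b i * complex_of_real (\<Phi> i))" by (simp add: norm_mult)
  also have "\<dots> \<le> cmod (\<Sum>n\<le>K. complex_of_real (residue i K n) * integral\<^sup>L lborel (F n))
      + cmod (\<Sum>k\<in>J. b k * complex_of_real (\<Phi> k))" unfolding eq by (rule norm_triangle_ineq4)
  also have "\<dots> \<le> (\<Sum>n\<le>K. \<bar>residue i K n\<bar> * cmod (integral\<^sup>L lborel (F n))) + cross_const * (\<Sum>k\<in>J. cmod (b k))"
  proof (intro add_mono order.trans[OF norm_sum])
    show "(\<Sum>k\<in>J. cmod (b k * complex_of_real (\<Phi> k))) \<le> cross_const * (\<Sum>k\<in>J. cmod (b k))"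
      unfolding sum_distrib_left
    proof (intro sum_mono)
      fix k assume "k \<in> J"
      then have "\<bar>\<Phi> k\<bar> \<le> cross_const" unfolding \<Phi>_def using i u0 by (intro symbol_moment_le) (auto simp: J_def)
      then show "cmod (b k * complex_of_real (\<Phi> k)) \<le> cross_const * cmod (b k)"
        by (simp add: norm_mult mult.commute[of cross_const] mult_left_mono)
    qed
  qed (simp add: norm_mult)
  finally have "ennreal (cmod (b i) * (own_const * exp (- (sh i * u0))))
     \<le> (\<Sum>n\<le>K. ennreal \<bar>residue i K n\<bar> * ennreal (cmod (integral\<^sup>L lborel (F n))))
       + ennreal (cross_const * (\<Sum>k\<in>J. cmod (b k)))"
    using cross_const_pos
    by (simp add: ennreal_leI sum_nonneg flip: ennreal_mult ennreal_plus)
  also have "\<dots> \<le> (\<Sum>n\<le>K. ennreal \<bar>residue i K n\<bar> *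
          (\<integral>\<^sup>+u. ennreal (indicator {0..} u * (exp (- (w n * u)) * cmod (expand b K (u + u0)))) \<partial>lborel))
      + ennreal (cross_const * (\<Sum>k\<in>J. cmod (b k)))"
    by (intro add_mono sum_mono mult_left_mono normF) auto
  finally show ?thesis by (simp add: J_def)
qed

definition kernel_const :: real where
  "kernel_const = residue_const * exp 2 * (3 / (1 - 1 / \<rho>)) + residue_const * 4 * (1 / (1 - 1 / A))"

lemma kernel_const_pos: "kernel_const > 0"
  using residue_const_pos A \<rho> by (auto simp: kernel_const_def intro!: add_pos_pos mult_pos_pos divide_pos_pos)

text \<open>As \<open>w n \<le> w i\<close>, translation by at most \<open>2 / w i\<close> changes the exponential by a bounded factor.\<close>

lemma avg_kernel_low:
  assumes i: "i \<le> K" and n: "n \<le> i" and v: "1 / w i \<le> v"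
  shows "ennreal (w i * \<bar>residue i K n\<bar>) * avg_kernel (w i) (w n) v \<le> ennreal (residue_const * exp 2 * (w n * exp (- w n * v)))"
proof -
  have "ennreal (w i * \<bar>residue i K n\<bar>) * avg_kernel (w i) (w n) v
    \<le> ennreal (w i * (residue_const * w n)) * ennreal (exp (- (w n * (v - 2 / w i))) / w i)"
    using residue_le[OF i, of n] n i w_pos
    by (intro mult_mono avg_kernel_le_exp ennreal_leI mult_left_mono) (auto simp: less_imp_le)
  also have "\<dots> = ennreal (residue_const * (w n * exp (- (w n * (v - 2 / w i)))))"
    using w_pos[of i] w_pos[of n] residue_const_pos by (simp flip: ennreal_mult)
  also have "\<dots> \<le> ennreal (residue_const * (w n * (exp 2 * exp (- w n * v))))"
  proof (intro ennreal_leI mult_left_mono)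
    have "w n * (2 / w i) \<le> 2" using w_mono[OF n] w_pos[of i] by (simp add: divide_le_eq)
    then have "- (w n * (v - 2 / w i)) \<le> 2 + - w n * v" by (simp add: right_diff_distrib)
    then show "exp (- (w n * (v - 2 / w i))) \<le> exp 2 * exp (- w n * v)"
      unfolding exp_add[symmetric] by simp
  qed (use w_pos[of n] residue_const_pos in auto)
  finally show ?thesis by (simp add: mult_ac)
qed

lemma avg_kernel_high:
  assumes i: "i \<le> K" and n: "i < n" "n \<le> K" and v: "1 / w i \<le> v"
  shows "ennreal (w i * \<bar>residue i K n\<bar>) * avg_kernel (w i) (w n) v \<le> ennreal (residue_const * 4 * (1 / A) ^ (n - i) / v)"
proof -
  have v0: "v > 0" using v w_pos[of i] by (smt (verit) divide_pos_pos)
  have r: "w i * \<bar>residue i K n\<bar> \<le> w i * (residue_const * w n * (1 / A) ^ (n - i))"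
    using residue_le[OF i, of n] n w_pos[of i] by (intro mult_left_mono) auto
  have c0: "residue_const * (1 / A) ^ (n - i) \<ge> 0" using residue_const_pos A by simp
  \<comment> \<open>For small \<open>v\<close> the total mass of the exponential suffices; for large \<open>v\<close> the averaging interval is at distance at least \<open>v / 2\<close>.\<close>
  have "\<exists>t\<ge>0. avg_kernel (w i) (w n) v \<le> ennreal t \<and> w i * w n * t \<le> 4 / v"
  proof (cases "v \<le> 4 / w i")
    case True
    have "w i * w n * (1 / w n) \<le> 4 / v" using True v0 w_pos[of i] w_pos[of n] by (simp add: field_simps)
    then show ?thesis using avg_kernel_le_inverse[OF w_pos, of "w i" n v] w_pos[of n]
      by (intro exI[of _ "1 / w n"]) auto
  next
    case False
    let ?t = "exp (- (w n * (v - 2 / w i))) / w i"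
    have "w i * w n * ?t = w n * exp (- (w n * (v - 2 / w i)))" using w_pos[of i] by simp
    also have "\<dots> \<le> w n * exp (- (w n * v / 2))"
    proof (intro mult_left_mono)
      have "v / 2 \<le> v - 2 / w i" using False by (simp add: not_le)
      then have "w n * (v / 2) \<le> w n * (v - 2 / w i)" using w_pos[of n] by (intro mult_left_mono) auto
      then show "exp (- (w n * (v - 2 / w i))) \<le> exp (- (w n * v / 2))" by simp
    qed (use w_pos[of n] in auto)
    also have "\<dots> \<le> 4 / v"
    proof -
      have "w n * v / 2 \<le> exp (w n * v / 2)" using exp_ge_add_one_self[of "w n * v / 2"] by linarith
      then have "w n * v \<le> 4 * exp (w n * v / 2)" using exp_gt_zero[of "w n * v / 2"] by linarith
      then show ?thesis using v0 by (simp add: exp_minus field_simps)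
    qed
    finally show ?thesis using avg_kernel_le_exp[OF w_pos w_pos, of i n v] w_pos[of i]
      by (intro exI[of _ ?t]) auto
  qed
  then obtain t where t: "t \<ge> 0" "avg_kernel (w i) (w n) v \<le> ennreal t" "w i * w n * t \<le> 4 / v" by blast
  have "ennreal (w i * \<bar>residue i K n\<bar>) * avg_kernel (w i) (w n) v
     \<le> ennreal (w i * (residue_const * w n * (1 / A) ^ (n - i))) * ennreal t"
    by (rule mult_mono[OF ennreal_leI[OF r] t(2)]) auto
  also have "\<dots> = ennreal (residue_const * (1 / A) ^ (n - i) * (w i * w n * t))"
    unfolding ennreal_mult''[OF t(1), symmetric] by (simp add: mult_ac)
  also have "\<dots> \<le> ennreal (residue_const * (1 / A) ^ (n - i) * (4 / v))"
    using t c0 by (intro ennreal_leI mult_left_mono)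
  finally show ?thesis by (simp add: mult_ac)
qed

text \<open>Summed over all poles, the averaged functional has the scale-invariant majorant \<open>1 / v\<close> on
\<open>v \<ge> 1 / w i\<close>, to which Hardy's inequality applies.\<close>

lemma avg_kernel_sum_le:
  assumes i: "i \<le> K"
  shows "(\<Sum>n\<le>K. ennreal (w i * \<bar>residue i K n\<bar>) * avg_kernel (w i) (w n) v)
     \<le> ennreal (kernel_const * (indicator {1 / w i..} v / v))"
proof (cases "1 / w i \<le> v")
  case False
  then show ?thesis by (simp add: avg_kernel_zero)
next
  case True
  have v0: "v > 0" using True w_pos[of i] by (smt (verit) divide_pos_pos)
  have "(\<Sum>n\<le>K. ennreal (w i * \<bar>residue i K n\<bar>) * avg_kernel (w i) (w n) v)
    = (\<Sum>n\<in>{n\<in>{..K}. n \<le> i}. ennreal (w i * \<bar>residue i K n\<bar>) * avg_kernel (w i) (w n) v)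
     + (\<Sum>n\<in>{n\<in>{..K}. \<not> n \<le> i}. ennreal (w i * \<bar>residue i K n\<bar>) * avg_kernel (w i) (w n) v)"
    by (subst sum.union_disjoint[symmetric]) (auto intro!: sum.cong)
  also have "\<dots> \<le> (\<Sum>n\<in>{n\<in>{..K}. n \<le> i}. ennreal (residue_const * exp 2 * (w n * exp (- w n * v))))
     + (\<Sum>n\<in>{n\<in>{..K}. \<not> n \<le> i}. ennreal (residue_const * 4 * (1 / A) ^ (n - i) / v))"
    using i True by (intro add_mono sum_mono avg_kernel_low avg_kernel_high) auto
  also have "\<dots> = ennreal ((\<Sum>n\<in>{n\<in>{..K}. n \<le> i}. residue_const * exp 2 * (w n * exp (- w n * v)))
     + (\<Sum>n\<in>{n\<in>{..K}. \<not> n \<le> i}. residue_const * 4 * (1 / A) ^ (n - i) / v))"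
    using residue_const_pos w_pos A v0
    by (subst (1 2) sum_ennreal) (auto simp: less_imp_le sum_nonneg simp flip: ennreal_plus)
  also have "\<dots> \<le> ennreal (residue_const * exp 2 * (3 / (1 - 1 / \<rho>) / v) + residue_const * 4 / v * (1 / (1 - 1 / A)))"
  proof (intro ennreal_leI add_mono)
    show "(\<Sum>n\<in>{n\<in>{..K}. n \<le> i}. residue_const * exp 2 * (w n * exp (- w n * v))) \<le> residue_const * exp 2 * (3 / (1 - 1 / \<rho>) / v)"
      unfolding sum_distrib_left[symmetric] using residue_const_pos v0
      by (intro mult_left_mono sum_times_exp_le) auto
    have "(\<Sum>n\<in>{n\<in>{..K}. \<not> n \<le> i}. residue_const * 4 * (1 / A) ^ (n - i) / v)
       = residue_const * 4 / v * (\<Sum>n\<in>{n\<in>{..K}. \<not> n \<le> i}. (1 / A) ^ (n - i))"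
      by (simp add: sum_distrib_left)
    also have "\<dots> \<le> residue_const * 4 / v * (1 / (1 - 1 / A))"
      using residue_const_pos v0 A by (intro mult_left_mono sum_power_inj_le) (auto intro!: inj_onI)
    finally show "(\<Sum>n\<in>{n\<in>{..K}. \<not> n \<le> i}. residue_const * 4 * (1 / A) ^ (n - i) / v) \<le> residue_const * 4 / v * (1 / (1 - 1 / A))" .
  qed
  also have "residue_const * exp 2 * (3 / (1 - 1 / \<rho>) / v) + residue_const * 4 / v * (1 / (1 - 1 / A))
     = kernel_const * (indicator {1 / w i..} v / v)"
    using True by (simp add: kernel_const_def add_divide_distrib)
  finally show ?thesis .
qed

lemma coeff_le_tail_plus_block:
  assumes i: "i \<le> K"
  shows "ennreal (cmod (b i) * (own_const * exp (-2)))
    \<le> ennreal kernel_const * hardy_tail (\<lambda>v. cmod (expand b K v)) (1 / w i)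
      + ennreal (cross_const * (\<Sum>k | i < k \<and> k \<le> K \<and> start k \<le> i. cmod (b k)))"
proof -
  let ?B = "cross_const * (\<Sum>k | i < k \<and> k \<le> K \<and> start k \<le> i. cmod (b k))"
  let ?I = "{1 / w i..2 / w i}"
  have B0: "?B \<ge> 0" using cross_const_pos by (auto intro!: mult_nonneg_nonneg sum_nonneg)
  have low0: "own_const > 0" by (simp add: own_const_def)
  have len: "(\<integral>\<^sup>+u0. ennreal c * ennreal (indicator ?I u0) \<partial>lborel) = ennreal c * ennreal (1 / w i)" for c
  proof -
    have "(\<integral>\<^sup>+u0. ennreal c * ennreal (indicator ?I u0) \<partial>lborel) = ennreal c * emeasure lborel ?I"
      by (simp add: ennreal_indicator nn_integral_cmult_indicator)
    also have "emeasure lborel ?I = ennreal (1 / w i)"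
      using w_pos[of i] by (simp add: divide_right_mono flip: diff_divide_distrib)
    finally show ?thesis .
  qed
  have cancel: "ennreal (w i) * (X * ennreal (1 / w i)) = X" for X
  proof -
    have "ennreal (w i) * ennreal (1 / w i) = 1"
      using w_pos[of i] by (simp add: less_imp_le flip: ennreal_mult)
    then show ?thesis by (metis mult.left_commute mult.right_neutral)
  qed
  have meas[measurable]: "(\<lambda>u0. \<integral>\<^sup>+u. ennreal (indicator {0..} u * (exp (- (w n * u)) * cmod (expand b K (u + u0)))) \<partial>lborel)
      \<in> borel_measurable borel" for n
  proof -
    have "case_prod (\<lambda>u0 u. ennreal (indicator {0..} u * (exp (- (w n * u)) * cmod (expand b K (u + u0)))))
        \<in> borel_measurable (borel \<Otimes>\<^sub>M lborel)" by measurable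
    then show ?thesis by measurable
  qed
  have "ennreal (cmod (b i) * (own_const * exp (-2))) * ennreal (1 / w i)
     = (\<integral>\<^sup>+u0. ennreal (cmod (b i) * (own_const * exp (-2))) * ennreal (indicator ?I u0) \<partial>lborel)"
    by (rule len[symmetric])
  also have "\<dots> \<le> (\<integral>\<^sup>+u0. (\<Sum>n\<le>K. ennreal \<bar>residue i K n\<bar> * (ennreal (indicator ?I u0) *
          (\<integral>\<^sup>+u. ennreal (indicator {0..} u * (exp (- (w n * u)) * cmod (expand b K (u + u0)))) \<partial>lborel)))
      + ennreal ?B * ennreal (indicator ?I u0) \<partial>lborel)"
  proof (intro nn_integral_mono)
    fix u0 :: real
    show "ennreal (cmod (b i) * (own_const * exp (-2))) * ennreal (indicator ?I u0) \<le>
       (\<Sum>n\<le>K. ennreal \<bar>residue i K n\<bar> * (ennreal (indicator ?I u0) *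
          (\<integral>\<^sup>+u. ennreal (indicator {0..} u * (exp (- (w n * u)) * cmod (expand b K (u + u0)))) \<partial>lborel)))
      + ennreal ?B * ennreal (indicator ?I u0)"
    proof (cases "u0 \<in> ?I")
      case True
      then have u0: "u0 \<ge> 0" using w_pos[of i] by (auto intro: order.trans[rotated])
      have "sh i * u0 \<le> w i * (2 / w i)" using True sh_le_w[of i] sh_pos[of i] w_pos[of i] u0 by (intro mult_mono) auto
      then have "sh i * u0 \<le> 2" using w_pos[of i] by simp
      then have "ennreal (cmod (b i) * (own_const * exp (-2))) \<le> ennreal (cmod (b i) * (own_const * exp (- (sh i * u0))))"
        using low0 by (intro ennreal_leI mult_left_mono) auto
      also note functional_le[OF i u0, of b]
      finally show ?thesis using True by simp
    qed simp
  qed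
  also have "\<dots> = (\<Sum>n\<le>K. ennreal \<bar>residue i K n\<bar> * (\<integral>\<^sup>+v. ennreal (cmod (expand b K v)) * avg_kernel (w i) (w n) v \<partial>lborel))
      + ennreal ?B * ennreal (1 / w i)"
    by (subst nn_integral_add) (simp_all add: nn_integral_sum nn_integral_cmult len
        avg_kernel_eq[where g = "\<lambda>v. cmod (expand b K v)"])
  finally have "ennreal (w i) * (ennreal (cmod (b i) * (own_const * exp (-2))) * ennreal (1 / w i))
     \<le> ennreal (w i) * ((\<Sum>n\<le>K. ennreal \<bar>residue i K n\<bar> *
        (\<integral>\<^sup>+v. ennreal (cmod (expand b K v)) * avg_kernel (w i) (w n) v \<partial>lborel)) + ennreal ?B * ennreal (1 / w i))"
    by (intro mult_left_mono) auto
  also have "ennreal (w i) * (ennreal (cmod (b i) * (own_const * exp (-2))) * ennreal (1 / w i))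
      = ennreal (cmod (b i) * (own_const * exp (-2)))"
    by (rule cancel)
  also have "ennreal (w i) * ((\<Sum>n\<le>K. ennreal \<bar>residue i K n\<bar> *
        (\<integral>\<^sup>+v. ennreal (cmod (expand b K v)) * avg_kernel (w i) (w n) v \<partial>lborel)) + ennreal ?B * ennreal (1 / w i))
     = (\<Sum>n\<le>K. ennreal (w i * \<bar>residue i K n\<bar>) *
        (\<integral>\<^sup>+v. ennreal (cmod (expand b K v)) * avg_kernel (w i) (w n) v \<partial>lborel)) + ennreal ?B"
    using w_pos[of i] by (simp add: distrib_left sum_distrib_left cancel ennreal_mult mult.assoc)
  also have "(\<Sum>n\<le>K. ennreal (w i * \<bar>residue i K n\<bar>) * (\<integral>\<^sup>+v. ennreal (cmod (expand b K v)) * avg_kernel (w i) (w n) v \<partial>lborel))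
     = (\<integral>\<^sup>+v. ennreal (cmod (expand b K v)) * (\<Sum>n\<le>K. ennreal (w i * \<bar>residue i K n\<bar>) * avg_kernel (w i) (w n) v) \<partial>lborel)"
  proof -
    have [measurable]: "avg_kernel (w i) (w n) \<in> borel_measurable borel" for n
    proof -
      have "case_prod (\<lambda>v u0. ennreal (indicator ?I u0 * (indicator {u0..} v * exp (- (w n * (v - u0))))))
         = (\<lambda>x. ennreal (indicator ?I (snd x) * ((if snd x \<le> fst x then 1 else 0) * exp (- (w n * (fst x - snd x))))))"
        by (auto simp: indicator_def)
      then have "case_prod (\<lambda>v u0. ennreal (indicator ?I u0 * (indicator {u0..} v * exp (- (w n * (v - u0))))))
         \<in> borel_measurable (borel \<Otimes>\<^sub>M lborel)" by simp
      then show ?thesis unfolding avg_kernel_def[abs_def] by measurable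
    qed
    show ?thesis
      by (simp add: sum_distrib_left nn_integral_sum mult.left_commute[of "ennreal (cmod _)"] flip: nn_integral_cmult)
  qed
  also have "\<dots> \<le> (\<integral>\<^sup>+v. ennreal (cmod (expand b K v)) * ennreal (kernel_const * (indicator {1 / w i..} v / v)) \<partial>lborel)"
    by (intro nn_integral_mono mult_left_mono avg_kernel_sum_le i) auto
  also have "\<dots> = ennreal kernel_const * hardy_tail (\<lambda>v. cmod (expand b K v)) (1 / w i)"
    unfolding hardy_tail_def using kernel_const_pos
    by (subst nn_integral_cmult[symmetric]) (auto simp: mult_ac simp flip: ennreal_mult' intro!: nn_integral_cong)
  finally show ?thesis by (simp add: add_right_mono)
qed

end

section \<open>Hardy inequality for the coefficients\<close>

text \<open>Holder's inequality with respect to \<open>v powr (- 1 - \<epsilon>)\<close> on \<open>{x..}\<close>. It is stated for a number \<open>y\<close> below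
the integral, which may be infinite.\<close>

lemma powr_le_hardy_tail:
  fixes g :: "real \<Rightarrow> real"
  assumes gm[measurable]: "g \<in> borel_measurable borel" and g0: "\<And>v. g v \<ge> 0"
    and x: "x > 0" and \<epsilon>: "\<epsilon> > 0" and s: "s \<ge> 1" and y: "y \<ge> 0"
    and le: "ennreal y \<le> hardy_tail g x"
  shows "ennreal (y powr s) \<le> ennreal ((x powr (- \<epsilon>) / \<epsilon>) powr (s - 1)) *
    (\<integral>\<^sup>+v. ennreal (indicator {x..} v * (g v powr s * v powr (\<epsilon> * (s - 1) - 1))) \<partial>lborel)"
    (is "_ \<le> _ * ?I")
proof (cases "y = 0")
  case True
  then show ?thesis by simp
next
  case False
  with y have y0: "y > 0" by simp
  define m where "m = x powr (- \<epsilon>) / \<epsilon>"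
  have m0: "m > 0" using x \<epsilon> by (simp add: m_def)
  \<comment> \<open>The mean value of \<open>g v * v powr \<epsilon>\<close> if \<open>y\<close> were the whole integral.\<close>
  define a where "a = y / m"
  have a0: "a > 0" using y0 m0 by (simp add: a_def)
  have mass: "(\<integral>\<^sup>+v. ennreal (indicator {x..} v * v powr (- 1 - \<epsilon>)) \<partial>lborel) = ennreal m"
  proof -
    have "((\<lambda>v. v powr (- 1 - \<epsilon>)) has_integral - (x powr (- 1 - \<epsilon> + 1)) / (- 1 - \<epsilon> + 1)) {x..}"
      using x \<epsilon> by (intro has_integral_powr_to_inf) auto
    then have "((\<lambda>v. v powr (- 1 - \<epsilon>)) has_integral m) {x..}" by (simp add: m_def)
    then show ?thesis
      using nn_integral_has_integral_lebesgue[of "{x..}" "\<lambda>v. v powr (- 1 - \<epsilon>)" m] by simp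
  qed
  have pt: "ennreal (s * a powr (s - 1)) * ennreal (indicator {x..} v * (g v / v))
    \<le> ennreal (indicator {x..} v * (g v powr s * v powr (\<epsilon> * (s - 1) - 1)))
      + ennreal ((s - 1) * a powr s) * ennreal (indicator {x..} v * v powr (- 1 - \<epsilon>))" for v
  proof (cases "x \<le> v")
    case True
    with x have v: "v > 0" by simp
    have "s * a powr (s - 1) * (g v * v powr \<epsilon>) \<le> (g v * v powr \<epsilon>) powr s + (s - 1) * a powr s"
      using a0 s g0 by (intro powr_tangent_le) auto
    then have "s * a powr (s - 1) * (g v * v powr \<epsilon>) * v powr (- 1 - \<epsilon>)
      \<le> ((g v * v powr \<epsilon>) powr s + (s - 1) * a powr s) * v powr (- 1 - \<epsilon>)"
      by (intro mult_right_mono) auto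
    moreover have "v powr \<epsilon> * v powr (- 1 - \<epsilon>) = 1 / v"
      using v by (simp flip: powr_add add: powr_minus_divide)
    moreover have "(g v * v powr \<epsilon>) powr s * v powr (- 1 - \<epsilon>) = g v powr s * v powr (\<epsilon> * (s - 1) - 1)"
    proof -
      have "\<epsilon> * s + (- 1 - \<epsilon>) = \<epsilon> * (s - 1) - 1" by (simp add: algebra_simps)
      then have "v powr (\<epsilon> * s) * v powr (- 1 - \<epsilon>) = v powr (\<epsilon> * (s - 1) - 1)"
        by (simp only: powr_add[symmetric])
      then show ?thesis using g0[of v] by (simp add: powr_mult powr_powr)
    qed
    ultimately have "s * a powr (s - 1) * (g v / v) \<le> g v powr s * v powr (\<epsilon> * (s - 1) - 1)
        + (s - 1) * a powr s * v powr (- 1 - \<epsilon>)"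
      by (simp add: distrib_right mult.assoc)
    then show ?thesis using True s g0[of v] v
      by (simp add: ennreal_leI flip: ennreal_mult ennreal_plus)
  qed simp
  have "ennreal (s * a powr (s - 1)) * ennreal y \<le> ennreal (s * a powr (s - 1)) * hardy_tail g x"
    by (intro mult_left_mono le) auto
  also have "\<dots> = (\<integral>\<^sup>+v. ennreal (s * a powr (s - 1)) * ennreal (indicator {x..} v * (g v / v)) \<partial>lborel)"
    unfolding hardy_tail_def by (rule nn_integral_cmult[symmetric]) measurable
  also have "\<dots> \<le> (\<integral>\<^sup>+v. ennreal (indicator {x..} v * (g v powr s * v powr (\<epsilon> * (s - 1) - 1)))
      + ennreal ((s - 1) * a powr s) * ennreal (indicator {x..} v * v powr (- 1 - \<epsilon>)) \<partial>lborel)"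
    by (intro nn_integral_mono pt)
  also have "\<dots> = ?I + ennreal ((s - 1) * a powr s) * ennreal m"
    by (subst nn_integral_add) (simp_all add: nn_integral_cmult mass)
  finally have main: "ennreal (s * a powr (s - 1)) * ennreal y \<le> ?I + ennreal ((s - 1) * a powr s) * ennreal m" .
  show ?thesis
  proof (cases "?I = \<infinity>")
    case True
    then show ?thesis using x \<epsilon> by (simp add: ennreal_mult_top)
  next
    case False
    then obtain \<iota> where \<iota>: "\<iota> \<ge> 0" "?I = ennreal \<iota>" by (cases ?I rule: ennreal_cases) auto
    have am: "a powr s * m = a powr (s - 1) * y"
    proof -
      have "a powr s = a powr (s - 1) * a" using a0 by (simp add: powr_diff)
      moreover have "a * m = y" using m0 by (simp add: a_def)
      ultimately show ?thesis by (simp only: mult.assoc)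
    qed
    have "s * a powr (s - 1) * y \<le> \<iota> + (s - 1) * a powr s * m"
      using main \<iota> s y0 m0 by (simp flip: ennreal_mult' ennreal_plus)
    then have "a powr (s - 1) * y \<le> \<iota>" using am by (simp add: mult.assoc left_diff_distrib)
    moreover have "y powr s = m powr (s - 1) * (a powr (s - 1) * y)"
    proof -
      have "y powr s = y powr (s - 1) * y" using y0 by (simp add: powr_diff)
      moreover have "y powr (s - 1) = m powr (s - 1) * a powr (s - 1)"
        using m0 y0 by (simp add: a_def powr_divide)
      ultimately show ?thesis by (simp only: mult.assoc)
    qed
    ultimately have "y powr s \<le> m powr (s - 1) * \<iota>" by (simp add: mult_left_mono)
    then show ?thesis unfolding \<iota>(2) using \<iota>(1) by (simp add: m_def ennreal_leI flip: ennreal_mult')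
  qed
qed

context separated_exponents
begin

text \<open>Descending induction within a group eliminates the coefficients of its later members; a group has at
most \<open>N\<close> of them, so the constants stay bounded.\<close>

lemma coeff_le_hardy_tail:
  "\<exists>C>0. \<forall>K b. \<forall>i\<le>K. ennreal (cmod (b i)) \<le> ennreal C * hardy_tail (\<lambda>v. cmod (expand b K v)) (1 / (A * R) / w i)"
proof -
  define L where "L = own_const * exp (-2)"
  have L0: "L > 0" by (simp add: L_def own_const_def)
  define B where "B = 1 + kernel_const / L + real N * (cross_const / L)"
  have B1: "B \<ge> 1" using kernel_const_pos cross_const_pos L0 by (simp add: B_def)
  have "ennreal (cmod (b i)) \<le> ennreal (B ^ N) * hardy_tail (\<lambda>v. cmod (expand b K v)) (1 / (A * R) / w i)"
    if iK: "i \<le> K" for K b i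
  proof -
    let ?H = "hardy_tail (\<lambda>v. cmod (expand b K v))"
    \<comment> \<open>The point \<open>x\<close> lies below \<open>1 / w k\<close> for every \<open>k\<close> in the group, so one tail integral serves the whole group.\<close>
    define s x where "s = start i" and "x = 1 / (A * R * sh s)"
    have ARs: "A * R * sh s > 0" using A R_ge_1 sh_pos[of s] by simp
    have xw: "x \<le> 1 / w k" if "start k = s" for k
    proof -
      have "sh k \<le> R * sh s" using block_ratio[of k] that by (simp add: sh_def)
      then have "A * sh k \<le> A * (R * sh s)" using A by (intro mult_left_mono) auto
      with w_le_sh[of k] have "w k \<le> A * (R * sh s)" by (rule order.trans)
      then show ?thesis using w_pos[of k] ARs by (simp add: x_def frac_le mult.assoc)
    qed
    have xl: "1 / (A * R) / w i \<le> x"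
    proof -
      have "A * R * sh s \<le> A * R * w i"
        using sh_mono[OF start_le[of i]] sh_le_w[of i] A R_ge_1 by (intro mult_left_mono) (auto simp: s_def)
      then show ?thesis using ARs by (simp add: x_def frac_le)
    qed
    show ?thesis
    proof (cases "?H x = \<infinity>")
      case True
      have "?H x \<le> ?H (1 / (A * R) / w i)"
        using A R_ge_1 w_pos[of i] xl by (intro hardy_tail_mono) auto
      then have "?H (1 / (A * R) / w i) = \<infinity>" using True by (simp add: top_unique)
      then show ?thesis using B1 by (simp add: ennreal_mult_top)
    next
      case False
      then obtain t where t: "t \<ge> 0" "?H x = ennreal t" by (cases "?H x" rule: ennreal_cases) auto
      have step: "cmod (b k) \<le> kernel_const / L * t
          + cross_const / L * (\<Sum>k' | k < k' \<and> k' \<le> K \<and> start k' \<le> k. cmod (b k'))" if k: "k \<le> K" "start k = s" for k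
      proof -
        let ?S = "\<Sum>k' | k < k' \<and> k' \<le> K \<and> start k' \<le> k. cmod (b k')"
        have S0: "?S \<ge> 0" by (intro sum_nonneg) auto
        have "?H (1 / w k) \<le> ?H x" using xw[OF k(2)] ARs by (intro hardy_tail_mono) (auto simp: x_def)
        then have "ennreal kernel_const * ?H (1 / w k) + ennreal (cross_const * ?S)
           \<le> ennreal (kernel_const * t) + ennreal (cross_const * ?S)"
          unfolding t(2) ennreal_mult''[OF t(1)] by (intro add_right_mono mult_left_mono) auto
        with coeff_le_tail_plus_block[OF k(1), of b]
        have "ennreal (cmod (b k) * L) \<le> ennreal (kernel_const * t) + ennreal (cross_const * ?S)"
          unfolding L_def by (rule order.trans)
        then have "cmod (b k) * L \<le> kernel_const * t + cross_const * ?S"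
          using t S0 kernel_const_pos cross_const_pos by (simp flip: ennreal_plus)
        then show ?thesis using L0 by (simp add: field_simps)
      qed
      have "cmod (b k) \<le> B ^ (s + N - k) * t" if "k \<le> K" "start k = s" for k
        using that
      proof (induction "s + N - k" arbitrary: k rule: less_induct)
        case less
        have kN: "k < s + N" using less_start[of k] less.prems by simp
        obtain l where l: "s + N - k = Suc l" using kN by (metis Suc_diff_Suc)
        let ?J = "{k'. k < k' \<and> k' \<le> K \<and> start k' \<le> k}"
        have J: "start k' = s \<and> k' < s + N" if "k' \<in> ?J" for k'
          using that start_eq[of k' k] less_start[of k'] less.prems by auto
        have "?J \<subseteq> {s..<s + N}" using J start_le by fastforce
        then have cardJ: "card ?J \<le> N" using card_mono[of "{s..<s + N}" ?J] by simp
        have "(\<Sum>k'\<in>?J. cmod (b k')) \<le> (\<Sum>k'\<in>?J. B ^ l * t)"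
        proof (intro sum_mono)
          fix k' assume k': "k' \<in> ?J"
          then have "cmod (b k') \<le> B ^ (s + N - k') * t" using J[OF k'] kN by (intro less.hyps) auto
          also have "\<dots> \<le> B ^ l * t"
            using B1 t(1) k' l by (intro mult_right_mono power_increasing) auto
          finally show "cmod (b k') \<le> B ^ l * t" .
        qed
        also have "\<dots> = real (card ?J) * (B ^ l * t)" by simp
        also have "\<dots> \<le> real N * (B ^ l * t)" using cardJ B1 t(1) by (intro mult_right_mono) auto
        finally have "cmod (b k) \<le> kernel_const / L * t + cross_const / L * (real N * (B ^ l * t))"
          using step[OF less.prems] cross_const_pos L0
          by (smt (verit) divide_nonneg_pos mult_left_mono)
        also have "\<dots> \<le> kernel_const / L * (B ^ l * t) + cross_const / L * (real N * (B ^ l * t))"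
          using B1 t(1) kernel_const_pos L0
          by (intro add_right_mono mult_left_mono) (auto simp: mult_le_cancel_right1)
        also have "\<dots> = (kernel_const / L + real N * (cross_const / L)) * (B ^ l * t)"
          by (simp add: algebra_simps)
        also have "\<dots> \<le> B * (B ^ l * t)" using B1 t(1) by (intro mult_right_mono) (auto simp: B_def)
        finally show ?case by (simp add: l mult.assoc)
      qed
      then have "cmod (b i) \<le> B ^ (s + N - i) * t" using iK by (simp add: s_def)
      also have "\<dots> \<le> B ^ N * t"
        using B1 t(1) start_le[of i] by (intro mult_right_mono power_increasing) (auto simp: s_def)
      finally have "ennreal (cmod (b i)) \<le> ennreal (B ^ N) * ?H x"
        unfolding t(2) using t(1) by (simp add: ennreal_leI flip: ennreal_mult'')
      also have "\<dots> \<le> ennreal (B ^ N) * ?H (1 / (A * R) / w i)"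
        using A R_ge_1 w_pos[of i] by (intro mult_left_mono hardy_tail_mono xl) auto
      finally show ?thesis .
    qed
  qed
  then show ?thesis using B1 by (intro exI[of _ "B ^ N"]) auto
qed

text \<open>Hardy's inequality. After Holder's inequality the sum over \<open>i\<close> can be carried out under the integral,
and it is a geometric sum over the indices with \<open>w i \<ge> c / v\<close>.\<close>

lemma sum_coeff_powr_le:
  assumes \<alpha>: "\<alpha> > 0" and s: "s \<ge> 1"
  shows "\<exists>C>0. \<forall>K b. ennreal (\<Sum>i\<le>K. cmod (b i) powr s / w i powr \<alpha>)
    \<le> ennreal C * (\<integral>\<^sup>+v. ennreal (indicator {0<..} v * (cmod (expand b K v) powr s * v powr (\<alpha> - 1))) \<partial>lborel)"
proof -
  obtain C where C: "C > 0" "\<And>K b i. i \<le> K \<Longrightarrow>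
      ennreal (cmod (b i)) \<le> ennreal C * hardy_tail (\<lambda>v. cmod (expand b K v)) (1 / (A * R) / w i)"
    using coeff_le_hardy_tail by blast
  define c where "c = 1 / (A * R)"
  have c0: "c > 0" using A R_ge_1 by (simp add: c_def)
  \<comment> \<open>Small enough for the exponent \<open>a\<close> of the geometric sum to be positive.\<close>
  define \<epsilon> where "\<epsilon> = \<alpha> / (2 * s)"
  have \<epsilon>: "\<epsilon> > 0" using \<alpha> s by (simp add: \<epsilon>_def)
  define a where "a = \<alpha> - \<epsilon> * (s - 1)"
  have a0: "a > 0"
  proof -
    have "\<epsilon> * (s - 1) \<le> \<epsilon> * s" using \<epsilon> by simp
    also have "\<dots> = \<alpha> / 2" using s by (simp add: \<epsilon>_def)
    finally show ?thesis using \<alpha> by (simp add: a_def)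
  qed
  interpret W: lacunary "\<lambda>n. w n powr a" "\<rho> powr a" by (rule lacunary_powr[OF a0])
  define D1 where "D1 = (c powr (- \<epsilon>) / \<epsilon>) powr (s - 1)"
  have D10: "D1 > 0" using c0 \<epsilon> by (simp add: D1_def)
  define D2 where "D2 = c powr (- a) * (1 / (1 - 1 / \<rho> powr a))"
  have D20: "D2 > 0" using c0 less_trans[OF zero_less_one W.\<rho>] W.\<rho> by (simp add: D2_def)
  have "ennreal (\<Sum>i\<le>K. cmod (b i) powr s / w i powr \<alpha>)
    \<le> ennreal (C powr s * D1 * D2) * (\<integral>\<^sup>+v. ennreal (indicator {0<..} v * (cmod (expand b K v) powr s * v powr (\<alpha> - 1))) \<partial>lborel)"
    for K b
  proof -
    let ?g = "\<lambda>v. cmod (expand b K v)"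
    let ?h = "\<lambda>v. ?g v powr s * v powr (\<epsilon> * (s - 1) - 1)"
    have one: "ennreal (cmod (b i) powr s / w i powr \<alpha>)
      \<le> ennreal (C powr s * D1) * (\<integral>\<^sup>+v. ennreal (1 / w i powr a * (indicator {c / w i..} v * ?h v)) \<partial>lborel)"
      if i: "i \<le> K" for i
    proof -
      have "ennreal (cmod (b i) / C) = ennreal (1 / C) * ennreal (cmod (b i))"
        using C(1) by (simp flip: ennreal_mult)
      also have "\<dots> \<le> ennreal (1 / C) * (ennreal C * hardy_tail ?g (c / w i))"
        unfolding c_def by (intro mult_left_mono C(2) i) auto
      also have "\<dots> = hardy_tail ?g (c / w i)"
        using C(1) by (simp add: mult.assoc[symmetric] flip: ennreal_mult)
      finally have "ennreal ((cmod (b i) / C) powr s) \<le> ennreal (((c / w i) powr (- \<epsilon>) / \<epsilon>) powr (s - 1)) *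
        (\<integral>\<^sup>+v. ennreal (indicator {c / w i..} v * ?h v) \<partial>lborel)"
        using \<epsilon> s c0 w_pos[of i] C(1) by (intro powr_le_hardy_tail) auto
      then have "ennreal (C powr s / w i powr \<alpha>) * ennreal ((cmod (b i) / C) powr s)
        \<le> ennreal (C powr s / w i powr \<alpha>) * (ennreal (((c / w i) powr (- \<epsilon>) / \<epsilon>) powr (s - 1)) *
        (\<integral>\<^sup>+v. ennreal (indicator {c / w i..} v * ?h v) \<partial>lborel))"
        by (intro mult_left_mono) auto
      also have "ennreal (C powr s / w i powr \<alpha>) * ennreal ((cmod (b i) / C) powr s) = ennreal (cmod (b i) powr s / w i powr \<alpha>)"
        using C(1) by (simp add: powr_divide flip: ennreal_mult)
      also have "ennreal (C powr s / w i powr \<alpha>) * (ennreal (((c / w i) powr (- \<epsilon>) / \<epsilon>) powr (s - 1)) *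
        (\<integral>\<^sup>+v. ennreal (indicator {c / w i..} v * ?h v) \<partial>lborel))
        = ennreal (C powr s * D1) * (ennreal (1 / w i powr a) * (\<integral>\<^sup>+v. ennreal (indicator {c / w i..} v * ?h v) \<partial>lborel))"
      proof -
        have "((c / w i) powr (- \<epsilon>) / \<epsilon>) powr (s - 1) = D1 * w i powr (\<epsilon> * (s - 1))"
        proof -
          have "(c / w i) powr (- \<epsilon>) / \<epsilon> = (c powr (- \<epsilon>) / \<epsilon>) * w i powr \<epsilon>"
            using c0 w_pos[of i] by (simp add: powr_divide powr_minus_divide)
          then show ?thesis
            using powr_mult[of "c powr (- \<epsilon>) / \<epsilon>" "w i powr \<epsilon>" "s - 1"] by (simp only: D1_def powr_powr)
        qed
        moreover have "w i powr (\<epsilon> * (s - 1)) / w i powr \<alpha> = 1 / w i powr a"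
          using w_pos[of i] by (simp add: a_def powr_diff)
        ultimately have "C powr s / w i powr \<alpha> * ((c / w i) powr (- \<epsilon>) / \<epsilon>) powr (s - 1) = C powr s * D1 * (1 / w i powr a)"
          by (metis (no_types, opaque_lifting) mult.assoc mult.commute times_divide_eq_left times_divide_eq_right)
        then show ?thesis using D10 by (simp only: mult.assoc[symmetric]) (simp flip: ennreal_mult)
      qed
      also have "ennreal (1 / w i powr a) * (\<integral>\<^sup>+v. ennreal (indicator {c / w i..} v * ?h v) \<partial>lborel)
         = (\<integral>\<^sup>+v. ennreal (1 / w i powr a * (indicator {c / w i..} v * ?h v)) \<partial>lborel)"
        by (subst nn_integral_cmult[symmetric]) (simp_all flip: ennreal_mult')
      finally show ?thesis .
    qed
    have "ennreal (\<Sum>i\<le>K. cmod (b i) powr s / w i powr \<alpha>) = (\<Sum>i\<le>K. ennreal (cmod (b i) powr s / w i powr \<alpha>))"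
      by (simp add: sum_ennreal)
    also have "\<dots> \<le> (\<Sum>i\<le>K. ennreal (C powr s * D1) *
        (\<integral>\<^sup>+v. ennreal (1 / w i powr a * (indicator {c / w i..} v * ?h v)) \<partial>lborel))"
      by (intro sum_mono one) auto
    also have "\<dots> = ennreal (C powr s * D1) *
        (\<integral>\<^sup>+v. (\<Sum>i\<le>K. ennreal (1 / w i powr a * (indicator {c / w i..} v * ?h v))) \<partial>lborel)"
      by (subst nn_integral_sum) (simp_all add: sum_distrib_left)
    also have "\<dots> \<le> ennreal (C powr s * D1) *
        (\<integral>\<^sup>+v. ennreal D2 * ennreal (indicator {0<..} v * (?g v powr s * v powr (\<alpha> - 1))) \<partial>lborel)"
    proof (intro mult_left_mono nn_integral_mono)
      fix v :: real
      show "(\<Sum>i\<le>K. ennreal (1 / w i powr a * (indicator {c / w i..} v * ?h v)))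
        \<le> ennreal D2 * ennreal (indicator {0<..} v * (?g v powr s * v powr (\<alpha> - 1)))"
      proof (cases "v > 0")
        case False
        have "v \<notin> {c / w i..}" for i using False divide_pos_pos[OF c0 w_pos[of i]] by simp
        then show ?thesis by simp
      next
        case True
        have "(\<Sum>i\<le>K. 1 / w i powr a * (indicator {c / w i..} v * ?h v))
          = (\<Sum>i\<in>{i\<in>{..K}. c / w i \<le> v}. 1 / w i powr a) * ?h v"
          unfolding sum_distrib_right by (subst sum.inter_filter) (auto intro!: sum.cong simp: indicator_def)
        also have "\<dots> \<le> (1 / (c / v) powr a / (1 - 1 / \<rho> powr a)) * ?h v"
        proof (intro mult_right_mono W.sum_inverse_above_le)
          fix j assume "j \<in> {i \<in> {..K}. c / w i \<le> v}"
          then have "c / v \<le> w j" using True w_pos[of j] by (simp add: field_simps)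
          then show "(c / v) powr a \<le> w j powr a" using a0 c0 True by (intro powr_mono2) auto
        qed (use True c0 in auto)
        also have "\<dots> = D2 * (?g v powr s * v powr (\<alpha> - 1))"
        proof -
          have "1 / (c / v) powr a = c powr (- a) * v powr a"
            using c0 True by (simp add: powr_divide powr_minus_divide)
          moreover have "v powr a * v powr (\<epsilon> * (s - 1) - 1) = v powr (\<alpha> - 1)"
            unfolding powr_add[symmetric] by (simp add: a_def)
          ultimately show ?thesis by (simp add: D2_def mult_ac) 
        qed
        finally show ?thesis using True D20 by (simp add: sum_ennreal ennreal_leI flip: ennreal_mult')
      qed
    qed auto
    also have "\<dots> = ennreal (C powr s * D1 * D2) *
        (\<integral>\<^sup>+v. ennreal (indicator {0<..} v * (?g v powr s * v powr (\<alpha> - 1))) \<partial>lborel)"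
      using D10 D20 by (subst nn_integral_cmult) (simp_all add: mult.assoc[symmetric] flip: ennreal_mult)
    finally show ?thesis .
  qed
  then show ?thesis using C(1) D10 D20 by (intro exI[of _ "C powr s * D1 * D2"]) auto
qed

end

section \<open>The weighted measure on the unit interval\<close>

lemma nn_integral_nu:
  assumes [measurable]: "h \<in> borel_measurable borel"
  shows "(\<integral>\<^sup>+x. h x \<partial>nu a) = (\<integral>\<^sup>+x. ennreal (indicator {0..1} x * (1 - x) powr a) * h x \<partial>lborel)"
proof -
  have "(\<integral>\<^sup>+x. h x \<partial>nu a) = (\<integral>\<^sup>+x. ennreal ((1 - x) powr a) * h x \<partial>restrict_space lborel {0..1})"
    unfolding nu_def by (rule nn_integral_density) (auto intro!: measurable_restrict_space1)
  also have "\<dots> = (\<integral>\<^sup>+x. ennreal ((1 - x) powr a) * h x * indicator {0..1} x \<partial>lborel)"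
    by (rule nn_integral_restrict_space) simp
  also have "\<dots> = (\<integral>\<^sup>+x. ennreal (indicator {0..1} x * (1 - x) powr a) * h x \<partial>lborel)"
    by (intro nn_integral_cong) (auto simp: indicator_def)
  finally show ?thesis .
qed

lemma measurable_nu: "h \<in> borel_measurable borel \<Longrightarrow> h \<in> borel_measurable (nu a)"
  by (simp add: nu_def measurable_restrict_space1)

text \<open>The substitution \<open>t = exp (- u)\<close>, carried out on compact intervals and extended by monotone
convergence.\<close>

lemma nn_integral_exp_substitution_le:
  fixes h :: "real \<Rightarrow> real"
  assumes [measurable]: "h \<in> borel_measurable borel" and h0: "\<And>t. h t \<ge> 0"
  shows "(\<integral>\<^sup>+u. ennreal (indicator {0<..} u * (h (exp (- u)) * exp (- u))) \<partial>lborel)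
    \<le> (\<integral>\<^sup>+t. ennreal (indicator {0..1} t * h t) \<partial>lborel)"
proof -
  define F where "F n v = ennreal (h (exp v)) * ennreal (exp v) * indicator {- real (Suc n)..0} v" for n and v :: real
  have inc: "incseq F" by (intro incseq_SucI le_funI) (auto simp: F_def indicator_def)
  have le: "(\<integral>\<^sup>+v. F n v \<partial>lborel) \<le> (\<integral>\<^sup>+t. ennreal (indicator {0..1} t * h t) \<partial>lborel)" for n
  proof -
    have "(\<integral>\<^sup>+v. F n v \<partial>lborel) = (\<integral>\<^sup>+t. ennreal (h t) * indicator {exp (- real (Suc n))..exp 0} t \<partial>lborel)"
      unfolding F_def
      by (intro nn_integral_substitution_aux[symmetric]) (auto intro!: derivative_eq_intros continuous_intros)
    also have "\<dots> \<le> (\<integral>\<^sup>+t. ennreal (indicator {0..1} t * h t) \<partial>lborel)"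
      by (intro nn_integral_mono) (auto simp: indicator_def intro: order.trans[OF exp_ge_zero])
    finally show ?thesis .
  qed
  have "(\<integral>\<^sup>+u. ennreal (indicator {0<..} u * (h (exp (- u)) * exp (- u))) \<partial>lborel)
    = (\<integral>\<^sup>+v. ennreal (indicator {0<..} (- v) * (h (exp v) * exp v)) \<partial>lborel)"
    by (subst nn_integral_real_affine[where c = "-1" and t = 0]) auto
  also have "\<dots> \<le> (\<integral>\<^sup>+v. (SUP n. F n v) \<partial>lborel)"
  proof (intro nn_integral_mono)
    fix v :: real
    show "ennreal (indicator {0<..} (- v) * (h (exp v) * exp v)) \<le> (SUP n. F n v)"
    proof (cases "v < 0")
      case True
      obtain n where "- v \<le> real n" using real_arch_simple by blast
      then have "ennreal (indicator {0<..} (- v) * (h (exp v) * exp v)) \<le> F n v"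
        using True h0 by (simp add: F_def indicator_def ennreal_mult)
      then show ?thesis by (rule SUP_upper2[rotated]) simp
    qed simp
  qed
  also have "\<dots> = (SUP n. \<integral>\<^sup>+v. F n v \<partial>lborel)"
    by (rule nn_integral_monotone_convergence_SUP[OF inc]) (unfold F_def, measurable)
  also have "\<dots> \<le> (\<integral>\<^sup>+t. ennreal (indicator {0..1} t * h t) \<partial>lborel)"
    by (intro SUP_least le)
  finally show ?thesis .
qed

text \<open>For small \<open>u\<close> the weights \<open>u powr (\<alpha> - 1)\<close> and \<open>(1 - exp (- u)) powr (\<alpha> - 1)\<close> are comparable; for large
\<open>u\<close> the factor \<open>exp (- (\<alpha> + 1) * u)\<close> compensates their quotient and the Jacobian.\<close>

lemma nn_integral_exp_shift_le_nu:
  fixes F :: "real \<Rightarrow> real"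
  assumes \<alpha>: "\<alpha> > 0" and s: "s \<ge> 1" and F[measurable]: "F \<in> borel_measurable borel" and F0: "\<And>t. F t \<ge> 0"
  shows "(\<integral>\<^sup>+u. ennreal (indicator {0<..} u * ((exp (- ((\<alpha> + 1) * u)) * F (exp (- u))) powr s * u powr (\<alpha> - 1))) \<partial>lborel)
    \<le> (\<integral>\<^sup>+t. ennreal (F t powr s) \<partial>nu (\<alpha> - 1))"
proof -
  have "(\<integral>\<^sup>+u. ennreal (indicator {0<..} u * ((exp (- ((\<alpha> + 1) * u)) * F (exp (- u))) powr s * u powr (\<alpha> - 1))) \<partial>lborel)
    \<le> (\<integral>\<^sup>+u. ennreal (indicator {0<..} u * ((1 - exp (- u)) powr (\<alpha> - 1) * F (exp (- u)) powr s * exp (- u))) \<partial>lborel)"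
  proof (intro nn_integral_mono ennreal_leI)
    fix u :: real
    show "indicator {0<..} u * ((exp (- ((\<alpha> + 1) * u)) * F (exp (- u))) powr s * u powr (\<alpha> - 1))
      \<le> indicator {0<..} u * ((1 - exp (- u)) powr (\<alpha> - 1) * F (exp (- u)) powr s * exp (- u))"
    proof (cases "u > 0")
      case True
      define z where "z = 1 - exp (- u)"
      have z0: "0 < z" using True by (simp add: z_def)
      have zu: "z \<le> u" using exp_ge_add_one_self[of "- u"] by (simp add: z_def)
      have uz: "u \<le> exp u * z"
      proof -
        have "exp u * z = exp u - 1" by (simp add: z_def right_diff_distrib exp_minus)
        then show ?thesis using exp_ge_add_one_self[of u] by linarith
      qed
      have wt: "exp (- ((\<alpha> + 1) * u)) powr s * u powr (\<alpha> - 1) \<le> z powr (\<alpha> - 1) * exp (- u)"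
      proof -
        have e: "exp (- ((\<alpha> + 1) * u)) powr s \<le> exp (- ((\<alpha> + 1) * u))"
        proof -
          have "(\<alpha> + 1) * u * 1 \<le> (\<alpha> + 1) * u * s" using \<alpha> s True by (intro mult_left_mono) auto
          then show ?thesis by (simp add: powr_def mult_ac)
        qed
        show ?thesis
        proof (cases "\<alpha> \<ge> 1")
          case True
          have "u powr (\<alpha> - 1) \<le> (exp u * z) powr (\<alpha> - 1)" using True uz \<open>u > 0\<close> by (intro powr_mono2) auto
          also have "\<dots> = exp ((\<alpha> - 1) * u) * z powr (\<alpha> - 1)" using z0 by (simp add: powr_mult powr_def[of "exp u"])
          finally have "exp (- ((\<alpha> + 1) * u)) powr s * u powr (\<alpha> - 1)
             \<le> exp (- ((\<alpha> + 1) * u)) * (exp ((\<alpha> - 1) * u) * z powr (\<alpha> - 1))"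
            using e by (intro mult_mono) auto
          also have "\<dots> = exp (- (2 * u)) * z powr (\<alpha> - 1)"
          proof -
            have "exp (- ((\<alpha> + 1) * u)) * exp ((\<alpha> - 1) * u) = exp (- (2 * u))"
              unfolding exp_add[symmetric] by (simp add: algebra_simps)
            then show ?thesis by (simp only: mult.assoc[symmetric])
          qed
          also have "\<dots> \<le> exp (- u) * z powr (\<alpha> - 1)" using \<open>u > 0\<close> by (intro mult_right_mono) auto
          finally show ?thesis by (simp only: mult.commute[of "exp (- u)"])
        next
          case False
          have "u powr (\<alpha> - 1) \<le> z powr (\<alpha> - 1)" using False zu z0 by (intro powr_mono2') auto
          moreover have "exp (- ((\<alpha> + 1) * u)) \<le> exp (- u)" using \<alpha> True by (simp add: distrib_right)
          with e have "exp (- ((\<alpha> + 1) * u)) powr s \<le> exp (- u)" by (rule order.trans)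
          ultimately have "exp (- ((\<alpha> + 1) * u)) powr s * u powr (\<alpha> - 1) \<le> exp (- u) * z powr (\<alpha> - 1)"
            by (intro mult_mono) auto
          then show ?thesis by (simp only: mult.commute[of "exp (- u)"])
        qed
      qed
      have "(exp (- ((\<alpha> + 1) * u)) * F (exp (- u))) powr s * u powr (\<alpha> - 1)
         = (exp (- ((\<alpha> + 1) * u)) powr s * u powr (\<alpha> - 1)) * F (exp (- u)) powr s"
        using F0 by (simp add: powr_mult)
      also have "\<dots> \<le> (z powr (\<alpha> - 1) * exp (- u)) * F (exp (- u)) powr s"
        by (intro mult_right_mono wt) auto
      finally show ?thesis using True by (simp add: z_def mult_ac)
    qed simp
  qed
  also have "\<dots> \<le> (\<integral>\<^sup>+t. ennreal (indicator {0..1} t * ((1 - t) powr (\<alpha> - 1) * F t powr s)) \<partial>lborel)"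
    by (intro nn_integral_exp_substitution_le) auto
  also have "\<dots> = (\<integral>\<^sup>+t. ennreal (F t powr s) \<partial>nu (\<alpha> - 1))"
    by (subst nn_integral_nu) (simp_all add: mult.assoc[symmetric] flip: ennreal_mult)
  finally show ?thesis .
qed

text \<open>As \<open>t powr b \<le> exp (- b * (1 - t))\<close>, the integral is at most a Gamma integral.\<close>

lemma nn_integral_powr_nu_le:
  assumes \<alpha>: "\<alpha> > 0" and b: "b > 0"
  shows "(\<integral>\<^sup>+t. ennreal (t powr b) \<partial>nu (\<alpha> - 1)) \<le> ennreal (Gamma \<alpha> / b powr \<alpha>)"
proof -
  have "(\<integral>\<^sup>+t. ennreal (t powr b) \<partial>nu (\<alpha> - 1))
     = (\<integral>\<^sup>+t. ennreal (indicator {0..1} t * (1 - t) powr (\<alpha> - 1) * t powr b) \<partial>lborel)"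
    by (subst nn_integral_nu) (simp_all flip: ennreal_mult)
  also have "\<dots> \<le> (\<integral>\<^sup>+t. ennreal (indicator {0..} (1 - t) * ((1 - t) powr (\<alpha> - 1) * exp (- (b * (1 - t))))) \<partial>lborel)"
  proof (intro nn_integral_mono ennreal_leI)
    fix t :: real
    show "indicator {0..1} t * (1 - t) powr (\<alpha> - 1) * t powr b
      \<le> indicator {0..} (1 - t) * ((1 - t) powr (\<alpha> - 1) * exp (- (b * (1 - t))))"
    proof (cases "0 < t \<and> t \<le> 1")
      case True
      have "b * ln t \<le> b * (t - 1)" using True b by (intro mult_left_mono ln_le_minus_one) auto
      then have "t powr b \<le> exp (- (b * (1 - t)))" using True by (simp add: powr_def algebra_simps)
      then show ?thesis using True by (simp add: mult_left_mono)
    next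
      case False
      then show ?thesis using b by (cases "t = 0") (auto simp: indicator_def)
    qed
  qed
  also have "\<dots> = (\<integral>\<^sup>+y. ennreal (indicator {0..} y * (y powr (\<alpha> - 1) * exp (- (b * y)))) \<partial>lborel)"
    by (subst (2) nn_integral_real_affine[where c = "-1" and t = 1]) auto
  also have "\<dots> = ennreal (1 / b) * (\<integral>\<^sup>+z. ennreal (indicator {0..} (0 + 1 / b * z) *
       ((0 + 1 / b * z) powr (\<alpha> - 1) * exp (- (b * (0 + 1 / b * z))))) \<partial>lborel)"
    using b by (subst nn_integral_real_affine[where c = "1 / b" and t = 0]) auto
  also have "\<dots> = ennreal (1 / b) * (\<integral>\<^sup>+z. ennreal (1 / b powr (\<alpha> - 1)) * ennreal (indicator {0..} z * (z powr (\<alpha> - 1) / exp z)) \<partial>lborel)"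
  proof (intro arg_cong[where f = "\<lambda>x. ennreal (1 / b) * x"] nn_integral_cong)
    fix z :: real
    show "ennreal (indicator {0..} (0 + 1 / b * z) * ((0 + 1 / b * z) powr (\<alpha> - 1) * exp (- (b * (0 + 1 / b * z)))))
      = ennreal (1 / b powr (\<alpha> - 1)) * ennreal (indicator {0..} z * (z powr (\<alpha> - 1) / exp z))"
    proof (cases "z \<ge> 0")
      case True
      have "(0 + 1 / b * z) powr (\<alpha> - 1) * exp (- (b * (0 + 1 / b * z)))
        = 1 / b powr (\<alpha> - 1) * (z powr (\<alpha> - 1) / exp z)"
      proof -
        have e: "0 + 1 / b * z = z / b" by simp
        show ?thesis unfolding e using b by (simp add: powr_divide exp_minus field_simps)
      qed
      moreover have "0 \<le> 0 + 1 / b * z" using True b by simp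
      ultimately show ?thesis using True by (simp add: ennreal_mult'[symmetric])
    next
      case False
      then have "\<not> 0 \<le> z / b" using b by (simp add: zero_le_divide_iff)
      then show ?thesis using False by simp
    qed
  qed
  also have "\<dots> = ennreal (1 / b) * (ennreal (1 / b powr (\<alpha> - 1)) * ennreal (Gamma \<alpha>))"
    using nn_integral_has_integral_lebesgue[of "{0..}" "\<lambda>t. t powr (\<alpha> - 1) / exp t" "Gamma \<alpha>"] Gamma_integral_real[OF \<alpha>]
    by (simp add: nn_integral_cmult)
  also have "\<dots> = ennreal (Gamma \<alpha> / b powr \<alpha>)"
    using b Gamma_real_pos[OF \<alpha>] by (simp add: powr_diff flip: ennreal_mult)
  finally show ?thesis .
qed

lemma muntz_poly_measurable [measurable]: "muntz_poly lam I a \<in> borel_measurable borel"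
proof -
  have "muntz_poly lam I a = (\<lambda>t. indicator {0..1} t *\<^sub>R (\<Sum>k\<in>I. a k * complex_of_real (t powr lam k)))"
    by (auto simp: muntz_poly_def)
  then show ?thesis by simp
qed

lemma norm_muntz_poly_le:
  assumes pos: "lam 0 > 0" and mono: "strict_mono lam"
  shows "cmod (muntz_poly lam I a t) \<le> (\<Sum>k\<in>I. cmod (a k)) * (indicator {0..1} t * t powr lam 0)"
proof (cases "t \<in> {0..1}")
  case True
  have "cmod (muntz_poly lam I a t) \<le> (\<Sum>k\<in>I. cmod (a k * complex_of_real (t powr lam k)))"
    using True by (simp add: muntz_poly_def sum_norm_le)
  also have "\<dots> \<le> (\<Sum>k\<in>I. cmod (a k) * t powr lam 0)"
  proof (intro sum_mono)
    fix k
    have "lam 0 \<le> lam k" using mono by (simp add: strict_mono_less_eq)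
    then have "t powr lam k \<le> t powr lam 0" using True by (cases "t = 0") (auto intro: powr_mono')
    then show "cmod (a k * complex_of_real (t powr lam k)) \<le> cmod (a k) * t powr lam 0"
      by (simp add: norm_mult mult_left_mono)
  qed
  finally show ?thesis using True by (simp add: sum_distrib_right)
qed (auto simp: muntz_poly_def)

lemma integrable_muntz_poly_powr:
  assumes pos: "lam 0 > 0" and mono: "strict_mono lam" and \<alpha>: "\<alpha> > 0" and s: "s > 0"
  shows "integrable (nu (\<alpha> - 1)) (\<lambda>t. cmod (muntz_poly lam I a t) powr s)"
proof (rule integrableI_bounded)
  let ?S = "\<Sum>k\<in>I. cmod (a k)"
  have "(\<integral>\<^sup>+t. ennreal (norm (cmod (muntz_poly lam I a t) powr s)) \<partial>nu (\<alpha> - 1))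
    \<le> (\<integral>\<^sup>+t. ennreal (?S powr s) * ennreal (t powr (lam 0 * s)) \<partial>nu (\<alpha> - 1))"
  proof (intro nn_integral_mono)
    fix t
    have "cmod (muntz_poly lam I a t) \<le> ?S * t powr lam 0"
      using norm_muntz_poly_le[OF pos mono, of I a t]
      by (rule order.trans) (intro mult_left_mono, auto simp: indicator_def intro: sum_nonneg)
    then have "cmod (muntz_poly lam I a t) powr s \<le> (?S * t powr lam 0) powr s"
      using s by (intro powr_mono2) auto
    also have "\<dots> = ?S powr s * t powr (lam 0 * s)" by (simp add: powr_mult powr_powr sum_nonneg)
    finally show "ennreal (norm (cmod (muntz_poly lam I a t) powr s)) \<le> ennreal (?S powr s) * ennreal (t powr (lam 0 * s))"
      by (simp add: ennreal_leI flip: ennreal_mult)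
  qed
  also have "\<dots> = ennreal (?S powr s) * (\<integral>\<^sup>+t. ennreal (t powr (lam 0 * s)) \<partial>nu (\<alpha> - 1))"
    by (intro nn_integral_cmult measurable_nu) measurable
  also have "\<dots> \<le> ennreal (?S powr s) * ennreal (Gamma \<alpha> / (lam 0 * s) powr \<alpha>)"
    using pos s \<alpha> by (intro mult_left_mono nn_integral_powr_nu_le) auto
  also have "\<dots> < \<infinity>" by (simp add: ennreal_mult_less_top)
  finally show "(\<integral>\<^sup>+t. ennreal (norm (cmod (muntz_poly lam I a t) powr s)) \<partial>nu (\<alpha> - 1)) < \<infinity>" .
qed (intro measurable_nu, measurable)

lemma Lnorm_powr: "s > 0 \<Longrightarrow> Lnorm M s f powr s = (\<integral>x. norm (f x) powr s \<partial>M)"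
  by (simp add: Lnorm_def powr_powr)

section \<open>Muntz polynomials in the basis of divided differences\<close>

context separated_exponents
begin

definition basis_fun :: "nat \<Rightarrow> real \<Rightarrow> complex" where
  "basis_fun k = muntz_poly lam {start k..k} (\<lambda>j. complex_of_real (basis_coeff k j))"

lemma basis_fun_exp: "u \<ge> 0 \<Longrightarrow> basis_fun k (exp (- u)) = complex_of_real (newton_basis k u)"
  by (simp add: basis_fun_def muntz_poly_def newton_basis_def newton_exp_def basis_coeff_def powr_def sum_distrib_left mult_ac)

lemma norm_basis_fun_le:
  "cmod (basis_fun k t) \<le> decay_const * t powr (decay_rate * w k)"
proof (cases "t \<in> {0<..1}")
  case True
  define u where "u = - ln t"
  have u: "u \<ge> 0" "t = exp (- u)" using True by (auto simp: u_def)
  show ?thesis using newton_basis_le[OF u(1), of k] unfolding u(2) basis_fun_exp[OF u(1)] by (simp add: powr_def)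
next
  case False
  then have "basis_fun k t = 0"
    using lam_gt_0 by (cases "t = 0") (auto simp: basis_fun_def muntz_poly_def less_imp_neq)
  then show ?thesis using decay_const_pos by simp
qed

lemma Lnorm_basis_fun_le:
  assumes \<alpha>: "\<alpha> > 0" and s: "s > 0"
  shows "Lnorm (nu (\<alpha> - 1)) s (basis_fun k) powr s \<le> decay_const powr s * Gamma \<alpha> / (decay_rate * s) powr \<alpha> / w k powr \<alpha>"
proof -
  let ?B = "decay_const powr s * Gamma \<alpha> / (decay_rate * s) powr \<alpha> / w k powr \<alpha>"
  have rw: "decay_rate * w k > 0" using decay_rate_pos w_pos by simp
  have "(\<integral>\<^sup>+t. ennreal (cmod (basis_fun k t) powr s) \<partial>nu (\<alpha> - 1))
     \<le> (\<integral>\<^sup>+t. ennreal (decay_const powr s) * ennreal (t powr (decay_rate * w k * s)) \<partial>nu (\<alpha> - 1))"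
  proof (intro nn_integral_mono)
    fix t
    have "cmod (basis_fun k t) powr s \<le> (decay_const * t powr (decay_rate * w k)) powr s"
      using s norm_basis_fun_le by (intro powr_mono2) auto
    also have "\<dots> = decay_const powr s * t powr (decay_rate * w k * s)"
      using decay_const_pos by (simp add: powr_mult powr_powr)
    finally show "ennreal (cmod (basis_fun k t) powr s) \<le> ennreal (decay_const powr s) * ennreal (t powr (decay_rate * w k * s))"
      by (simp add: ennreal_leI flip: ennreal_mult)
  qed
  also have "\<dots> = ennreal (decay_const powr s) * (\<integral>\<^sup>+t. ennreal (t powr (decay_rate * w k * s)) \<partial>nu (\<alpha> - 1))"
    by (intro nn_integral_cmult measurable_nu) measurable
  also have "\<dots> \<le> ennreal (decay_const powr s) * ennreal (Gamma \<alpha> / (decay_rate * w k * s) powr \<alpha>)"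
    using rw s \<alpha> by (intro mult_left_mono nn_integral_powr_nu_le) auto
  also have "\<dots> = ennreal ?B"
    using decay_rate_pos w_pos[of k] s by (simp add: powr_mult mult_ac flip: ennreal_mult')
  finally have le: "(\<integral>\<^sup>+t. ennreal (cmod (basis_fun k t) powr s) \<partial>nu (\<alpha> - 1)) \<le> ennreal ?B" .
  have int: "integrable (nu (\<alpha> - 1)) (\<lambda>t. cmod (basis_fun k t) powr s)"
    unfolding basis_fun_def by (rule integrable_muntz_poly_powr[OF lam_pos lam_mono \<alpha> s])
  have "ennreal (\<integral>t. cmod (basis_fun k t) powr s \<partial>nu (\<alpha> - 1)) \<le> ennreal ?B"
    using le nn_integral_eq_integral[OF int] by simp
  moreover have "?B \<ge> 0" using Gamma_real_pos[OF \<alpha>] by simp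
  ultimately show ?thesis using s by (simp add: Lnorm_powr)
qed

text \<open>The basis is triangular with respect to the powers of \<open>t\<close>, with nonzero diagonal.\<close>

lemma muntz_poly_expansion:
  "\<exists>b. \<forall>t. muntz_poly lam {..K} a t = (\<Sum>i\<le>K. b i * basis_fun i t)"
proof (induction K arbitrary: a)
  case 0
  have "start 0 = 0" using start_le[of 0] by simp
  then have "muntz_poly lam {..0} a t = a 0 * basis_fun 0 t" for t
    by (simp add: basis_fun_def muntz_poly_def basis_coeff_def newton_coeff_def)
  then show ?case by (intro exI[of _ a]) simp
next
  case (Suc K)
  define K' where "K' = Suc K"
  have inj: "lam i \<noteq> lam j" if "i \<noteq> j" for i j using strict_mono_eq[OF lam_mono] that by blast
  have nz: "basis_coeff K' K' \<noteq> 0"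
    using sh_pos[of K'] inj by (auto simp: basis_coeff_def newton_coeff_def)
  \<comment> \<open>Subtracting this multiple of the last basis function removes the highest power.\<close>
  define \<beta> where "\<beta> = a K' / basis_coeff K' K'"
  define a' where "a' j = a j - (if start K' \<le> j then \<beta> * basis_coeff K' j else 0)" for j
  obtain b where b: "\<And>t. muntz_poly lam {..K} a' t = (\<Sum>i\<le>K. b i * basis_fun i t)" using Suc by blast
  have "muntz_poly lam {..K'} a t = (\<Sum>i\<le>K. b i * basis_fun i t) + \<beta> * basis_fun K' t" for t
  proof (cases "t \<in> {0..1}")
    case True
    have "basis_fun K' t = (\<Sum>j\<in>{..K'}. if start K' \<le> j then basis_coeff K' j * complex_of_real (t powr lam j) else 0)"
      using True by (simp add: basis_fun_def muntz_poly_def) (intro sum.mono_neutral_cong_left, auto)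
    then have "\<beta> * basis_fun K' t = (\<Sum>j\<in>{..K'}. (if start K' \<le> j then \<beta> * basis_coeff K' j else 0) * complex_of_real (t powr lam j))"
      by (auto simp: sum_distrib_left intro!: sum.cong)
    moreover have "a' K' = 0" using nz start_le[of K'] by (simp add: a'_def \<beta>_def)
    then have "muntz_poly lam {..K} a' t = (\<Sum>j\<in>{..K'}. a' j * complex_of_real (t powr lam j))"
      using True by (simp add: muntz_poly_def K'_def)
    ultimately have "muntz_poly lam {..K} a' t + \<beta> * basis_fun K' t = (\<Sum>j\<in>{..K'}. a j * complex_of_real (t powr lam j))"
      by (simp add: a'_def left_diff_distrib flip: sum.distrib)
    then show ?thesis using True b[of t] by (simp add: muntz_poly_def)
  qed (auto simp: muntz_poly_def basis_fun_def)
  then have "muntz_poly lam {..K'} a t = (\<Sum>i\<le>K'. (b(K' := \<beta>)) i * basis_fun i t)" for t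
    by (simp add: K'_def)
  then show ?case unfolding K'_def by blast
qed

abbreviation basis_sum :: "(nat \<Rightarrow> complex) \<Rightarrow> nat set \<Rightarrow> real \<Rightarrow> complex" where
  "basis_sum b I \<equiv> \<lambda>t. \<Sum>i\<in>I. b i * basis_fun i t"

abbreviation coeff_sum :: "real \<Rightarrow> real \<Rightarrow> (nat \<Rightarrow> complex) \<Rightarrow> nat set \<Rightarrow> real" where
  "coeff_sum \<alpha> s b I \<equiv> \<Sum>i\<in>I. cmod (b i) powr s / w i powr \<alpha>"

lemma basis_fun_sum_in_muntz_space:
  assumes fin: "finite I"
  shows "basis_sum b I \<in> muntz_space lam"
proof -
  obtain K where K: "I \<subseteq> {..K}" using fin by (meson finite_nat_set_iff_bounded_le subset_eq atMost_iff)
  define a where "a j = (\<Sum>i\<in>I. if start i \<le> j \<and> j \<le> i then b i * basis_coeff i j else 0)" for j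
  have "(\<Sum>i\<in>I. b i * basis_fun i t) = muntz_poly lam {..K} a t" for t
  proof (cases "t \<in> {0..1}")
    case True
    have "basis_fun i t = (\<Sum>j\<le>K. (if start i \<le> j \<and> j \<le> i then basis_coeff i j else 0) * complex_of_real (t powr lam j))"
      if "i \<in> I" for i
      using True K that by (simp add: basis_fun_def muntz_poly_def) (intro sum.mono_neutral_cong_left, auto)
    then have "(\<Sum>i\<in>I. b i * basis_fun i t)
      = (\<Sum>i\<in>I. \<Sum>j\<le>K. (if start i \<le> j \<and> j \<le> i then b i * basis_coeff i j else 0) * complex_of_real (t powr lam j))"
      by (auto simp: sum_distrib_left intro!: sum.cong)
    also have "\<dots> = (\<Sum>j\<le>K. a j * complex_of_real (t powr lam j))"
      by (subst sum.swap) (simp add: a_def sum_distrib_right)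
    finally show ?thesis using True by (simp add: muntz_poly_def)
  qed (auto simp: muntz_poly_def basis_fun_def)
  then show ?thesis unfolding muntz_space_def by blast
qed

lemma basis_fun_sum_powr_integrable:
  assumes "finite I" "\<alpha> > 0" "s > 0"
  shows "integrable (nu (\<alpha> - 1)) (\<lambda>t. cmod (\<Sum>i\<in>I. b i * basis_fun i t) powr s)"
proof -
  obtain K a where "basis_sum b I = muntz_poly lam {..K} a"
    using basis_fun_sum_in_muntz_space[OF assms(1), of b] unfolding muntz_space_def by blast
  then show ?thesis using integrable_muntz_poly_powr[OF lam_pos lam_mono assms(2,3), of "{..K}" a] by metis
qed

lemma sum_coeff_powr_le_Lnorm:
  assumes \<alpha>: "\<alpha> > 0" and s: "s \<ge> 1" and shift_eq: "shift = \<alpha> + 1"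
  shows "\<exists>C>0. \<forall>K b. coeff_sum \<alpha> s b {..K}
    \<le> C * Lnorm (nu (\<alpha> - 1)) s (basis_sum b {..K}) powr s"
proof -
  obtain C where C: "C > 0" "\<And>K b. ennreal (coeff_sum \<alpha> s b {..K})
    \<le> ennreal C * (\<integral>\<^sup>+v. ennreal (indicator {0<..} v * (cmod (expand b K v) powr s * v powr (\<alpha> - 1))) \<partial>lborel)"
    using sum_coeff_powr_le[OF \<alpha> s] by blast
  have "coeff_sum \<alpha> s b {..K}
    \<le> C * Lnorm (nu (\<alpha> - 1)) s (basis_sum b {..K}) powr s" for K b
  proof -
    define F where "F t = cmod (\<Sum>i\<le>K. b i * basis_fun i t)" for t
    have Fm: "F \<in> borel_measurable borel" unfolding F_def basis_fun_def by measurable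
    have int: "integrable (nu (\<alpha> - 1)) (\<lambda>t. F t powr s)"
      unfolding F_def using \<alpha> s by (intro basis_fun_sum_powr_integrable) auto
    have "cmod (expand b K v) = exp (- ((\<alpha> + 1) * v)) * F (exp (- v))" if "v > 0" for v
    proof -
      have "expand b K v = complex_of_real (exp (- (shift * v))) * (\<Sum>i\<le>K. b i * basis_fun i (exp (- v)))"
        using that by (simp add: expand_def basis_fun_exp sum_distrib_left mult_ac)
      then show ?thesis by (simp add: norm_mult F_def shift_eq)
    qed
    then have "(\<integral>\<^sup>+v. ennreal (indicator {0<..} v * (cmod (expand b K v) powr s * v powr (\<alpha> - 1))) \<partial>lborel)
       = (\<integral>\<^sup>+u. ennreal (indicator {0<..} u * ((exp (- ((\<alpha> + 1) * u)) * F (exp (- u))) powr s * u powr (\<alpha> - 1))) \<partial>lborel)"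
      by (intro nn_integral_cong) (simp add: indicator_def)
    also have "\<dots> \<le> (\<integral>\<^sup>+t. ennreal (F t powr s) \<partial>nu (\<alpha> - 1))"
      by (rule nn_integral_exp_shift_le_nu[OF \<alpha> s Fm]) (simp add: F_def)
    also have "\<dots> = ennreal (\<integral>t. F t powr s \<partial>nu (\<alpha> - 1))"
      by (intro nn_integral_eq_integral int) auto
    finally have "ennreal (coeff_sum \<alpha> s b {..K}) \<le> ennreal C * ennreal (\<integral>t. F t powr s \<partial>nu (\<alpha> - 1))"
      using C(2)[of b K] by (meson mult_left_mono order.trans zero_le)
    then have "coeff_sum \<alpha> s b {..K} \<le> C * (\<integral>t. F t powr s \<partial>nu (\<alpha> - 1))"
      using C(1) by (simp flip: ennreal_mult' add: integral_nonneg_AE)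
    then show ?thesis using s by (simp add: Lnorm_powr F_def)
  qed
  then show ?thesis using C(1) by blast
qed

end

section \<open>Groups of exponents in a quasi-lacunary sequence\<close>

lemma block_index_exists:
  fixes m :: "nat \<Rightarrow> nat"
  assumes m: "strict_mono m" "m 0 = 0"
  shows "\<exists>k. m k \<le> i \<and> i < m (Suc k)"
proof -
  have ex: "\<exists>k. i < m (Suc k)"
    using strict_mono_imp_increasing[OF m(1), of "Suc i"] by (intro exI[of _ i]) simp
  define k where "k = (LEAST k. i < m (Suc k))"
  have k: "i < m (Suc k)" unfolding k_def using ex by (rule LeastI_ex)
  have "m k \<le> i"
  proof (cases k)
    case (Suc k')
    then have "\<not> i < m (Suc k')" using not_less_Least[of k' "\<lambda>k. i < m (Suc k)"] by (simp add: k_def)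
    then show ?thesis using Suc by simp
  qed (use m in simp)
  with k show ?thesis by blast
qed

text \<open>A group starts at each index that is preceded by a gap of ratio \<open>Q\<close>. All blocks start in this way, so
a group lies in one block. Any \<open>N\<close> consecutive steps cross a gap, whence the exponents grow at least
by \<open>Q\<close> in \<open>N\<close> steps. With \<open>A\<close> and \<open>\<rho>\<close> given by \<open>A ^ (2 * N) = Q\<close> and \<open>\<rho> ^ N = A\<close>, the least majorant of
the shifted exponents that grows at least by \<open>\<rho>\<close> in each step exceeds them by a factor of at most
\<open>A\<close>.\<close>

lemma separated_exponents_exist:
  assumes pos: "\<And>k. lam k > 0" and mono: "strict_mono lam"
    and ql: "quasi_lacunary_blocks lam m" and sep: "separated_blocks lam m" and shift: "0 \<le> shift"
  shows "\<exists>w \<rho> start A R Q D c0 N. separated_exponents w \<rho> lam shift start A R Q D c0 N \<and>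
     (\<forall>i k. m k \<le> i \<longrightarrow> i < m (Suc k) \<longrightarrow> m k \<le> start i)"
proof -
  from ql obtain N where m: "strict_mono m" "m 0 = 0" and N: "N \<ge> 1"
    and card: "\<And>k. card {m k..<m (Suc k)} \<le> N"
    unfolding quasi_lacunary_blocks_def by blast
  have size: "m (Suc k) \<le> m k + N" for k using card[of k] by simp
  have m1: "m k \<ge> 1" if "k \<ge> 1" for k using m that by (metis One_nat_def Suc_le_eq strict_mono_less zero_less_one_class.zero_less_one less_le_trans)
  define sh where "sh j = lam j + shift" for j
  have shpos: "sh j > 0" for j using pos[of j] shift by (simp add: sh_def)
  have shmono: "sh i \<le> sh j" if "i \<le> j" for i j using mono that by (simp add: sh_def strict_mono_less_eq)
  obtain Q where Q: "Q > 1" "\<And>k. k \<ge> 1 \<Longrightarrow> Q * sh (m k - 1) \<le> sh (m k)"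
  proof -
    from sep obtain q1 k0 where q1: "q1 > 1" and k0: "\<And>k. k \<ge> k0 \<Longrightarrow> lam (m k) / lam (m k - 1) > q1"
      unfolding separated_blocks_def eventually_sequentially by blast
    \<comment> \<open>Finitely many early gaps may be smaller than \<open>q1\<close>, but each of them exceeds 1.\<close>
    define q2 where "q2 = Min (insert q1 ((\<lambda>k. lam (m k) / lam (m k - 1)) ` {1..<k0}))"
    have "q2 > 1"
      unfolding q2_def
    proof (subst Min_gr_iff, goal_cases)
      case 3
      have "lam (m k) / lam (m k - 1) > 1" if "k \<ge> 1" for k
        using strict_mono_less[OF mono, of "m k - 1" "m k"] m1[OF that] pos[of "m k - 1"] by simp
      then show ?case using q1 by auto
    qed auto
    have q2: "q2 * lam (m k - 1) \<le> lam (m k)" if "k \<ge> 1" for k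
    proof -
      have "q2 \<le> lam (m k) / lam (m k - 1)"
      proof (cases "k < k0")
        case True
        then show ?thesis unfolding q2_def using that by (intro Min_le) auto
      next
        case False
        have "q2 \<le> q1" unfolding q2_def by (intro Min_le) auto
        then show ?thesis using k0[of k] False by simp
      qed
      then show ?thesis using pos[of "m k - 1"] by (simp add: le_divide_eq)
    qed
    \<comment> \<open>The shift reduces the ratio of two exponents, and most of all at the smallest exponent.\<close>
    define Q where "Q = (q2 * lam 0 + shift) / (lam 0 + shift)"
    have d: "lam 0 + shift > 0" using pos[of 0] shift by simp
    have "Q > 1" using \<open>q2 > 1\<close> pos[of 0] d by (simp add: Q_def)
    moreover have "Q * sh (m k - 1) \<le> sh (m k)" if "k \<ge> 1" for k
    proof -
      define l where "l = lam (m k - 1)"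
      have l0: "lam 0 \<le> l" using mono by (simp add: l_def strict_mono_less_eq)
      have "0 \<le> shift * ((q2 - 1) * (l - lam 0))" using shift \<open>q2 > 1\<close> l0 by simp
      then have "(q2 * lam 0 + shift) * (l + shift) \<le> (q2 * l + shift) * (lam 0 + shift)" by (simp add: algebra_simps)
      then have "Q * (l + shift) \<le> q2 * l + shift" using d by (simp add: Q_def divide_le_eq)
      also have "\<dots> \<le> sh (m k)" using q2[OF that] by (simp add: sh_def l_def)
      finally show ?thesis by (simp add: sh_def l_def)
    qed
    ultimately show ?thesis using that by blast
  qed
  define brk where "brk j \<longleftrightarrow> j = 0 \<or> Q * sh (j - 1) \<le> sh j" for j
  define start where "start i = Max {j. j \<le> i \<and> brk j}" for i
  have fin: "finite {j. j \<le> i \<and> brk j}" "0 \<in> {j. j \<le> i \<and> brk j}" for i by (auto simp: brk_def)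
  have stin: "start i \<le> i" "brk (start i)" for i using Max_in[OF fin(1), of i] fin(2)[of i] unfolding start_def by blast+
  have stge: "j \<le> start i" if "j \<le> i" "brk j" for i j unfolding start_def using that fin(1) by (intro Max_ge) auto
  have brkm: "brk (m k)" for k using Q(2)[of k] m(2) by (cases "k = 0") (auto simp: brk_def)
  have block: "m k \<le> start i" if "m k \<le> i" for i k using stge[OF that brkm] .
  have near: "i < start i + N" for i
  proof -
    obtain k where k: "m k \<le> i" "i < m (Suc k)" using block_index_exists[OF m] by blast
    then show ?thesis using block[of k i] size[of k] by linarith
  qed
  have gap: "Q * sh j \<le> sh (start i)" if "j < start i" for i j
  proof -
    have "Q * sh j \<le> Q * sh (start i - 1)" using that Q(1) by (intro mult_left_mono shmono) auto
    also have "\<dots> \<le> sh (start i)" using stin(2)[of i] that by (simp add: brk_def)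
    finally show ?thesis .
  qed
  have lac: "Q * sh j \<le> sh (j + N)" for j
  proof -
    have "Q * sh j \<le> sh (start (j + N))" using near[of "j + N"] by (intro gap) simp
    also have "\<dots> \<le> sh (j + N)" by (intro shmono stin)
    finally show ?thesis .
  qed
  have ratio: "sh i \<le> Q ^ N * sh (start i)" for i
  proof -
    have "sh (start i + d) \<le> Q ^ d * sh (start i)" if "start i + d \<le> i" for d
      using that
    proof (induction d)
      case (Suc d)
      have "\<not> brk (start i + Suc d)" using stge[OF Suc.prems] by auto
      then have "sh (start i + Suc d) \<le> Q * sh (start i + d)" by (simp add: brk_def)
      also have "\<dots> \<le> Q * (Q ^ d * sh (start i))" using Suc Q(1) by (intro mult_left_mono) auto
      finally show ?case by simp
    qed simp
    from this[of "i - start i"] have "sh i \<le> Q ^ (i - start i) * sh (start i)" using stin(1)[of i] by simp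
    also have "\<dots> \<le> Q ^ N * sh (start i)"
      using near[of i] Q(1) shpos[of "start i"] by (intro mult_right_mono power_increasing) auto
    finally show ?thesis .
  qed
  define A where "A = root (2 * N) Q"
  have A: "A > 1" "A ^ (2 * N) = Q" using Q(1) N by (auto simp: A_def)
  define \<rho> where "\<rho> = root N A"
  have \<rho>: "\<rho> > 1" "\<rho> ^ N = A" using A(1) N by (auto simp: \<rho>_def)
  have AQ: "A \<le> Q" using self_le_power[of A "2 * N"] A N by simp
  have growA: "A ^ (2 * k) * sh i \<le> Q * sh (i + k)" for k i
  proof (induction k rule: less_induct)
    case (less k)
    show ?case
    proof (cases "k < N")
      case True
      have "A ^ (2 * k) \<le> A ^ (2 * N)" using True A by (intro power_increasing) auto
      then show ?thesis using A shmono[of i "i + k"] shpos[of i] Q(1) by (intro mult_mono) auto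
    next
      case False
      then obtain d where d: "k = d + N" by (metis add.commute le_Suc_ex not_less)
      have "A ^ (2 * k) * sh i = Q * (A ^ (2 * d) * sh i)" using A by (simp add: d distrib_left power_add)
      also have "\<dots> \<le> Q * (Q * sh (i + d))" using less[of d] d N Q(1) by (intro mult_left_mono) auto
      also have "\<dots> \<le> Q * sh (i + d + N)" using lac[of "i + d"] Q(1) by (intro mult_left_mono) auto
      finally show ?thesis by (simp add: d add.assoc)
    qed
  qed
  have growr: "\<rho> ^ k * sh i \<le> A * sh (i + k)" for k i
  proof (induction k rule: less_induct)
    case (less k)
    show ?case
    proof (cases "k < N")
      case True
      have "\<rho> ^ k \<le> \<rho> ^ N" using True \<rho> by (intro power_increasing) auto
      then show ?thesis using \<rho> A shmono[of i "i + k"] shpos[of i] by (intro mult_mono) auto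
    next
      case False
      then obtain d where d: "k = d + N" by (metis add.commute le_Suc_ex not_less)
      have "\<rho> ^ k * sh i = A * (\<rho> ^ d * sh i)" using \<rho> by (simp add: d power_add)
      also have "\<dots> \<le> A * (A * sh (i + d))" using less[of d] d N A(1) by (intro mult_left_mono) auto
      also have "\<dots> \<le> A * (Q * sh (i + d))" using A(1) AQ shpos[of "i + d"] by (intro mult_left_mono mult_right_mono) auto
      also have "\<dots> \<le> A * sh (i + d + N)" using lac[of "i + d"] A(1) by (intro mult_left_mono) auto
      finally show ?thesis by (simp add: d add.assoc)
    qed
  qed
  \<comment> \<open>The least majorant of the shifted exponents that grows at least by \<open>\<rho>\<close> in each step.\<close>
  define w where "w = rec_nat (sh 0) (\<lambda>j x. max (sh (Suc j)) (\<rho> * x))"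
  have w: "w 0 = sh 0" "w (Suc j) = max (sh (Suc j)) (\<rho> * w j)" for j by (auto simp: w_def)
  have wform: "\<exists>n\<le>j. w j = \<rho> ^ (j - n) * sh n" for j
  proof (induction j)
    case (Suc j)
    then obtain n where n: "n \<le> j" "w j = \<rho> ^ (j - n) * sh n" by blast
    show ?case
    proof (cases "sh (Suc j) \<le> \<rho> * w j")
      case True
      then show ?thesis using n by (intro exI[of _ n]) (auto simp: w Suc_diff_le)
    next
      case False
      then show ?thesis by (intro exI[of _ "Suc j"]) (auto simp: w)
    qed
  qed (simp add: w)
  have shw: "sh j \<le> w j" for j by (cases j) (auto simp: w)
  have wsh: "w j \<le> A * sh j" for j
  proof -
    obtain n where n: "n \<le> j" "w j = \<rho> ^ (j - n) * sh n" using wform by blast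
    then show ?thesis using growr[of "j - n" n] by simp
  qed
  define c0 where "c0 = lam 0 / (A * (lam 0 + shift))"
  have c0: "c0 > 0" using pos[of 0] shift A(1) by (auto simp: c0_def intro!: divide_pos_pos mult_pos_pos)
  have wlam: "c0 * w j \<le> lam j" for j
  proof -
    have "c0 * w j \<le> c0 * (A * sh j)" using wsh c0 by (intro mult_left_mono) auto
    also have "\<dots> = lam 0 * sh j / sh 0" using A(1) by (simp add: c0_def sh_def)
    also have "\<dots> \<le> lam j"
    proof -
      have "lam 0 * shift \<le> lam j * shift" using mono shift by (intro mult_right_mono) (auto simp: strict_mono_less_eq)
      then have "lam 0 * sh j \<le> lam j * sh 0" by (simp add: sh_def distrib_left)
      then show ?thesis using shpos[of 0] by (simp add: divide_le_eq)
    qed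
    finally show ?thesis .
  qed
  have steq: "start j = start i" if "start i \<le> j" "j \<le> i" for i j
    using stge[of "start i" j] stge[of "start j" i] stin[of i] stin[of j] that by fastforce
  have "separated_exponents w \<rho> lam shift start A (Q ^ N) Q Q c0 N"
  proof -
    have "0 < w 0" "\<rho> * w n \<le> w (Suc n)" "\<rho> ^ N \<le> A" for n using w \<rho> shpos[of 0] by auto
    then show ?thesis
      by unfold_locales (rule \<rho> pos mono shift A shw[unfolded sh_def] wsh[unfolded sh_def] growA[unfolded sh_def]
        stin near steq ratio[unfolded sh_def] Q gap[unfolded sh_def] c0 wlam | assumption)+
  qed
  then show ?thesis using block by blast
qed

section \<open>Completeness and compactness\<close>

abbreviation Lr_power :: "'a measure \<Rightarrow> real \<Rightarrow> ('a \<Rightarrow> complex) \<Rightarrow> ennreal" where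
  "Lr_power M r f \<equiv> \<integral>\<^sup>+x. ennreal (cmod (f x) powr r) \<partial>M"

text \<open>Completeness of \<open>L\<^sup>r\<close>. Along a fast subsequence the series of the powers of the increments, weighted
by \<open>2 ^ n\<close>, has finite integral, so the increments decay geometrically almost everywhere. Fatou's
lemma gives convergence of the whole sequence to the pointwise limit of the subsequence.\<close>

lemma Lr_Cauchy_imp_convergent:
  fixes M :: "'a measure" and u :: "nat \<Rightarrow> 'a \<Rightarrow> complex"
  assumes r: "r > 0" and um[measurable]: "\<And>n. u n \<in> borel_measurable M"
    and Cauchy: "\<And>\<epsilon>. \<epsilon> > 0 \<Longrightarrow> \<exists>n0. \<forall>i\<ge>n0. \<forall>j\<ge>n0. Lr_power M r (\<lambda>x. u i x - u j x) \<le> ennreal \<epsilon>"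
  shows "\<exists>g\<in>borel_measurable M. \<forall>\<epsilon>>0. \<exists>n0. \<forall>i\<ge>n0. Lr_power M r (\<lambda>x. u i x - g x) \<le> ennreal \<epsilon>"
proof -
  have "\<forall>n. \<exists>n0. \<forall>i\<ge>n0. \<forall>j\<ge>n0. Lr_power M r (\<lambda>x. u i x - u j x) \<le> ennreal ((1/4) ^ n)"
    using Cauchy by simp
  then obtain n0 where n0: "\<And>n i j. i \<ge> n0 n \<Longrightarrow> j \<ge> n0 n \<Longrightarrow>
      Lr_power M r (\<lambda>x. u i x - u j x) \<le> ennreal ((1/4) ^ n)" by metis
  \<comment> \<open>Adding up all thresholds makes both \<open>\<phi> n\<close> and \<open>\<phi> (Suc n)\<close> exceed \<open>n0 n\<close>.\<close>
  define \<phi> where "\<phi> n = n + (\<Sum>k\<le>n. n0 k)" for n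
  have \<phi>: "n0 n \<le> \<phi> n" "n0 n \<le> \<phi> (Suc n)" "n \<le> \<phi> n" for n
    using member_le_sum[of n "{..n}" n0] by (auto simp: \<phi>_def)
  define d where "d n x = u (\<phi> (Suc n)) x - u (\<phi> n) x" for n x
  have dm[measurable]: "d n \<in> borel_measurable M" for n unfolding d_def by measurable
  have "(\<integral>\<^sup>+x. (\<Sum>n. ennreal (2 ^ n * cmod (d n x) powr r)) \<partial>M) = (\<Sum>n. \<integral>\<^sup>+x. ennreal (2 ^ n * cmod (d n x) powr r) \<partial>M)"
    by (rule nn_integral_suminf) measurable
  also have "\<dots> \<le> (\<Sum>n. ennreal ((1/2) ^ n))"
  proof (intro suminf_le)
    fix n
    have "(\<integral>\<^sup>+x. ennreal (2 ^ n * cmod (d n x) powr r) \<partial>M) = ennreal (2 ^ n) * Lr_power M r (d n)"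
      by (subst nn_integral_cmult[symmetric]) (simp_all add: ennreal_mult)
    also have "\<dots> \<le> ennreal (2 ^ n) * ennreal ((1/4) ^ n)"
      unfolding d_def using n0 \<phi> by (intro mult_left_mono) auto
    also have "\<dots> = ennreal ((1/2) ^ n)"
      by (simp add: power_mult_distrib[symmetric] flip: ennreal_mult)
    finally show "(\<integral>\<^sup>+x. ennreal (2 ^ n * cmod (d n x) powr r) \<partial>M) \<le> ennreal ((1/2) ^ n)" .
  qed auto
  also have "\<dots> = ennreal 2" by (subst suminf_ennreal2) (auto simp: suminf_geometric summable_geometric)
  finally have fin: "(\<integral>\<^sup>+x. (\<Sum>n. ennreal (2 ^ n * cmod (d n x) powr r)) \<partial>M) \<noteq> \<infinity>" by (auto simp: top_unique)
  have AEfin: "AE x in M. (\<Sum>n. ennreal (2 ^ n * cmod (d n x) powr r)) \<noteq> \<infinity>"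
    by (rule nn_integral_PInf_AE[OF _ fin]) measurable
  define g where "g x = lim (\<lambda>n. u (\<phi> n) x)" for x
  have gm[measurable]: "g \<in> borel_measurable M" unfolding g_def by measurable
  have AElim: "AE x in M. (\<lambda>n. u (\<phi> n) x) \<longlonglongrightarrow> g x"
    using AEfin
  proof eventually_elim
    case (elim x)
    define S where "S = (\<Sum>n. ennreal (2 ^ n * cmod (d n x) powr r))"
    have "S \<noteq> \<infinity>" using elim by (simp only: S_def not_False_eq_True)
    then obtain b where b: "b \<ge> 0" "S = ennreal b" by (cases S rule: ennreal_cases) simp_all
    have dn: "cmod (d n x) \<le> b powr (1 / r) * ((1/2) powr (1 / r)) ^ n" for n
    proof -
      have "(\<Sum>k\<in>{n}. ennreal (2 ^ k * cmod (d k x) powr r)) \<le> S"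
        unfolding S_def by (intro sum_le_suminf) auto
      then have "2 ^ n * cmod (d n x) powr r \<le> b" using b(1) unfolding b(2) by simp
      then have "cmod (d n x) powr r \<le> b * (1/2) ^ n" by (simp add: field_simps)
      then have "(cmod (d n x) powr r) powr (1 / r) \<le> (b * (1/2) ^ n) powr (1 / r)" using r by (intro powr_mono2) auto
      also have "(b * (1/2) ^ n) powr (1 / r) = b powr (1 / r) * ((1/2) powr (1 / r)) ^ n"
      proof -
        have "(y ^ n) powr (1 / r) = (y powr (1 / r)) ^ n" if "y \<ge> 0" for y :: real
          using that by (induction n) (simp_all add: powr_mult)
        from this[of "1/2"] show ?thesis using b(1) by (simp add: powr_mult)
      qed
      finally show ?thesis using r by (simp add: powr_powr)
    qed
    have sm: "summable (\<lambda>n. b powr (1 / r) * ((1/2) powr (1 / r)) ^ n)"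
      using r powr_less_mono2[of "1 / r" "1/2" 1] by (intro summable_mult summable_geometric) auto
    have "summable (\<lambda>n. d n x)" by (rule summable_comparison_test'[OF sm, of 0]) (rule dn)
    then have "convergent (\<lambda>n. \<Sum>k<n. d k x)" by (simp add: summable_iff_convergent)
    then have "convergent (\<lambda>n. (\<Sum>k<n. d k x) + u (\<phi> 0) x)" by (intro convergent_add convergent_const)
    moreover have "(\<Sum>k<n. d k x) + u (\<phi> 0) x = u (\<phi> n) x" for n
      unfolding d_def by (subst sum_lessThan_telescope) simp
    ultimately have "convergent (\<lambda>n. u (\<phi> n) x)" by simp
    then show ?case unfolding g_def by (simp add: convergent_LIMSEQ_iff)
  qed
  have "\<exists>n0. \<forall>i\<ge>n0. Lr_power M r (\<lambda>x. u i x - g x) \<le> ennreal \<epsilon>"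
    if eps: "\<epsilon> > 0" for \<epsilon>
  proof -
    obtain n1 where n1: "\<And>i j. i \<ge> n1 \<Longrightarrow> j \<ge> n1 \<Longrightarrow> Lr_power M r (\<lambda>x. u i x - u j x) \<le> ennreal \<epsilon>"
      using Cauchy[OF eps] by blast
    have "Lr_power M r (\<lambda>x. u i x - g x) \<le> ennreal \<epsilon>" if i: "i \<ge> n1" for i
    proof -
      have "Lr_power M r (\<lambda>x. u i x - g x)
        = (\<integral>\<^sup>+x. liminf (\<lambda>n. ennreal (cmod (u i x - u (\<phi> n) x) powr r)) \<partial>M)"
        using AElim
      proof (intro nn_integral_cong_AE, eventually_elim)
        case (elim x)
        then have "(\<lambda>n. ennreal (cmod (u i x - u (\<phi> n) x) powr r)) \<longlonglongrightarrow> ennreal (cmod (u i x - g x) powr r)"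
          using r by (intro tendsto_ennrealI tendsto_powr2 tendsto_norm tendsto_diff tendsto_const) auto
        then show ?case by (intro lim_imp_Liminf[symmetric]) auto
      qed
      also have "\<dots> \<le> liminf (\<lambda>n. Lr_power M r (\<lambda>x. u i x - u (\<phi> n) x))"
        by (rule nn_integral_liminf) measurable
      also have "\<dots> \<le> ennreal \<epsilon>"
      proof (rule Liminf_le)
        have "n1 \<le> \<phi> n" if "n \<ge> n1" for n using that \<phi>(3)[of n] by simp
        then show "\<forall>\<^sub>F n in sequentially. Lr_power M r (\<lambda>x. u i x - u (\<phi> n) x) \<le> ennreal \<epsilon>"
          using n1[OF i] by (intro eventually_sequentiallyI[of n1]) auto
      qed auto
      finally show ?thesis .
    qed
    then show ?thesis by blast
  qed
  then show ?thesis using gm by blast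
qed

text \<open>Sequential compactness of a product of discs, which replaces a diagonal argument.\<close>

lemma bounded_coordinates_subseq:
  fixes c :: "nat \<Rightarrow> nat \<Rightarrow> complex"
  assumes bd: "\<And>i k. cmod (c i k) \<le> B k"
  shows "\<exists>\<sigma> l. strict_mono \<sigma> \<and> (\<forall>k. (\<lambda>i. c (\<sigma> i) k) \<longlonglongrightarrow> l k)"
proof -
  have "compact (\<Pi>\<^sub>E k\<in>UNIV. cball 0 (B k) :: complex set)"
  proof -
    have "compactin (product_topology (\<lambda>k::nat. euclidean) UNIV) (\<Pi>\<^sub>E k\<in>UNIV. cball (0::complex) (B k))"
      by (subst compactin_PiE) auto
    then show ?thesis by (simp add: euclidean_product_topology)
  qed
  then have "seq_compact (\<Pi>\<^sub>E k\<in>UNIV. cball 0 (B k) :: complex set)" by (rule compact_imp_seq_compact)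
  moreover have "c i \<in> (\<Pi>\<^sub>E k\<in>UNIV. cball 0 (B k) :: complex set)" for i using bd by (auto simp: PiE_iff)
  ultimately obtain l \<sigma> where \<sigma>: "strict_mono \<sigma>" "(c \<circ> \<sigma>) \<longlonglongrightarrow> l" by (meson seq_compactE)
  have "(\<lambda>i. c (\<sigma> i) k) \<longlonglongrightarrow> l k" for k
  proof -
    have "continuous_on UNIV (\<lambda>f::nat \<Rightarrow> complex. f k)" by simp
    then show ?thesis using continuous_on_tendsto_compose[OF _ \<sigma>(2), of UNIV "\<lambda>f. f k"] by (simp add: o_def)
  qed
  then show ?thesis using \<sigma>(1) by blast
qed

section \<open>Sublinear operators on the Muntz space\<close>

lemma
  assumes T: "sublinear_operator M lam T" and f: "f \<in> muntz_space lam" and g: "g \<in> muntz_space lam"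
  shows sublinear_measurable: "T f \<in> borel_measurable M"
    and sublinear_scale: "AE x in M. norm (T (\<lambda>t. c * f t) x) = norm c * norm (T f x)"
    and sublinear_add: "AE x in M. norm (T (\<lambda>t. f t + g t) x) \<le> norm (T f x) + norm (T g x)"
    and sublinear_diff: "AE x in M. norm (T f x - T g x) \<le> norm (T (\<lambda>t. f t - g t) x)"
  using assms unfolding sublinear_operator_def by blast+

context separated_exponents
begin

lemma basis_fun_in_muntz_space: "basis_fun k \<in> muntz_space lam"
  using basis_fun_sum_in_muntz_space[of "{k}" "\<lambda>_. 1"] by simp

lemma norm_operator_basis_fun_sum_le:
  assumes T: "sublinear_operator M lam T" and fin: "finite I"
  shows "AE x in M. cmod (T (basis_sum b I) x) \<le> (\<Sum>i\<in>I. cmod (b i) * cmod (T (basis_fun i) x))"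
  using fin
proof (induction I)
  case empty
  have "AE x in M. cmod (T (\<lambda>t. 0 * basis_fun 0 t) x) = cmod 0 * cmod (T (basis_fun 0) x)"
    by (rule sublinear_scale[OF T basis_fun_in_muntz_space basis_fun_in_muntz_space])
  then show ?case by simp
next
  case (insert k I)
  let ?f = "\<lambda>t. b k * basis_fun k t" and ?g = "basis_sum b I"
  have f: "?f \<in> muntz_space lam" using basis_fun_sum_in_muntz_space[of "{k}" b] by simp
  have g: "?g \<in> muntz_space lam" using insert by (intro basis_fun_sum_in_muntz_space)
  have "AE x in M. cmod (T (\<lambda>t. ?f t + ?g t) x) \<le> cmod (T ?f x) + cmod (T ?g x)"
    by (rule sublinear_add[OF T f g])
  moreover have "AE x in M. cmod (T ?f x) = cmod (b k) * cmod (T (basis_fun k) x)"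
    by (rule sublinear_scale[OF T basis_fun_in_muntz_space basis_fun_in_muntz_space])
  ultimately show ?case using insert.IH
    by eventually_elim (use insert in simp)
qed

lemma nn_integral_operator_le:
  assumes T: "sublinear_operator M lam T" and fin: "finite I"
    and \<alpha>: "\<alpha> > 0" and \<beta>: "\<beta> \<ge> 1" and pr: "p < r" "1 < r" "r < q" and P: "P > 0" and Qc: "Qc > 0"
    and wp: "\<And>i l. i \<in> I \<Longrightarrow> l > 0 \<Longrightarrow> emeasure M {x\<in>space M. cmod (T (basis_fun i) x) > l} \<le> ennreal (P * l powr (- p) / w i powr (\<alpha> * \<beta>))"
    and wq: "\<And>i l. i \<in> I \<Longrightarrow> l > 0 \<Longrightarrow> emeasure M {x\<in>space M. cmod (T (basis_fun i) x) > l} \<le> ennreal (Qc * l powr (- q) / w i powr (\<alpha> * \<beta>))"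
  shows "Lr_power M r (T (basis_sum b I))
    \<le> ennreal (lacunary.marcinkiewicz_const (\<rho> powr (\<alpha> * \<beta>)) p q r *
         (P powr ((q - r) / (q - p)) * Qc powr ((r - p) / (q - p))) *
         (coeff_sum \<alpha> (r / \<beta>) b I) powr \<beta>)"
proof -
  interpret X: lacunary "\<lambda>n. w n powr (\<alpha> * \<beta>)" "\<rho> powr (\<alpha> * \<beta>)" using \<alpha> \<beta> by (intro lacunary_powr) auto
  have Tm: "T (basis_fun i) \<in> borel_measurable M" for i
    by (rule sublinear_measurable[OF T basis_fun_in_muntz_space basis_fun_in_muntz_space])
  have "Lr_power M r (T (basis_sum b I))
    \<le> (\<integral>\<^sup>+x. ennreal ((\<Sum>i\<in>I. cmod (b i) * cmod (T (basis_fun i) x)) powr r) \<partial>M)"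
    using norm_operator_basis_fun_sum_le[OF T fin, of b]
    by (intro nn_integral_mono_AE, eventually_elim) (use pr in \<open>auto intro!: ennreal_leI powr_mono2\<close>)
  also have "\<dots> \<le> ennreal (X.marcinkiewicz_const p q r * (P powr ((q - r) / (q - p)) * Qc powr ((r - p) / (q - p)))
         * (\<Sum>i\<in>I. cmod (b i) powr r / w i powr (\<alpha> * \<beta>)))"
    using pr fin P Qc Tm wp wq by (intro X.nn_integral_weak_type_sum_le) auto
  also have "\<dots> \<le> ennreal (X.marcinkiewicz_const p q r * (P powr ((q - r) / (q - p)) * Qc powr ((r - p) / (q - p)))
         * coeff_sum \<alpha> (r / \<beta>) b I powr \<beta>)"
  proof (intro ennreal_leI mult_left_mono)
    have "(\<Sum>i\<in>I. cmod (b i) powr r / w i powr (\<alpha> * \<beta>)) = (\<Sum>i\<in>I. (cmod (b i) powr (r / \<beta>) / w i powr \<alpha>) powr \<beta>)"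
      using \<beta> by (intro sum.cong refl) (simp add: powr_divide powr_powr)
    also have "\<dots> \<le> coeff_sum \<alpha> (r / \<beta>) b I powr \<beta>"
      using fin \<beta> by (intro sum_powr_le_powr_sum) auto
    finally show "(\<Sum>i\<in>I. cmod (b i) powr r / w i powr (\<alpha> * \<beta>)) \<le> coeff_sum \<alpha> (r / \<beta>) b I powr \<beta>" .
  qed (use X.marcinkiewicz_const_pos[of r p q] pr in \<open>auto intro!: mult_nonneg_nonneg\<close>)
  finally show ?thesis .
qed

text \<open>The weighted \<open>\<ell>\<^sup>s\<close> bound on the coordinates makes them converge along a subsequence. A difference of
two members is split at the index \<open>i0\<close>: the finitely many low coordinates converge, and \<open>T\<close> is small
on the rest.\<close>

lemma compact_operator_if_tails_small:
  assumes T: "sublinear_operator M lam T" and mem: "\<And>f. f \<in> muntz_space lam \<Longrightarrow> memLp M r (T f)"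
    and r: "r > 1" and \<beta>: "\<beta> \<ge> 1" and s: "r / \<beta> \<ge> 1"
    and C: "C > 0" "\<And>K b. coeff_sum \<alpha> (r / \<beta>) b {..K}
      \<le> C * Lnorm (nu (\<alpha> - 1)) (r / \<beta>) (basis_sum b {..K}) powr (r / \<beta>)"
    and D: "D1 > 0" "\<And>I b. finite I \<Longrightarrow> Lr_power M r (T (basis_sum b I))
      \<le> ennreal (D1 * coeff_sum \<alpha> (r / \<beta>) b I powr \<beta>)"
    and small: "\<And>\<epsilon>. \<epsilon> > 0 \<Longrightarrow> \<exists>i0. \<forall>I b. finite I \<longrightarrow> I \<subseteq> {i0..} \<longrightarrow>
      Lr_power M r (T (basis_sum b I))
      \<le> ennreal (\<epsilon> * coeff_sum \<alpha> (r / \<beta>) b I powr \<beta>)"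
  shows "compact_operator \<alpha> \<beta> M lam T r"
  unfolding compact_operator_def
proof (intro conjI ballI allI impI)
  fix f :: "nat \<Rightarrow> real \<Rightarrow> complex"
  assume "(\<forall>i. f i \<in> muntz_space lam) \<and> (\<exists>B. \<forall>i. Lnorm (nu (\<alpha> - 1)) (r / \<beta>) (f i) \<le> B)"
  then obtain B where f: "\<And>i. f i \<in> muntz_space lam" and B: "\<And>i. Lnorm (nu (\<alpha> - 1)) (r / \<beta>) (f i) \<le> B" by blast
  define e where "e = r / \<beta>"
  have e1: "e \<ge> 1" using s by (simp add: e_def)
  have "\<exists>K b. f i = basis_sum b {..K}" for i
  proof -
    obtain K a where fi: "f i = muntz_poly lam {..K} a" using f[of i] unfolding muntz_space_def by blast
    obtain b where "\<And>t. muntz_poly lam {..K} a t = (\<Sum>k\<le>K. b k * basis_fun k t)" using muntz_poly_expansion[of K a] by blast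
    then have "f i = basis_sum b {..K}" unfolding fi by (intro ext)
    then show ?thesis by blast
  qed
  then obtain K b where fb: "\<And>i. f i = basis_sum (b i) {..K i}" by metis
  define c where "c i k = (if k \<le> K i then b i k else 0)" for i k
  define wt where "wt k z = cmod z powr e / w k powr \<alpha>" for k z
  have wt0: "wt k z \<ge> 0" for k z by (simp add: wt_def)
  have fc: "f i = basis_sum (c i) {..L}" if "K i \<le> L" for i L
    unfolding fb c_def using that by (intro ext sum.mono_neutral_cong_left) auto
  define Y where "Y = C * B powr e"
  have csum: "(\<Sum>k\<in>I. wt k (c i k)) \<le> Y" if "finite I" for i I
  proof -
    have "(\<Sum>k\<in>I. wt k (c i k)) \<le> (\<Sum>k\<in>I \<union> {..K i}. wt k (c i k))"
      using that wt0 by (intro sum_mono2) auto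
    also have "\<dots> = (\<Sum>k\<le>K i. wt k (c i k))"
      using that by (intro sum.mono_neutral_right) (auto simp: c_def wt_def)
    also have "\<dots> \<le> C * Lnorm (nu (\<alpha> - 1)) e (f i) powr e"
      unfolding fc[OF order.refl] wt_def e_def by (rule C(2))
    also have "\<dots> \<le> C * B powr e"
      using B[of i] C(1) e1 by (intro mult_left_mono powr_mono2) (auto simp: e_def Lnorm_def)
    finally show ?thesis by (simp add: Y_def)
  qed
  have "cmod (c i k) \<le> (Y * w k powr \<alpha>) powr (1 / e)" for i k
  proof -
    have "cmod (c i k) powr e \<le> Y * w k powr \<alpha>"
      using csum[of "{k}" i] w_pos[of k] by (simp add: wt_def divide_le_eq)
    then have "(cmod (c i k) powr e) powr (1 / e) \<le> (Y * w k powr \<alpha>) powr (1 / e)" using e1 by (intro powr_mono2) auto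
    then show ?thesis using e1 by (simp add: powr_powr)
  qed
  then obtain \<sigma> l where \<sigma>: "strict_mono \<sigma>" and l: "\<And>k. (\<lambda>i. c (\<sigma> i) k) \<longlonglongrightarrow> l k"
    using bounded_coordinates_subseq[of c "\<lambda>k. (Y * w k powr \<alpha>) powr (1 / e)"] by blast
  define Z where "Z = 2 powr (e - 1) * (Y + Y)"
  have wt_diff: "wt k (x - y) \<le> 2 powr (e - 1) * (wt k (x - z) + wt k (y - z))" for k x y z
  proof -
    have "cmod (x - y) powr e \<le> (cmod (x - z) + cmod (y - z)) powr e"
      using norm_triangle_ineq4[of "x - z" "y - z"] e1 by (intro powr_mono2) auto
    also have "\<dots> \<le> 2 powr (e - 1) * (cmod (x - z) powr e + cmod (y - z) powr e)"
      using e1 by (intro powr_add_le) auto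
    finally have "wt k (x - y) \<le> 2 powr (e - 1) * (cmod (x - z) powr e + cmod (y - z) powr e) / w k powr \<alpha>"
      unfolding wt_def by (rule divide_right_mono) simp
    then show ?thesis by (simp add: wt_def add_divide_distrib distrib_left)
  qed
  have Tf: "T (f i) \<in> borel_measurable M" for i by (rule sublinear_measurable[OF T f f])
  have Cauchy: "\<exists>n0. \<forall>i\<ge>n0. \<forall>j\<ge>n0. Lr_power M r (\<lambda>x. T (f (\<sigma> i)) x - T (f (\<sigma> j)) x) \<le> ennreal \<epsilon>"
    if \<epsilon>: "\<epsilon> > 0" for \<epsilon>
  proof -
    \<comment> \<open>The summand 1 in the denominator only serves to avoid a division by 0.\<close>
    define \<epsilon>1 where "\<epsilon>1 = \<epsilon> / 2 powr r / (1 + Z powr \<beta>)"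
    have Zp: "1 + Z powr \<beta> > 0" by (smt (verit) powr_ge_zero)
    have \<epsilon>1: "\<epsilon>1 > 0" using \<epsilon> Zp by (simp add: \<epsilon>1_def)
    obtain i0 where i0: "\<And>I b. finite I \<Longrightarrow> I \<subseteq> {i0..} \<Longrightarrow>
      Lr_power M r (T (basis_sum b I))
      \<le> ennreal (\<epsilon>1 * (\<Sum>i\<in>I. wt i (b i)) powr \<beta>)"
      using small[OF \<epsilon>1] unfolding wt_def e_def by blast
    define v where "v i = (\<Sum>k<i0. wt k (c (\<sigma> i) k - l k))" for i
    have v0: "v i \<ge> 0" for i using wt0 by (simp add: v_def sum_nonneg)
    define u where "u i = D1 * (2 powr (e - 1) * (v i + v i)) powr \<beta>" for i
    have "v \<longlonglongrightarrow> (\<Sum>k<i0. 0)"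
      unfolding v_def[abs_def]
    proof (intro tendsto_sum)
      fix k
      have "(\<lambda>i. cmod (c (\<sigma> i) k - l k)) \<longlonglongrightarrow> 0" using l[of k] by (simp add: LIM_zero tendsto_norm_zero)
      then have "(\<lambda>i. cmod (c (\<sigma> i) k - l k) powr e) \<longlonglongrightarrow> 0 powr e" using e1 by (intro tendsto_powr2 tendsto_const) auto
      then show "(\<lambda>i. wt k (c (\<sigma> i) k - l k)) \<longlonglongrightarrow> 0"
        unfolding wt_def using tendsto_divide_zero[of _ sequentially "w k powr \<alpha>"] by simp
    qed
    then have "(\<lambda>i. 2 powr (e - 1) * (v i + v i)) \<longlonglongrightarrow> 2 powr (e - 1) * (0 + 0)" by (intro tendsto_intros) simp_all
    then have "u \<longlonglongrightarrow> D1 * 0 powr \<beta>"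
      unfolding u_def[abs_def] using \<beta> v0 by (intro tendsto_mult tendsto_const tendsto_powr2) auto
    then have "u \<longlonglongrightarrow> 0" by simp
    then have "\<forall>\<^sub>F i in sequentially. u i < \<epsilon> / 2 powr r" using \<epsilon> by (intro order_tendstoD) auto
    then obtain n0 where n0: "\<And>i. i \<ge> n0 \<Longrightarrow> u i < \<epsilon> / 2 powr r" unfolding eventually_sequentially by blast
    have "Lr_power M r (\<lambda>x. T (f (\<sigma> i)) x - T (f (\<sigma> j)) x) \<le> ennreal \<epsilon>"
      if i: "i \<ge> n0" and j: "j \<ge> n0" for i j
    proof -
      define L where "L = K (\<sigma> i) + K (\<sigma> j) + i0"
      define d where "d k = c (\<sigma> i) k - c (\<sigma> j) k" for k
      let ?lo = "basis_sum d {..<i0}" and ?hi = "basis_sum d {i0..L}"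
      have split: "{..L} = {..<i0} \<union> {i0..L}" by (auto simp: L_def)
      have diff: "(\<lambda>t. f (\<sigma> i) t - f (\<sigma> j) t) = (\<lambda>t. ?lo t + ?hi t)"
      proof
        fix t
        have "f (\<sigma> i) t - f (\<sigma> j) t = (\<Sum>k\<le>L. d k * basis_fun k t)"
          using fc[of "\<sigma> i" L] fc[of "\<sigma> j" L] by (simp add: L_def d_def left_diff_distrib sum_subtractf)
        also have "\<dots> = ?lo t + ?hi t" unfolding split by (rule sum.union_disjoint) auto
        finally show "f (\<sigma> i) t - f (\<sigma> j) t = ?lo t + ?hi t" .
      qed
      have lo: "?lo \<in> muntz_space lam" and hi: "?hi \<in> muntz_space lam" by (intro basis_fun_sum_in_muntz_space; simp)+
      have lom: "T ?lo \<in> borel_measurable M" and him: "T ?hi \<in> borel_measurable M"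
        by (rule sublinear_measurable[OF T lo lo] sublinear_measurable[OF T hi hi])+
      have "AE x in M. cmod (T (f (\<sigma> i)) x - T (f (\<sigma> j)) x) \<le> cmod (T (\<lambda>t. f (\<sigma> i) t - f (\<sigma> j) t) x)"
        by (rule sublinear_diff[OF T f f])
      moreover have "AE x in M. cmod (T (\<lambda>t. ?lo t + ?hi t) x) \<le> cmod (T ?lo x) + cmod (T ?hi x)"
        by (rule sublinear_add[OF T lo hi])
      ultimately have "AE x in M. ennreal (cmod (T (f (\<sigma> i)) x - T (f (\<sigma> j)) x) powr r)
         \<le> ennreal (2 powr (r - 1)) * (ennreal (cmod (T ?lo x) powr r) + ennreal (cmod (T ?hi x) powr r))"
        unfolding diff
      proof eventually_elim
        case (elim x)
        then have "cmod (T (f (\<sigma> i)) x - T (f (\<sigma> j)) x) powr r \<le> (cmod (T ?lo x) + cmod (T ?hi x)) powr r"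
          using r by (intro powr_mono2) auto
        also have "\<dots> \<le> 2 powr (r - 1) * (cmod (T ?lo x) powr r + cmod (T ?hi x) powr r)"
          using r by (intro powr_add_le) auto
        finally show ?case by (simp add: ennreal_leI flip: ennreal_mult' ennreal_plus)
      qed
      then have "Lr_power M r (\<lambda>x. T (f (\<sigma> i)) x - T (f (\<sigma> j)) x)
        \<le> (\<integral>\<^sup>+x. ennreal (2 powr (r - 1)) * (ennreal (cmod (T ?lo x) powr r) + ennreal (cmod (T ?hi x) powr r)) \<partial>M)"
        by (rule nn_integral_mono_AE)
      also have "\<dots> = ennreal (2 powr (r - 1)) * (Lr_power M r (T ?lo) + Lr_power M r (T ?hi))"
        using lom him by (simp add: nn_integral_cmult nn_integral_add)
      also have "\<dots> \<le> ennreal (2 powr (r - 1)) * (ennreal (\<epsilon> / 2 powr r) + ennreal (\<epsilon> / 2 powr r))"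
      proof (intro mult_left_mono add_mono)
        have "(\<Sum>k<i0. wt k (d k)) \<le> 2 powr (e - 1) * (v i + v j)"
          unfolding v_def d_def sum.distrib[symmetric] sum_distrib_left by (intro sum_mono wt_diff)
        then have "(\<Sum>k<i0. wt k (d k)) powr \<beta> \<le> (2 powr (e - 1) * (v i + v j)) powr \<beta>"
          using \<beta> wt0 by (intro powr_mono2) (auto intro: sum_nonneg)
        then have "D1 * (\<Sum>k<i0. wt k (d k)) powr \<beta> \<le> D1 * (2 powr (e - 1) * (v i + v j)) powr \<beta>"
          using D(1) by (intro mult_left_mono) auto
        also have "\<dots> \<le> max (u i) (u j)"
        proof (cases "v i \<le> v j")
          case True
          then have "D1 * (2 powr (e - 1) * (v i + v j)) powr \<beta> \<le> u j"
            unfolding u_def using D(1) \<beta> v0[of i] v0[of j] by (intro mult_left_mono powr_mono2) auto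
          then show ?thesis by simp
        next
          case False
          then have "D1 * (2 powr (e - 1) * (v i + v j)) powr \<beta> \<le> u i"
            unfolding u_def using D(1) \<beta> v0[of i] v0[of j] by (intro mult_left_mono powr_mono2) auto
          then show ?thesis by simp
        qed
        also have "\<dots> \<le> \<epsilon> / 2 powr r" using n0[OF i] n0[OF j] by simp
        finally show "Lr_power M r (T ?lo) \<le> ennreal (\<epsilon> / 2 powr r)"
          using D(2)[of "{..<i0}" d] unfolding wt_def e_def by (meson ennreal_leI finite_lessThan order.trans)
      next
        have "(\<Sum>k\<in>{i0..L}. wt k (d k)) \<le> (\<Sum>k\<in>{i0..L}. 2 powr (e - 1) * (wt k (c (\<sigma> i) k) + wt k (c (\<sigma> j) k)))"
          unfolding d_def using wt_diff[where z = 0] by (intro sum_mono) simp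
        also have "\<dots> \<le> Z"
          unfolding Z_def sum_distrib_left[symmetric] sum.distrib by (intro mult_left_mono add_mono csum) auto
        finally have "(\<Sum>k\<in>{i0..L}. wt k (d k)) powr \<beta> \<le> Z powr \<beta>"
          using \<beta> wt0 by (intro powr_mono2) (auto intro: sum_nonneg)
        then have "\<epsilon>1 * (\<Sum>k\<in>{i0..L}. wt k (d k)) powr \<beta> \<le> \<epsilon>1 * (1 + Z powr \<beta>)"
          using \<epsilon>1 by (intro mult_left_mono) auto
        also have "\<dots> = \<epsilon> / 2 powr r" using Zp by (simp add: \<epsilon>1_def)
        finally show "Lr_power M r (T ?hi) \<le> ennreal (\<epsilon> / 2 powr r)"
          using i0[of "{i0..L}" d] by (meson atLeastAtMost_iff atLeast_iff ennreal_leI finite_atLeastAtMost order.trans subsetI)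
      qed auto
      also have "\<dots> = ennreal \<epsilon>"
        using \<epsilon> by (simp add: powr_diff flip: ennreal_mult ennreal_plus)
      finally show ?thesis .
    qed
    then show ?thesis by blast
  qed
  obtain g where g: "g \<in> borel_measurable M"
    and glim: "\<And>\<epsilon>. \<epsilon> > 0 \<Longrightarrow> \<exists>n0. \<forall>i\<ge>n0. Lr_power M r (\<lambda>x. T (f (\<sigma> i)) x - g x) \<le> ennreal \<epsilon>"
    using Lr_Cauchy_imp_convergent[of r "\<lambda>i. T (f (\<sigma> i))" M] Tf Cauchy r by auto
  have gmem: "memLp M r g"
    unfolding memLp_def
  proof (intro conjI g integrableI_bounded)
    show "(\<lambda>x. cmod (g x) powr r) \<in> borel_measurable M" using g by measurable
    obtain i where i: "Lr_power M r (\<lambda>x. T (f (\<sigma> i)) x - g x) \<le> ennreal 1"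
      using glim[of 1] by auto
    have int: "integrable M (\<lambda>x. cmod (T (f (\<sigma> i)) x) powr r)" using mem[OF f] by (simp add: memLp_def)
    have "(\<integral>\<^sup>+x. ennreal (norm (cmod (g x) powr r)) \<partial>M)
      \<le> (\<integral>\<^sup>+x. ennreal (2 powr (r - 1)) * (ennreal (cmod (T (f (\<sigma> i)) x) powr r) + ennreal (cmod (T (f (\<sigma> i)) x - g x) powr r)) \<partial>M)"
    proof (intro nn_integral_mono)
      fix x
      have "cmod (g x) powr r \<le> (cmod (T (f (\<sigma> i)) x) + cmod (T (f (\<sigma> i)) x - g x)) powr r"
        using norm_triangle_ineq4[of "T (f (\<sigma> i)) x" "T (f (\<sigma> i)) x - g x"] r by (intro powr_mono2) auto
      also have "\<dots> \<le> 2 powr (r - 1) * (cmod (T (f (\<sigma> i)) x) powr r + cmod (T (f (\<sigma> i)) x - g x) powr r)"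
        using r by (intro powr_add_le) auto
      finally show "ennreal (norm (cmod (g x) powr r)) \<le> ennreal (2 powr (r - 1)) *
        (ennreal (cmod (T (f (\<sigma> i)) x) powr r) + ennreal (cmod (T (f (\<sigma> i)) x - g x) powr r))"
        by (simp add: ennreal_leI flip: ennreal_mult' ennreal_plus)
    qed
    also have "\<dots> = ennreal (2 powr (r - 1)) * (Lr_power M r (T (f (\<sigma> i)))
       + Lr_power M r (\<lambda>x. T (f (\<sigma> i)) x - g x))"
      using Tf g by (simp add: nn_integral_cmult nn_integral_add)
    also have "\<dots> < \<infinity>"
      using i nn_integral_eq_integral[OF int] le_less_trans[OF i]
      by (simp add: ennreal_mult_less_top)
    finally show "(\<integral>\<^sup>+x. ennreal (norm (cmod (g x) powr r)) \<partial>M) < \<infinity>" .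
  qed
  have "(\<lambda>i. Lnorm M r (\<lambda>x. T (f (\<sigma> i)) x - g x)) \<longlonglongrightarrow> 0"
  proof (rule LIMSEQ_I)
    fix \<epsilon> :: real assume \<epsilon>: "\<epsilon> > 0"
    then have "(\<epsilon> / 2) powr r > 0" by simp
    then obtain n0 where n0: "\<And>i. i \<ge> n0 \<Longrightarrow>
        Lr_power M r (\<lambda>x. T (f (\<sigma> i)) x - g x) \<le> ennreal ((\<epsilon> / 2) powr r)" using glim by blast
    have "norm (Lnorm M r (\<lambda>x. T (f (\<sigma> i)) x - g x) - 0) < \<epsilon>" if i: "i \<ge> n0" for i
    proof -
      have "(\<integral>x. cmod (T (f (\<sigma> i)) x - g x) powr r \<partial>M) \<le> (\<epsilon> / 2) powr r"
      proof (cases "integrable M (\<lambda>x. cmod (T (f (\<sigma> i)) x - g x) powr r)")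
        case True
        then show ?thesis using n0[OF i] by (simp add: nn_integral_eq_integral)
      qed (simp add: not_integrable_integral_eq)
      then have "Lnorm M r (\<lambda>x. T (f (\<sigma> i)) x - g x) \<le> ((\<epsilon> / 2) powr r) powr (1 / r)"
        unfolding Lnorm_def using r by (intro powr_mono2) auto
      also have "\<dots> = \<epsilon> / 2" using \<epsilon> r by (simp add: powr_powr)
      finally show ?thesis using \<epsilon> by (simp add: Lnorm_def)
    qed
    then show "\<exists>n0. \<forall>i\<ge>n0. norm (Lnorm M r (\<lambda>x. T (f (\<sigma> i)) x - g x) - 0) < \<epsilon>" by blast
  qed
  then show "\<exists>\<sigma> g. strict_mono \<sigma> \<and> memLp M r g \<and> (\<lambda>i. Lnorm M r (\<lambda>x. T (f (\<sigma> i)) x - g x)) \<longlonglongrightarrow> 0"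
    using \<sigma> gmem by blast
qed (use mem in blast)

end

theorem theorem1:
  fixes \<alpha> \<beta> p q r \<theta> :: real and lam :: "nat \<Rightarrow> real" and m :: "nat \<Rightarrow> nat"
  assumes "\<alpha> > 0" and "\<beta> \<ge> 1"
    and "\<And>k. lam k > 0" and "strict_mono lam" and "summable (\<lambda>k. 1 / lam k)"
    and "quasi_lacunary_blocks lam m" and "separated_blocks lam m"
    and "\<beta> \<le> p" and "p < q" and "p < r" and "r < q"
    and "0 < \<theta>" and "\<theta> < 1" and "1 / r = (1 - \<theta>) / p + \<theta> / q"
  shows "\<exists>K>0. \<forall>(\<mu> :: real measure) (T :: (real \<Rightarrow> complex) \<Rightarrow> real \<Rightarrow> complex)
           (cp :: nat \<Rightarrow> real) (cq :: nat \<Rightarrow> real) (Cp :: real) (Cq :: real).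
      sets \<mu> = sets (restrict_space borel {0..1}) \<longrightarrow>
      sublinear_operator (completion \<mu>) lam T \<longrightarrow>
      restricted_weak_type \<alpha> \<beta> (completion \<mu>) lam m T p cp \<longrightarrow>
      restricted_weak_type \<alpha> \<beta> (completion \<mu>) lam m T q cq \<longrightarrow>
      (\<forall>k. cp k \<le> Cp) \<longrightarrow> (\<forall>k. cq k \<le> Cq) \<longrightarrow>
        strong_type \<alpha> \<beta> (completion \<mu>) lam T r (K * (Cp powr (1 - \<theta>) * Cq powr \<theta>)) \<and>
        (cp \<longlonglongrightarrow> 0 \<or> cq \<longlonglongrightarrow> 0 \<longrightarrow> compact_operator \<alpha> \<beta> (completion \<mu>) lam T r)"
proof -
  define e where "e = r / \<beta>"
  have r1: "r > 1" and e1: "e \<ge> 1" and pq: "p > 0" "q > 0" and \<beta>0: "\<beta> > 0"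
    using assms by (auto simp: e_def)
  have shift: "0 \<le> \<alpha> + 1" using assms by simp
  \<comment> \<open>The shift \<open>\<alpha> + 1\<close> is the one for which the weights on the half-line and on the unit interval match.\<close>
  obtain w \<rho> start A R Q D c0 N where SE: "separated_exponents w \<rho> lam (\<alpha> + 1) start A R Q D c0 N"
    and block: "\<And>i k. m k \<le> i \<Longrightarrow> i < m (Suc k) \<Longrightarrow> m k \<le> start i"
    using separated_exponents_exist[OF assms(3,4,6,7) shift] by blast
  interpret separated_exponents w \<rho> lam "\<alpha> + 1" start A R Q D c0 N by (rule SE)
  have m: "strict_mono m" "m 0 = 0" using assms(6) by (auto simp: quasi_lacunary_blocks_def)
  have basis_fun_block: "basis_fun i \<in> block_space lam m k" if "m k \<le> i" "i < m (Suc k)" for i k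
  proof -
    have "basis_fun i = muntz_poly lam {m k..<m (Suc k)} (\<lambda>j. if j \<in> {start i..i} then complex_of_real (basis_coeff i j) else 0)"
      using block[OF that] that unfolding basis_fun_def muntz_poly_def
      by (intro ext if_cong refl sum.mono_neutral_cong_left) auto
    then show ?thesis unfolding block_space_def by blast
  qed
  define Bc where "Bc s = decay_const powr s * Gamma \<alpha> / (decay_rate * s) powr \<alpha>" for s
  have Bc0: "Bc s > 0" if "s > 0" for s
    using that decay_const_pos decay_rate_pos Gamma_real_pos[OF assms(1)] by (simp add: Bc_def)
  have Lbasis_fun: "Lnorm (nu (\<alpha> - 1)) (s / \<beta>) (basis_fun i) powr s \<le> Bc (s / \<beta>) powr \<beta> / w i powr (\<alpha> * \<beta>)" if "s > 0" for s i
  proof -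
    have "Lnorm (nu (\<alpha> - 1)) (s / \<beta>) (basis_fun i) powr s = (Lnorm (nu (\<alpha> - 1)) (s / \<beta>) (basis_fun i) powr (s / \<beta>)) powr \<beta>"
      using \<beta>0 by (simp add: powr_powr)
    also have "\<dots> \<le> (Bc (s / \<beta>) / w i powr \<alpha>) powr \<beta>"
      using Lnorm_basis_fun_le[OF assms(1), of "s / \<beta>" i] that \<beta>0 by (intro powr_mono2) (auto simp: Bc_def)
    also have "\<dots> = Bc (s / \<beta>) powr \<beta> / w i powr (\<alpha> * \<beta>)"
      using Bc0[of "s / \<beta>"] that \<beta>0 by (simp add: powr_divide powr_powr)
    finally show ?thesis .
  qed
  obtain C where C: "C > 0" "\<And>K b. coeff_sum \<alpha> e b {..K}
      \<le> C * Lnorm (nu (\<alpha> - 1)) e (basis_sum b {..K}) powr e"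
    using sum_coeff_powr_le_Lnorm[OF assms(1) e1 refl] by blast
  define mc where "mc = lacunary.marcinkiewicz_const (\<rho> powr (\<alpha> * \<beta>)) p q r"
  have mc0: "mc > 0"
  proof -
    interpret X: lacunary "\<lambda>n. w n powr (\<alpha> * \<beta>)" "\<rho> powr (\<alpha> * \<beta>)" using assms(1) \<beta>0 by (intro lacunary_powr) auto
    show ?thesis unfolding mc_def using r1 assms(10,11) by (rule X.marcinkiewicz_const_pos)
  qed
  define W where "W = mc * ((Bc (p / \<beta>) powr \<beta>) powr ((q - r) / (q - p)) * (Bc (q / \<beta>) powr \<beta>) powr ((r - p) / (q - p)))"
  have W0: "W > 0" using mc0 Bc0[of "p / \<beta>"] Bc0[of "q / \<beta>"] pq \<beta>0 by (simp add: W_def)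
  have "r * \<theta> * (q - p) = q * (r - p)"
    using assms(14) pq r1 by (simp add: field_simps)
  then have ex\<theta>: "q * ((r - p) / (q - p)) = \<theta> * r" and "p * ((q - r) / (q - p)) = (1 - \<theta>) * r"
    using assms(9) by (auto simp: field_simps)
  note ex1\<theta> = \<open>p * ((q - r) / (q - p)) = (1 - \<theta>) * r\<close>
  \<comment> \<open>For a finite set of indices whose blocks have constants at most \<open>Cp\<close> and \<open>Cq\<close>: part (i) uses all indices, part (ii) also large ones with smaller constants.\<close>
  have key: "Lr_power M r (T (basis_sum b I))
      \<le> ennreal (W * (Cp powr (1 - \<theta>) * Cq powr \<theta>) powr r * coeff_sum \<alpha> e b I powr \<beta>)"
    if T: "sublinear_operator M lam T" and Tp: "restricted_weak_type \<alpha> \<beta> M lam m T p cp"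
      and Tq: "restricted_weak_type \<alpha> \<beta> M lam m T q cq" and fin: "finite I" and C0: "Cp > 0" "Cq > 0"
      and Cpq: "\<And>i k. i \<in> I \<Longrightarrow> m k \<le> i \<Longrightarrow> i < m (Suc k) \<Longrightarrow> cp k \<le> Cp \<and> cq k \<le> Cq"
    for M :: "real measure" and T cp cq Cp Cq I b
  proof -
    have weak: "emeasure M {x\<in>space M. cmod (T (basis_fun i) x) > l} \<le> ennreal (Cs powr s * Bc (s / \<beta>) powr \<beta> * l powr (- s) / w i powr (\<alpha> * \<beta>))"
      if s: "s > 0" and Ts: "restricted_weak_type \<alpha> \<beta> M lam m T s cs" and i: "i \<in> I" and l: "l > 0"
        and Cs: "\<And>k. m k \<le> i \<Longrightarrow> i < m (Suc k) \<Longrightarrow> cs k \<le> Cs" for s cs Cs i l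
    proof -
      obtain k where k: "m k \<le> i" "i < m (Suc k)" using block_index_exists[OF m] by blast
      have "emeasure M {x\<in>space M. cmod (T (basis_fun i) x) > l}
        \<le> ennreal (cs k powr s * l powr (- s) * Lnorm (nu (\<alpha> - 1)) (s / \<beta>) (basis_fun i) powr s)"
        using Ts basis_fun_block[OF k] l unfolding restricted_weak_type_def by blast
      also have "\<dots> \<le> ennreal (Cs powr s * l powr (- s) * (Bc (s / \<beta>) powr \<beta> / w i powr (\<alpha> * \<beta>)))"
      proof -
        have "0 \<le> cs k" using Ts unfolding restricted_weak_type_def by (auto intro: less_imp_le)
        then have "cs k powr s \<le> Cs powr s" using Cs[OF k] s by (intro powr_mono2) auto
        then show ?thesis by (intro ennreal_leI mult_mono mult_right_mono Lbasis_fun s) auto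
      qed
      finally show ?thesis by (simp add: mult_ac)
    qed
    have "Lr_power M r (T (basis_sum b I))
      \<le> ennreal (mc * ((Cp powr p * Bc (p / \<beta>) powr \<beta>) powr ((q - r) / (q - p)) *
           (Cq powr q * Bc (q / \<beta>) powr \<beta>) powr ((r - p) / (q - p))) *
         (coeff_sum \<alpha> (r / \<beta>) b I) powr \<beta>)"
      unfolding mc_def
      by (rule nn_integral_operator_le[OF T fin assms(1,2,10) r1 assms(11)]) (use C0 Bc0[of "p / \<beta>"] Bc0[of "q / \<beta>"] pq \<beta>0 in \<open>auto intro!: weak[OF _ Tp] weak[OF _ Tq] simp: Cpq\<close>)
    also have "(Cp powr p * Bc (p / \<beta>) powr \<beta>) powr ((q - r) / (q - p)) *
           (Cq powr q * Bc (q / \<beta>) powr \<beta>) powr ((r - p) / (q - p))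
        = (Bc (p / \<beta>) powr \<beta>) powr ((q - r) / (q - p)) * (Bc (q / \<beta>) powr \<beta>) powr ((r - p) / (q - p))
           * (Cp powr (1 - \<theta>) * Cq powr \<theta>) powr r"
      by (simp add: powr_mult powr_powr ex\<theta> ex1\<theta> del: times_divide_eq_right)
    finally show ?thesis by (simp add: W_def e_def mult.assoc)
  qed
  define K where "K = (W * C powr \<beta>) powr (1 / r)"
  have K0: "K > 0" using W0 C(1) by (simp add: K_def)
  show ?thesis
  proof (intro exI[of _ K] conjI K0 allI impI)
    fix \<mu> :: "real measure" and T :: "(real \<Rightarrow> complex) \<Rightarrow> real \<Rightarrow> complex" and cp cq :: "nat \<Rightarrow> real" and Cp Cq :: real
    define M where "M = completion \<mu>"
    assume "sublinear_operator (completion \<mu>) lam T"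
      and "restricted_weak_type \<alpha> \<beta> (completion \<mu>) lam m T p cp"
      and "restricted_weak_type \<alpha> \<beta> (completion \<mu>) lam m T q cq"
      and cp: "\<forall>k. cp k \<le> Cp" and cq: "\<forall>k. cq k \<le> Cq"
    then have T: "sublinear_operator M lam T" and Tp: "restricted_weak_type \<alpha> \<beta> M lam m T p cp"
      and Tq: "restricted_weak_type \<alpha> \<beta> M lam m T q cq" by (simp_all add: M_def)
    have "cp 0 > 0" "cq 0 > 0" using Tp Tq unfolding restricted_weak_type_def by blast+
    with cp cq have C0: "Cp > 0" "Cq > 0" by (meson less_le_trans)+
    define G where "G = Cp powr (1 - \<theta>) * Cq powr \<theta>"
    have G0: "G > 0" using C0 by (simp add: G_def)
    have full: "Lr_power M r (T (basis_sum b I))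
      \<le> ennreal (W * G powr r * coeff_sum \<alpha> e b I powr \<beta>)" if "finite I" for I b
      unfolding G_def using cp cq C0 by (intro key[OF T Tp Tq that]) auto
    have strong: "memLp M r (T f) \<and> Lnorm M r (T f) \<le> K * G * Lnorm (nu (\<alpha> - 1)) e f" if f: "f \<in> muntz_space lam" for f
    proof -
      obtain L a where fa: "f = muntz_poly lam {..L} a" using f unfolding muntz_space_def by blast
      obtain b where b: "\<And>t. muntz_poly lam {..L} a t = (\<Sum>i\<le>L. b i * basis_fun i t)" using muntz_poly_expansion[of L a] by blast
      have fb: "f = basis_sum b {..L}" using fa b by auto
      define n where "n = Lnorm (nu (\<alpha> - 1)) e f"
      have n0: "n \<ge> 0" by (simp add: n_def Lnorm_def)
      have Tm: "T f \<in> borel_measurable M" by (rule sublinear_measurable[OF T f f])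
      have "Lr_power M r (T f)
        \<le> ennreal (W * G powr r * coeff_sum \<alpha> e b {..L} powr \<beta>)"
        unfolding fb by (rule full) simp
      also have "\<dots> \<le> ennreal (W * G powr r * (C * n powr e) powr \<beta>)"
        using C(2)[where b = b and K = L] W0 \<beta>0
        by (intro ennreal_leI mult_left_mono powr_mono2) (auto simp: n_def fb intro: sum_nonneg)
      also have "W * G powr r * (C * n powr e) powr \<beta> = (K * G * n) powr r"
      proof -
        have "(C * n powr e) powr \<beta> = C powr \<beta> * n powr r" using C(1) n0 \<beta>0 by (simp add: powr_mult powr_powr e_def)
        moreover have "K powr r = W * C powr \<beta>" using r1 W0 C(1) by (simp add: K_def powr_powr)
        ultimately show ?thesis using K0 G0 n0 by (simp add: powr_mult)
      qed
      finally have le: "Lr_power M r (T f) \<le> ennreal ((K * G * n) powr r)" .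
      have int: "integrable M (\<lambda>x. cmod (T f x) powr r)"
      proof (rule integrableI_bounded)
        show "(\<lambda>x. cmod (T f x) powr r) \<in> borel_measurable M" using Tm by measurable
        show "(\<integral>\<^sup>+x. ennreal (norm (cmod (T f x) powr r)) \<partial>M) < \<infinity>" using le_less_trans[OF le] by simp
      qed
      have "(\<integral>x. cmod (T f x) powr r \<partial>M) \<le> (K * G * n) powr r"
        using le nn_integral_eq_integral[OF int] by simp
      then have "Lnorm M r (T f) \<le> ((K * G * n) powr r) powr (1 / r)"
        unfolding Lnorm_def using r1 by (intro powr_mono2) auto
      also have "\<dots> = K * G * n" using K0 G0 n0 r1 by (simp add: powr_powr)
      finally show ?thesis using Tm int by (simp add: memLp_def n_def)
    qed
    show "strong_type \<alpha> \<beta> (completion \<mu>) lam T r (K * (Cp powr (1 - \<theta>) * Cq powr \<theta>))"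
      unfolding strong_type_def using strong K0 G0 by (auto simp: G_def M_def e_def mult.assoc)
    assume lim: "cp \<longlonglongrightarrow> 0 \<or> cq \<longlonglongrightarrow> 0"
    have "compact_operator \<alpha> \<beta> M lam T r"
    proof (rule compact_operator_if_tails_small[OF T _ r1 assms(2) e1[unfolded e_def] C[unfolded e_def] _ full[unfolded e_def]])
      show "memLp M r (T f)" if "f \<in> muntz_space lam" for f using strong[OF that] by blast
      show "0 < W * G powr r" using W0 G0 by simp
      fix \<epsilon> :: real assume \<epsilon>: "\<epsilon> > 0"
      have solve: "\<exists>\<delta>>0. W * (\<delta> powr t * X) powr r = \<epsilon>" if "t > 0" "X > 0" for t X :: real
      proof -
        let ?\<delta> = "((\<epsilon> / W) powr (1 / r) / X) powr (1 / t)"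
        have "?\<delta> powr t * X = (\<epsilon> / W) powr (1 / r)" using that \<epsilon> W0 by (simp add: powr_powr)
        then have "W * (?\<delta> powr t * X) powr r = \<epsilon>" using r1 \<epsilon> W0 by (simp add: powr_powr)
        moreover have "?\<delta> > 0" using that \<epsilon> W0 by simp
        ultimately show ?thesis by blast
      qed
      \<comment> \<open>Beyond some block, the constant tending to 0 may be replaced by one that makes the bound equal to \<open>\<epsilon>\<close>.\<close>
      have "\<exists>\<gamma>p>0. \<exists>\<gamma>q>0. W * (\<gamma>p powr (1 - \<theta>) * \<gamma>q powr \<theta>) powr r = \<epsilon> \<and>
         (\<forall>\<^sub>F k in sequentially. cp k \<le> \<gamma>p \<and> cq k \<le> \<gamma>q)"
        using lim
      proof
        assume cp0: "cp \<longlonglongrightarrow> 0"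
        obtain \<delta> where \<delta>: "\<delta> > 0" "W * (\<delta> powr (1 - \<theta>) * Cq powr \<theta>) powr r = \<epsilon>"
          using solve[of "1 - \<theta>" "Cq powr \<theta>"] assms(13) C0 by auto
        have "\<forall>\<^sub>F k in sequentially. cp k < \<delta>" using order_tendstoD(2)[OF cp0 \<delta>(1)] .
        then have "\<forall>\<^sub>F k in sequentially. cp k \<le> \<delta> \<and> cq k \<le> Cq" by eventually_elim (use cq in auto)
        then show ?thesis using \<delta> C0 by blast
      next
        assume cq0: "cq \<longlonglongrightarrow> 0"
        obtain \<delta> where \<delta>: "\<delta> > 0" "W * (\<delta> powr \<theta> * Cp powr (1 - \<theta>)) powr r = \<epsilon>"
          using solve[of \<theta> "Cp powr (1 - \<theta>)"] assms(12) C0 by auto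
        have "\<forall>\<^sub>F k in sequentially. cq k < \<delta>" using order_tendstoD(2)[OF cq0 \<delta>(1)] .
        then have "\<forall>\<^sub>F k in sequentially. cp k \<le> Cp \<and> cq k \<le> \<delta>" by eventually_elim (use cp in auto)
        moreover have "W * (Cp powr (1 - \<theta>) * \<delta> powr \<theta>) powr r = \<epsilon>" using \<delta>(2) by (simp add: mult.commute)
        ultimately show ?thesis using \<delta>(1) C0 by blast
      qed
      then obtain \<gamma>p \<gamma>q k0 where \<gamma>: "\<gamma>p > 0" "\<gamma>q > 0" "W * (\<gamma>p powr (1 - \<theta>) * \<gamma>q powr \<theta>) powr r = \<epsilon>"
        and k0: "\<And>k. k \<ge> k0 \<Longrightarrow> cp k \<le> \<gamma>p \<and> cq k \<le> \<gamma>q"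
        unfolding eventually_sequentially by blast
      have "Lr_power M r (T (basis_sum b I))
          \<le> ennreal (\<epsilon> * coeff_sum \<alpha> (r / \<beta>) b I powr \<beta>)"
        if fin: "finite I" and I: "I \<subseteq> {m k0..}" for I b
        unfolding \<gamma>(3)[symmetric] e_def[symmetric]
      proof (rule key[OF T Tp Tq fin \<gamma>(1,2)])
        fix i k assume ik: "i \<in> I" "m k \<le> i" "i < m (Suc k)"
        then have "m k0 < m (Suc k)" using I by auto
        then have "k0 \<le> k" using m(1) by (simp add: strict_mono_less)
        then show "cp k \<le> \<gamma>p \<and> cq k \<le> \<gamma>q" by (rule k0)
      qed
      then show "\<exists>i0. \<forall>I b. finite I \<longrightarrow> I \<subseteq> {i0..} \<longrightarrow>
        Lr_power M r (T (basis_sum b I))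
        \<le> ennreal (\<epsilon> * coeff_sum \<alpha> (r / \<beta>) b I powr \<beta>)" by blast
    qed
    then show "compact_operator \<alpha> \<beta> (completion \<mu>) lam T r" by (simp add: M_def)
  qed
qed

end
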